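(* Let $X$ be a complete separable connected median space of finite rank and let $G$ be a locally compact second countable group with Kazhdan's Property (T) that acts ergodically by a measure-preserving action on a standard probability space $(\Omega,\mu)$. Then for any cocycle $\alpha:G\times\Omega\to\mathrm{Isom}(X)$ there exists an $\alpha$-equivariant (measurable) section $f:\Omega\to X$. In particular, $\alpha$ is elementary.
   Context: A metric space $(X,d)$ is a median space if for all $x,y,z\in X$ the intersection $[x,y]\cap[x,z]\cap[y,z]$ is a single point $m(x,y,z)$, where $[a,b]=\{c\in X: d(a,b)=d(a,c)+d(c,b)\}$. A subset $A$ is convex if $[a,b]\subseteq A$ for all $a,b\in A$. A halfspace is a subset $\mathfrak h$ such that $\mathfrak h$ and its complement $\mathfrak h^c$ are convex; it is thick if both $\mathfrak h$ and $\mathfrak h^c$ have nonempty interior. Two halfspaces are transverse if each of $\mathfrak h_1,\mathfrak h_1^c$ meets each of $\mathfrak h_2,\mathfrak h_2^c$. The rank is the maximal number of pairwise transverse halfspaces. For $X$ complete of finite rank, the Roller compactification $\bar X$ is the closure of the image of $X\to\prod_{a,b\in X}[a,b]$, $x\mapsto(m(x,a,b))_{a,b}$, in the product topology, a compact median algebra with coordinatewise median operation and intervals $[x,y]=\{z: m(x,y,z)=z\}$. $X$ is lineal if $\bar X$ is an interval. $\mathrm{Isom}(X)$ carries the topology of pointwise convergence and its Borel structure. A (measurable, strict) cocycle is a measurable map $\alpha:G\times\Omega\to \mathrm{Isom}(X)$ such that $\alpha(g_1g_2,\omega)=\alpha(g_1,g_2.\omega)\circ\alpha(g_2,\omega)$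 for all $g_1,g_2\in G$, $\omega\in\Omega$. A section $f:\Omega\to X$ is $\alpha$-equivariant if for any $g\in G$, $f(g.\omega)=\alpha(g,\omega).f(\omega)$ for almost all $\omega$. For $X$ complete, non lineal, of finite rank, $\alpha$ is non-elementary if for any thick halfspace $\mathfrak h$ and any subset $A\subseteq\Omega$ of positive measure there exist $g\in G$ and $\omega\in A\cap g^{-1}.A$ such that $\alpha(g,\omega).\mathfrak h\subseteq\mathfrak h^c$. A cocycle is elementary if it is not non-elementary; when $X$ is lineal every cocycle is regarded as elementary. *)

theory Defs
  imports "HOL-Probability.Probability" "HOL-Library.Extended_Nat"
begin

section \<open>Median spaces\<close>

context metric_space
begin

definition metric_interval :: "'a \<Rightarrow> 'a \<Rightarrow> 'a set" where
  "metric_interval a b = {c. dist a b = dist a c + dist c b}"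

end

class median_space = metric_space +
  assumes median_ex1:
    "\<exists>!m. m \<in> metric_interval x y \<inter> metric_interval x z \<inter> metric_interval y z"

definition median :: "'a::median_space \<Rightarrow> 'a \<Rightarrow> 'a \<Rightarrow> 'a" where
  "median x y z =
     (THE m. m \<in> metric_interval x y \<inter> metric_interval x z \<inter> metric_interval y z)"

definition median_convex :: "'a::metric_space set \<Rightarrow> bool" where
  "median_convex A \<longleftrightarrow> (\<forall>a\<in>A. \<forall>b\<in>A. metric_interval a b \<subseteq> A)"

definition median_halfspace :: "'a::metric_space set \<Rightarrow> bool" where
  "median_halfspace h \<longleftrightarrow> median_convex h \<and> median_convex (- h)"

definition thick_halfspace :: "'a::metric_space set \<Rightarrow> bool" where
  "thick_halfspace h \<longleftrightarrow>
     median_halfspace h \<and> interior h \<noteq> {} \<and> interior (- h) \<noteq> {}"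

definition transverse :: "'a set \<Rightarrow> 'a set \<Rightarrow> bool" where
  "transverse h k \<longleftrightarrow>
     h \<inter> k \<noteq> {} \<and> h \<inter> - k \<noteq> {} \<and> - h \<inter> k \<noteq> {} \<and> - h \<inter> - k \<noteq> {}"

text \<open>
  The trivial halfspaces \<open>{}\<close> and \<open>UNIV\<close> are transverse to nothing; they only have the
  effect that a one-point space gets rank 1 instead of 0.
\<close>

definition median_rank :: "'a::median_space itself \<Rightarrow> enat" where
  "median_rank _ =
     (SUP \<H> \<in> {\<H> :: 'a set set. finite \<H> \<and> (\<forall>h\<in>\<H>. median_halfspace h) \<and> pairwise transverse \<H>}.
        enat (card \<H>))"

definition finite_rank :: "'a::median_space itself \<Rightarrow> bool" where
  "finite_rank X \<longleftrightarrow> median_rank X < \<infinity>"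


section \<open>Roller compactification\<close>

definition roller_embedding :: "'a::median_space \<Rightarrow> 'a \<times> 'a \<Rightarrow> 'a" where
  "roller_embedding x = (\<lambda>(a, b). median x a b)"

definition roller_compactification :: "('a::median_space \<times> 'a \<Rightarrow> 'a) set" where
  "roller_compactification =
     product_topology (\<lambda>(a, b). top_of_set (metric_interval a b)) UNIV
       closure_of range roller_embedding"

definition roller_median ::
  "('a::median_space \<times> 'a \<Rightarrow> 'a) \<Rightarrow> ('a \<times> 'a \<Rightarrow> 'a) \<Rightarrow> ('a \<times> 'a \<Rightarrow> 'a) \<Rightarrow> 'a \<times> 'a \<Rightarrow> 'a" where
  "roller_median \<xi> \<eta> \<zeta> = (\<lambda>p. median (\<xi> p) (\<eta> p) (\<zeta> p))"

definition roller_interval ::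
  "('a::median_space \<times> 'a \<Rightarrow> 'a) \<Rightarrow> ('a \<times> 'a \<Rightarrow> 'a) \<Rightarrow> ('a \<times> 'a \<Rightarrow> 'a) set" where
  "roller_interval \<xi> \<eta> = {\<zeta> \<in> roller_compactification. roller_median \<xi> \<eta> \<zeta> = \<zeta>}"

definition lineal :: "'a::median_space itself \<Rightarrow> bool" where
  "lineal _ \<longleftrightarrow>
     (\<exists>\<xi> \<in> (roller_compactification :: ('a \<times> 'a \<Rightarrow> 'a) set). \<exists>\<eta> \<in> roller_compactification.
        roller_compactification = roller_interval \<xi> \<eta>)"


section \<open>The isometry group\<close>

definition isometries :: "('a::metric_space \<Rightarrow> 'a) set" where
  "isometries = {f. surj f \<and> (\<forall>x y. dist (f x) (f y) = dist x y)}"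

text \<open>
  The topology of the function type is that of pointwise convergence, so this is the Borel
  structure of the subspace topology on the isometry group.
\<close>

definition isometry_borel :: "('a::metric_space \<Rightarrow> 'a) measure" where
  "isometry_borel = restrict_space borel isometries"


section \<open>Property (T)\<close>

text \<open>
  Topological groups are written additively, following the class \<^class>\<open>topological_group_add\<close>,
  which does not assume commutativity.  A Hilbert space is given by its carrier \<open>H\<close> and its
  operations, because Property (T) quantifies over Hilbert spaces inside a formula.
\<close>

locale complex_hilbert_space =
  fixes H :: "'h set"
    and zero :: 'h
    and add :: "'h \<Rightarrow> 'h \<Rightarrow> 'h"
    and scale :: "complex \<Rightarrow> 'h \<Rightarrow> 'h"
    and ip :: "'h \<Rightarrow> 'h \<Rightarrow> complex"
  assumes zero_closed: "zero \<in> H"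
    and add_closed: "\<lbrakk>x \<in> H; y \<in> H\<rbrakk> \<Longrightarrow> add x y \<in> H"
    and scale_closed: "x \<in> H \<Longrightarrow> scale c x \<in> H"
    and add_assoc: "\<lbrakk>x \<in> H; y \<in> H; z \<in> H\<rbrakk> \<Longrightarrow> add (add x y) z = add x (add y z)"
    and add_commute: "\<lbrakk>x \<in> H; y \<in> H\<rbrakk> \<Longrightarrow> add x y = add y x"
    and add_zero: "x \<in> H \<Longrightarrow> add x zero = x"
    and add_inverse: "x \<in> H \<Longrightarrow> add x (scale (- 1) x) = zero"
    and scale_add_right: "\<lbrakk>x \<in> H; y \<in> H\<rbrakk> \<Longrightarrow> scale c (add x y) = add (scale c x) (scale c y)"
    and scale_add_left: "x \<in> H \<Longrightarrow> scale (c + d) x = add (scale c x) (scale d x)"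
    and scale_scale: "x \<in> H \<Longrightarrow> scale c (scale d x) = scale (c * d) x"
    and scale_one: "x \<in> H \<Longrightarrow> scale 1 x = x"
    and ip_add_left: "\<lbrakk>x \<in> H; y \<in> H; z \<in> H\<rbrakk> \<Longrightarrow> ip (add x y) z = ip x z + ip y z"
    and ip_scale_left: "\<lbrakk>x \<in> H; y \<in> H\<rbrakk> \<Longrightarrow> ip (scale c x) y = c * ip x y"
    and ip_commute: "\<lbrakk>x \<in> H; y \<in> H\<rbrakk> \<Longrightarrow> ip x y = cnj (ip y x)"
    and ip_pos: "\<lbrakk>x \<in> H; x \<noteq> zero\<rbrakk> \<Longrightarrow> Re (ip x x) > 0"
    and complete:
      "\<lbrakk>\<And>n. s n \<in> H;
        \<And>e. e > 0 \<Longrightarrow> \<exists>N. \<forall>m\<ge>N. \<forall>n\<ge>N.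
           sqrt (Re (ip (add (s m) (scale (- 1) (s n))) (add (s m) (scale (- 1) (s n))))) < e\<rbrakk>
       \<Longrightarrow> \<exists>x\<in>H. (\<lambda>n. sqrt (Re (ip (add (s n) (scale (- 1) x)) (add (s n) (scale (- 1) x)))))
              \<longlonglongrightarrow> 0"
begin

definition hnorm :: "'h \<Rightarrow> real" where
  "hnorm x = sqrt (Re (ip x x))"

definition hdiff :: "'h \<Rightarrow> 'h \<Rightarrow> 'h" where
  "hdiff x y = add x (scale (- 1) y)"

end

text \<open>
  Surjectivity of \<open>\<pi> g\<close> follows from the homomorphism property.
\<close>

locale unitary_representation = complex_hilbert_space H zero add scale ip
  for H :: "'h set" and zero add scale ip +
  fixes \<pi> :: "'g::topological_group_add \<Rightarrow> 'h \<Rightarrow> 'h"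
  assumes rep_closed: "x \<in> H \<Longrightarrow> \<pi> g x \<in> H"
    and rep_add: "\<lbrakk>x \<in> H; y \<in> H\<rbrakk> \<Longrightarrow> \<pi> g (add x y) = add (\<pi> g x) (\<pi> g y)"
    and rep_scale: "x \<in> H \<Longrightarrow> \<pi> g (scale c x) = scale c (\<pi> g x)"
    and rep_ip: "\<lbrakk>x \<in> H; y \<in> H\<rbrakk> \<Longrightarrow> ip (\<pi> g x) (\<pi> g y) = ip x y"
    and rep_id: "x \<in> H \<Longrightarrow> \<pi> 0 x = x"
    and rep_mult: "x \<in> H \<Longrightarrow> \<pi> (g + h) x = \<pi> g (\<pi> h x)"
    and rep_continuous: "x \<in> H \<Longrightarrow> ((\<lambda>h. hnorm (hdiff (\<pi> h x) (\<pi> g x))) \<longlongrightarrow> 0) (at g)"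
begin

definition almost_invariant :: "'g set \<Rightarrow> real \<Rightarrow> 'h \<Rightarrow> bool" where
  "almost_invariant Q \<epsilon> v \<longleftrightarrow>
     v \<in> H \<and> v \<noteq> zero \<and> (\<forall>g\<in>Q. hnorm (hdiff (\<pi> g v) v) < \<epsilon> * hnorm v)"

definition has_invariant_vector :: bool where
  "has_invariant_vector \<longleftrightarrow> (\<exists>v\<in>H. v \<noteq> zero \<and> (\<forall>g. \<pi> g v = v))"

end

text \<open>
  Hilbert spaces with underlying set in \<open>'g \<Rightarrow> complex\<close> represent all Hilbert spaces that
  matter: an almost invariant vector \<open>\<xi>\<close> of an arbitrary representation is almost invariant in
  the closed subrepresentation generated by \<open>\<xi>\<close>, an invariant vector of the latter is invariant
  in the former, and on the latter the map \<open>v \<mapsto> (\<lambda>g. \<langle>v, \<pi> g \<xi>\<rangle>)\<close> is an injection into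
  \<open>'g \<Rightarrow> complex\<close> along which the structure can be transported.
\<close>

definition property_T :: "'g::topological_group_add itself \<Rightarrow> bool" where
  "property_T _ \<longleftrightarrow>
     (\<exists>(Q :: 'g set) \<epsilon>. compact Q \<and> \<epsilon> > 0 \<and>
        (\<forall>(H :: ('g \<Rightarrow> complex) set) zero add scale ip (\<pi> :: 'g \<Rightarrow> _).
           unitary_representation H zero add scale ip \<pi> \<longrightarrow>
           (\<exists>v. unitary_representation.almost_invariant H zero add scale ip \<pi> Q \<epsilon> v) \<longrightarrow>
           unitary_representation.has_invariant_vector H zero \<pi>))"


section \<open>Actions on standard probability spaces\<close>

definition standard_borel :: "'w measure \<Rightarrow> bool" where
  "standard_borel M \<longleftrightarrow>
     (\<exists>T. topspace T = space M \<and> completely_metrizable_space T \<and> second_countable T \<and>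
          sets M = sigma_sets (space M) {U. openin T U})"

locale pmp_action = prob_space M
  for M :: "'w measure" +
  fixes act :: "'g::topological_group_add \<Rightarrow> 'w \<Rightarrow> 'w"
  assumes act_measurable: "(\<lambda>(g, \<omega>). act g \<omega>) \<in> measurable (borel \<Otimes>\<^sub>M M) M"
    and act_zero: "\<omega> \<in> space M \<Longrightarrow> act 0 \<omega> = \<omega>"
    and act_plus: "\<omega> \<in> space M \<Longrightarrow> act (g + h) \<omega> = act g (act h \<omega>)"
    and act_preserving: "distr M M (act g) = M"

definition ergodic_action :: "'w measure \<Rightarrow> ('g \<Rightarrow> 'w \<Rightarrow> 'w) \<Rightarrow> bool" where
  "ergodic_action M act \<longleftrightarrow>
     (\<forall>A\<in>sets M. (\<forall>g. act g -` A \<inter> space M = A) \<longrightarrow> measure M A = 0 \<or> measure M A = 1)"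


section \<open>Cocycles\<close>

definition isometric_cocycle ::
  "'w measure \<Rightarrow> ('g::topological_group_add \<Rightarrow> 'w \<Rightarrow> 'w) \<Rightarrow>
   ('g \<Rightarrow> 'w \<Rightarrow> 'a::metric_space \<Rightarrow> 'a) \<Rightarrow> bool" where
  "isometric_cocycle M act \<alpha> \<longleftrightarrow>
     (\<lambda>(g, \<omega>). \<alpha> g \<omega>) \<in> measurable (borel \<Otimes>\<^sub>M M) isometry_borel \<and>
     (\<forall>g h. \<forall>\<omega>\<in>space M. \<alpha> (g + h) \<omega> = \<alpha> g (act h \<omega>) \<circ> \<alpha> h \<omega>)"

definition equivariant_section ::
  "'w measure \<Rightarrow> ('g \<Rightarrow> 'w \<Rightarrow> 'w) \<Rightarrow> ('g \<Rightarrow> 'w \<Rightarrow> 'a \<Rightarrow> 'a) \<Rightarrow> ('w \<Rightarrow> 'a) \<Rightarrow> bool" where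
  "equivariant_section M act \<alpha> f \<longleftrightarrow> (\<forall>g. AE \<omega> in M. f (act g \<omega>) = \<alpha> g \<omega> (f \<omega>))"

definition nonelementary_cocycle ::
  "'w measure \<Rightarrow> ('g \<Rightarrow> 'w \<Rightarrow> 'w) \<Rightarrow> ('g \<Rightarrow> 'w \<Rightarrow> 'a::median_space \<Rightarrow> 'a) \<Rightarrow> bool" where
  "nonelementary_cocycle M act \<alpha> \<longleftrightarrow>
     \<not> lineal TYPE('a) \<and>
     (\<forall>h. thick_halfspace h \<longrightarrow>
        (\<forall>A\<in>sets M. measure M A > 0 \<longrightarrow>
           (\<exists>g. \<exists>\<omega>\<in>A. act g \<omega> \<in> A \<and> \<alpha> g \<omega> ` h \<subseteq> - h)))"

definition elementary_cocycle ::
  "'w measure \<Rightarrow> ('g \<Rightarrow> 'w \<Rightarrow> 'w) \<Rightarrow> ('g \<Rightarrow> 'w \<Rightarrow> 'a::median_space \<Rightarrow> 'a) \<Rightarrow> bool" where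
  "elementary_cocycle M act \<alpha> \<longleftrightarrow> \<not> nonelementary_cocycle M act \<alpha>"

end

theory Submission
  imports Defs
begin

text \<open>
  Property (T) is used through kernels.  On a median space the function \<open>exp (- t * dist x y)\<close> is
  positive definite (\<open>exp_dist_positive_definite\<close>), because the metric of a finite subset is a sum of
  weighted cuts.  Let \<open>F g\<close> be the image under the group element \<open>g\<close> of a constant section, for the
  action that the cocycle defines on sections, and let \<open>psi t g h\<close> be the mean of
  \<open>exp (- t * dist (F g w) (F h w))\<close>.  This is a left invariant positive definite kernel on the group;
  it is continuous by a Steinhaus argument (\<open>psi_continuous\<close>), and for small \<open>t\<close> it is close to one
  on a given compact set (\<open>psi_near_one\<close>).  Hence the translation representation on its Hilbert space
  has almost invariant vectors, and by Property (T) a nonzero invariant one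
  (\<open>property_T_invariant_function\<close>).

  Finite combinations of the vectors given by the sections \<open>F g\<close> approximate the invariant vector.
  At a point \<open>w\<close> of the probability space such a combination is a sum of exponential bumps
  \<open>exp (- t * dist (F g w) x)\<close> in the variable \<open>x\<close>.  For almost every \<open>w\<close> a fast sequence of
  combinations converges uniformly to a function \<open>field w\<close>, which vanishes at infinity.  Invariance of
  the vector means that the cocycle carries \<open>field w\<close> to \<open>field (act g w)\<close>
  (\<open>field_equivariant\<close>), and by ergodicity \<open>field w\<close> is almost never identically zero
  (\<open>AE_support_set\<close>).

  It remains to choose, naturally and measurably, a point from a nonzero function that vanishes at
  infinity.  A halfspace is said to have the majority if the function, used as a weight, reaches
  deeper into it than into its complement.  Majority halfspaces meet pairwise, so by a Helly argument
  their closures have a common point (\<open>centre_set_nonempty\<close>).  In finite rank two distinct points are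
  separated by two nested halfspaces whose walls are apart (\<open>nested_halfspaces\<close>); since the
  space is connected, both walls cannot be balanced, so the common point is unique and
  depends continuously on the function (\<open>centre_continuous\<close>).  The centre of \<open>field w\<close> is the
  section (\<open>section_map_equivariant\<close>).

  Finally, a section visits some small ball with positive probability.  The cocycle cannot carry a
  thick halfspace around that ball into its complement between two visits, so the cocycle is
  elementary (\<open>equivariant_section_elementary\<close>).  Both here and for ergodicity, statements that
  hold up to a null set for each group element are upgraded to one null set for all by Fubini's
  theorem for a right invariant Haar measure (\<open>right_haar_exists\<close>).
\<close>

section \<open>Median algebra of a median metric\<close>

lemma in_metric_interval: "c \<in> metric_interval a b \<longleftrightarrow> dist a b = dist a c + dist c b"
  by (simp add: metric_interval_def)

lemma metric_interval_commute: "metric_interval a b = metric_interval b a"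
  by (auto simp: metric_interval_def dist_commute add.commute)

lemma metric_interval_ends [simp]: "a \<in> metric_interval a b" "b \<in> metric_interval a b"
  by (auto simp: metric_interval_def)

lemma metric_interval_same [simp]: "metric_interval a a = {a::'a::metric_space}"
  by (auto simp: metric_interval_def dist_commute)

lemma metric_interval_nest:
  fixes a b c d :: "'a::metric_space"
  assumes "c \<in> metric_interval a b" "d \<in> metric_interval a c"
  shows "d \<in> metric_interval a b" "c \<in> metric_interval d b"
proof -
  have "dist a b = dist a c + dist c b" "dist a c = dist a d + dist d c"
    using assms by (auto simp: in_metric_interval)
  moreover have "dist a b \<le> dist a d + dist d b" "dist d b \<le> dist d c + dist c b"
    by (rule dist_triangle)+
  ultimately show "d \<in> metric_interval a b" "c \<in> metric_interval d b"
    by (auto simp: in_metric_interval)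
qed

lemma median_props:
  fixes x y z :: "'a::median_space"
  shows "median x y z \<in> metric_interval x y" "median x y z \<in> metric_interval x z"
    "median x y z \<in> metric_interval y z"
proof -
  have "median x y z \<in> metric_interval x y \<inter> metric_interval x z \<inter> metric_interval y z"
    unfolding median_def by (rule theI') (rule median_ex1)
  thus "median x y z \<in> metric_interval x y" "median x y z \<in> metric_interval x z"
    "median x y z \<in> metric_interval y z" by auto
qed

lemma median_unique:
  fixes x y z :: "'a::median_space"
  assumes "m \<in> metric_interval x y" "m \<in> metric_interval x z" "m \<in> metric_interval y z"
  shows "median x y z = m"
  unfolding median_def using median_ex1[of x y z] assms by (intro the1_equality) auto

lemma median_swap12: "median x y z = median y x (z::'a::median_space)"
  by (rule median_unique) (use median_props[of y x z] in \<open>auto simp: metric_interval_commute\<close>)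

lemma median_swap23: "median x y z = median x z (y::'a::median_space)"
  by (rule median_unique) (use median_props[of x z y] in \<open>auto simp: metric_interval_commute\<close>)

lemma median_eq_iff: "median x y z = z \<longleftrightarrow> z \<in> metric_interval x (y::'a::median_space)"
  using median_props[of x y z] by (auto intro: median_unique)

lemma dist_median: "dist x (median x y z) = (dist x y + dist x z - dist y (z::'a::median_space)) / 2"
proof -
  have "dist x y = dist x (median x y z) + dist (median x y z) y"
    "dist x z = dist x (median x y z) + dist (median x y z) z"
    "dist y z = dist y (median x y z) + dist (median x y z) z"
    using median_props[of x y z] by (auto simp: in_metric_interval)
  thus ?thesis using dist_commute[of y "median x y z"] by argo
qed

text \<open>The two medians of \<open>p\<close> and \<open>z\<close> with the end points form, together with \<open>z\<close> and their own
  median with \<open>p\<close>, a quadrangle with equal opposite sides; this forces the fourth corner to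
  be the median of \<open>x\<close>, \<open>y\<close> and \<open>p\<close>.\<close>

lemma median_is_gate:
  fixes x y z p :: "'a::median_space"
  assumes z: "z \<in> metric_interval x y"
  shows "median x y p \<in> metric_interval p z"
proof -
  define q where "q = median p z x"
  define r where "r = median p z y"
  define s where "s = median p q r"
  have q: "q \<in> metric_interval p z" "q \<in> metric_interval p x" "q \<in> metric_interval z x"
    unfolding q_def by (rule median_props)+
  have r: "r \<in> metric_interval p z" "r \<in> metric_interval p y" "r \<in> metric_interval z y"
    unfolding r_def by (rule median_props)+
  have s: "s \<in> metric_interval p q" "s \<in> metric_interval p r" "s \<in> metric_interval q r"
    unfolding s_def by (rule median_props)+
  have t: "dist x y \<le> dist x q + dist q r + dist r y" "dist x y \<le> dist x s + dist s y"
    "dist q r \<le> dist q z + dist z r" "dist x s \<le> dist x q + dist q s" "dist s y \<le> dist s r + dist r y"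
    using dist_triangle[of x y q] dist_triangle[of q y r] dist_triangle[of x y s]
      dist_triangle[of q r z] dist_triangle[of x s q] dist_triangle[of s y r] by auto
  have sxy: "s \<in> metric_interval x y"
    using t z q(3) r(3) s(3) unfolding in_metric_interval
    by (auto simp: dist_commute)
  have spx: "s \<in> metric_interval p x" using metric_interval_nest(1)[OF q(2) s(1)] .
  have spy: "s \<in> metric_interval p y" using metric_interval_nest(1)[OF r(2) s(2)] .
  have "median x y p = s"
    by (rule median_unique) (use sxy spx spy in \<open>auto simp: metric_interval_commute\<close>)
  thus ?thesis using metric_interval_nest(1)[OF q(1) s(1)] by simp
qed

text \<open>Either point reaches the gate of the other one through its own gate.\<close>

lemma median_lipschitz: "dist (median x y p) (median x y q) \<le> dist p (q::'a::median_space)"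
proof -
  let ?p = "median x y p" and ?q = "median x y q"
  have "dist p ?q = dist p ?p + dist ?p ?q"
    using median_is_gate[OF median_props(1)[of x y q], of p] by (simp add: in_metric_interval)
  moreover have "dist q ?p = dist q ?q + dist ?q ?p"
    using median_is_gate[OF median_props(1)[of x y p], of q] by (simp add: in_metric_interval)
  ultimately show ?thesis
    using dist_triangle[of p ?q q] dist_triangle[of q ?p p] by (simp add: dist_commute)
qed

text \<open>The gate of \<open>c\<close> is at most as far from \<open>a\<close> and from \<open>b\<close> as \<open>c\<close>, which leaves no room between \<open>c\<close>
  and its gate.\<close>

lemma metric_interval_convex:
  fixes x y :: "'a::median_space"
  assumes "a \<in> metric_interval x y" "b \<in> metric_interval x y"
  shows "metric_interval a b \<subseteq> metric_interval x y"
proof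
  fix c assume c: "c \<in> metric_interval a b"
  let ?c = "median x y c"
  have "dist c a = dist c ?c + dist ?c a" "dist c b = dist c ?c + dist ?c b"
    using median_is_gate[OF assms(1), of c] median_is_gate[OF assms(2), of c]
    by (auto simp: in_metric_interval)
  moreover have "dist a b = dist a c + dist c b" using c by (simp add: in_metric_interval)
  moreover have "dist a b \<le> dist a ?c + dist ?c b" by (rule dist_triangle)
  ultimately have "dist c ?c \<le> 0" by (simp add: dist_commute)
  hence "c = ?c" by simp
  thus "c \<in> metric_interval x y" using median_props(1)[of x y c] by simp
qed

text \<open>Let \<open>c'\<close> be the gate of \<open>c\<close> on the interval from \<open>y\<close> to \<open>e\<close>.  Taking medians with \<open>z1\<close>,
  \<open>z2\<close> and \<open>y\<close> one finds a point \<open>l\<close> whose distance from \<open>c'\<close>, computed through \<open>n\<close>, exceeds the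
  length of the way through \<open>y\<close> by twice the distance from \<open>y\<close> to \<open>c'\<close>; hence \<open>c' = y\<close>.\<close>

lemma shadow_convex:
  fixes y z1 z2 e c :: "'a::median_space"
  assumes y1: "y \<in> metric_interval z1 e" and y2: "y \<in> metric_interval z2 e"
    and c: "c \<in> metric_interval z1 z2"
  shows "y \<in> metric_interval c e"
proof -
  define c' where "c' = median y e c"
  define n where "n = median z1 z2 c'"
  have c'y: "c' \<in> metric_interval y e" unfolding c'_def by (rule median_props)
  have gate: "\<And>z. z \<in> metric_interval y e \<Longrightarrow> dist c z = dist c c' + dist c' z"
    using median_is_gate unfolding c'_def in_metric_interval by blast
  have zc': "y \<in> metric_interval z c'" if "y \<in> metric_interval z e" for z
    using metric_interval_nest[of y e z c'] that c'y
    by (metis metric_interval_commute metric_interval_nest(2))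
  have n: "n \<in> metric_interval z1 c'" "n \<in> metric_interval z2 c'" "n \<in> metric_interval z1 z2"
    unfolding n_def by (rule median_props)+
  have nc: "n \<in> metric_interval c' c"
    unfolding n_def by (rule median_is_gate[OF c])
  have ny: "dist n y = dist n c' + dist c' y"
    using nc gate[of y] dist_triangle[of c y n] dist_triangle[of n y c']
    by (simp add: in_metric_interval dist_commute)
  note yz1 = zc'[OF y1] and yz2 = zc'[OF y2]
  define k1 where "k1 = median z1 n y"
  define k2 where "k2 = median z2 n y"
  define l where "l = median y k1 k2"
  have k1: "k1 \<in> metric_interval z1 n" "k1 \<in> metric_interval z1 y" "k1 \<in> metric_interval n y"
    unfolding k1_def by (rule median_props)+
  have k2: "k2 \<in> metric_interval z2 n" "k2 \<in> metric_interval z2 y" "k2 \<in> metric_interval n y"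
    unfolding k2_def by (rule median_props)+
  have l: "l \<in> metric_interval y k1" "l \<in> metric_interval y k2" "l \<in> metric_interval k1 k2"
    unfolding l_def by (rule median_props)+
  have n1: "n \<in> metric_interval k1 c'" by (rule metric_interval_nest(2)[OF n(1) k1(1)])
  have n2: "n \<in> metric_interval k2 c'" by (rule metric_interval_nest(2)[OF n(2) k2(1)])
  have n3: "n \<in> metric_interval k1 k2"
    using metric_interval_nest(2)[OF n(3) k1(1)] k2(1)
    by (metis metric_interval_commute metric_interval_nest(2))
  have "median k1 k2 c' = n"
    by (rule median_unique) (use n1 n2 n3 in auto)
  with median_is_gate[OF l(3), of c'] have nl: "n \<in> metric_interval c' l" by simp
  have "dist z1 c' = dist z1 n + dist n c'" "dist z1 c' = dist z1 y + dist y c'"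
    "dist z2 c' = dist z2 n + dist n c'" "dist z2 c' = dist z2 y + dist y c'"
    "dist z1 z2 = dist z1 n + dist n z2"
    "dist z1 n = dist z1 k1 + dist k1 n" "dist z1 y = dist z1 k1 + dist k1 y"
    "dist n y = dist n k1 + dist k1 y"
    "dist z2 n = dist z2 k2 + dist k2 n" "dist z2 y = dist z2 k2 + dist k2 y"
    "dist n y = dist n k2 + dist k2 y"
    "dist y k1 = dist y l + dist l k1" "dist y k2 = dist y l + dist l k2" "dist k1 k2 = dist k1 l + dist l k2"
    "dist k1 k2 = dist k1 n + dist n k2" "dist c' l = dist c' n + dist n l" "dist l n = dist l k1 + dist k1 n"
    using n yz1 yz2 k1 k2 l n3 nl
      metric_interval_nest(2)[OF k1(3)[unfolded metric_interval_commute[of n]] l(1)]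
    unfolding in_metric_interval by auto
  moreover have "dist k1 y \<le> dist k1 l + dist l y" "dist n y \<le> dist n l + dist l y"
     "dist c' l \<le> dist c' y + dist y l" "dist z1 z2 \<le> dist z1 y + dist y z2" by (rule dist_triangle)+
  ultimately have "dist c' y \<le> 0"
    using ny by (simp add: dist_commute del: dist_le_zero_iff)
  hence "c' = y" by simp
  thus ?thesis unfolding c'_def using median_props(3)[of y e c] by (metis metric_interval_commute)
qed

text \<open>Let \<open>y0\<close> be the gate of \<open>c'\<close>, the image of \<open>c\<close>, on the interval between the images of \<open>z1\<close>
  and \<open>z2\<close>.  It lies between \<open>c'\<close> and either of \<open>z1\<close>, \<open>z2\<close>, hence between \<open>c'\<close> and \<open>c\<close>; but
  \<open>c'\<close> is a gate of \<open>c\<close>, so \<open>y0 = c'\<close>.\<close>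

lemma median_betweenness:
  fixes x y z1 z2 c :: "'a::median_space"
  assumes c: "c \<in> metric_interval z1 z2"
  shows "median x y c \<in> metric_interval (median x y z1) (median x y z2)"
proof -
  define c' where "c' = median x y c"
  define a where "a = median x y z1"
  define b where "b = median x y z2"
  define y0 where "y0 = median a b c'"
  have c': "c' \<in> metric_interval x y" and a: "a \<in> metric_interval x y" and b: "b \<in> metric_interval x y"
    unfolding c'_def a_def b_def by (rule median_props)+
  have y0: "y0 \<in> metric_interval a b" "y0 \<in> metric_interval a c'" "y0 \<in> metric_interval b c'"
    unfolding y0_def by (rule median_props)+
  have y0xy: "y0 \<in> metric_interval x y" using metric_interval_convex[OF a b] y0 by auto
  have A: "y0 \<in> metric_interval z1 c'"
  proof -
    have "a \<in> metric_interval z1 c'" unfolding a_def by (rule median_is_gate[OF c'])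
    thus ?thesis using y0(2) by (metis metric_interval_commute metric_interval_nest(1))
  qed
  have B: "y0 \<in> metric_interval z2 c'"
  proof -
    have "b \<in> metric_interval z2 c'" unfolding b_def by (rule median_is_gate[OF c'])
    thus ?thesis using y0(3) by (metis metric_interval_commute metric_interval_nest(1))
  qed
  have "y0 \<in> metric_interval c c'" by (rule shadow_convex[OF A B c])
  moreover have "c' \<in> metric_interval c y0" unfolding c'_def by (rule median_is_gate[OF y0xy])
  ultimately have "dist y0 c' \<le> 0" unfolding in_metric_interval 
    using zero_le_dist[of y0 c'] zero_le_dist[of c y0] by (simp add: dist_commute)
  hence "y0 = c'" by simp
  thus ?thesis using y0(1) unfolding c'_def a_def b_def by simp
qed

text \<open>The distributive law of median algebras.\<close>

lemma median_median:
  fixes x y a b c :: "'a::median_space"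
  shows "median x y (median a b c) = median (median x y a) (median x y b) (median x y c)"
  by (rule median_unique[symmetric]) (intro median_betweenness median_props)+

text \<open>To show that \<open>z\<close> lies between \<open>p\<close> and \<open>c\<close> one may argue in the interval from
  \<open>median z p c\<close> to \<open>z\<close>: if the two end points of that interval were distinct, the retraction
  onto it would separate \<open>z\<close> from both \<open>p\<close> and \<open>c\<close>.\<close>

lemma retraction_separates:
  fixes z p c :: "'a::median_space"
  defines "z0 \<equiv> median z p c"
  shows "median z0 z p = z0" "median z0 z c = z0" "median z0 z z = z"
  unfolding z0_def by (rule median_unique; use median_props[of z p c] in \<open>auto simp: metric_interval_commute\<close>)+

section \<open>Convex sets and halfspaces\<close>

lemma median_convexD:
  "median_convex C \<Longrightarrow> a \<in> C \<Longrightarrow> b \<in> C \<Longrightarrow> c \<in> metric_interval a b \<Longrightarrow> c \<in> C"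
  unfolding median_convex_def by blast

lemma median_convexI:
  "(\<And>a b c. a \<in> C \<Longrightarrow> b \<in> C \<Longrightarrow> c \<in> metric_interval a b \<Longrightarrow> c \<in> C) \<Longrightarrow> median_convex C"
  unfolding median_convex_def by blast

lemma median_in_convex:
  "median_convex C \<Longrightarrow> a \<in> C \<Longrightarrow> b \<in> C \<Longrightarrow> median a b (c::'a::median_space) \<in> C"
  by (meson median_convexD median_props(1))

lemma median_convex_singleton [simp]: "median_convex {x::'a::metric_space}"
  by (simp add: median_convex_def)

lemma median_convex_Inter: "(\<And>C. C \<in> F \<Longrightarrow> median_convex C) \<Longrightarrow> median_convex (\<Inter>F)"
  unfolding median_convex_def by blast

lemma median_convex_Int: "median_convex A \<Longrightarrow> median_convex B \<Longrightarrow> median_convex (A \<inter> B)"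
  unfolding median_convex_def by blast

lemma median_convex_hull [simp]: "median_convex (median_convex hull S)"
  by (rule hull_in) (auto intro: median_convex_Inter)

lemma median_convex_chain_Union:
  assumes "subset.chain {C. median_convex C} \<C>"
  shows "median_convex (\<Union>\<C>)"
  unfolding median_convex_def
proof (intro ballI)
  fix a b assume "a \<in> \<Union>\<C>" "b \<in> \<Union>\<C>"
  then obtain A B where AB: "A \<in> \<C>" "B \<in> \<C>" "a \<in> A" "b \<in> B" by blast
  hence "A \<subseteq> B \<or> B \<subseteq> A" using assms unfolding subset.chain_def by (auto simp: psubset_eq)
  then obtain C where C: "C \<in> \<C>" "a \<in> C" "b \<in> C" using AB by blast
  moreover have "median_convex C" using C(1) assms by (auto simp: subset.chain_def)
  ultimately show "metric_interval a b \<subseteq> \<Union>\<C>"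
    by (meson Union_upper median_convex_def order_trans)
qed

text \<open>The point \<open>median c1 c2 z\<close> of \<open>C\<close> witnesses that \<open>z\<close> is in the cone: a wall
  separating \<open>z\<close> from \<open>p\<close> and from that point would separate \<open>z\<close> from \<open>c1\<close> and \<open>c2\<close>.\<close>

lemma median_convex_cone:
  fixes p :: "'a::median_space"
  assumes C: "median_convex C"
  shows "median_convex {z. \<exists>c\<in>insert p C. z \<in> metric_interval p c}"
  unfolding median_convex_def
proof (intro ballI subsetI CollectI)
  fix z1 z2 z assume "z1 \<in> {z. \<exists>c\<in>insert p C. z \<in> metric_interval p c}"
    "z2 \<in> {z. \<exists>c\<in>insert p C. z \<in> metric_interval p c}" and z: "z \<in> metric_interval z1 z2"
  then obtain c1 c2 where c: "c1 \<in> insert p C" "c2 \<in> insert p C"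
    and z1: "z1 \<in> metric_interval p c1" and z2: "z2 \<in> metric_interval p c2" by blast
  consider "c1 = p" | "c2 = p" | "c1 \<in> C" "c2 \<in> C" using c by blast
  thus "\<exists>c\<in>insert p C. z \<in> metric_interval p c"
  proof cases
    case 1
    hence "z \<in> metric_interval p c2" using z z1 z2 metric_interval_nest(1) by auto
    thus ?thesis using c by blast
  next
    case 2
    hence "z \<in> metric_interval p c1" using z z1 z2 metric_interval_nest(1)
      by (metis metric_interval_commute metric_interval_same singletonD)
    thus ?thesis using c by blast
  next
    case 3
    define c where "c = median c1 c2 z"
    define z0 where "z0 = median z p c"
    note sep = retraction_separates[of z p c, folded z0_def]
    let ?r = "median z0 z"
    have "median (?r c1) (?r c2) z = z0"
      using median_median[of z0 z c1 c2 z] sep unfolding c_def by simp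
    hence m: "z0 \<in> metric_interval (?r c1) z" "z0 \<in> metric_interval (?r c2) z"
      using median_props by metis+
    have fixed: "?r w = z0" if "z0 \<in> metric_interval (?r w) z" for w
      using that median_props(1)[of z0 z w] zero_le_dist[of z0 "?r w"] unfolding in_metric_interval
      by (simp add: dist_commute)
    have "?r z1 \<in> metric_interval z0 z0" "?r z2 \<in> metric_interval z0 z0"
      using median_betweenness[OF z1, of z0 z] median_betweenness[OF z2, of z0 z] sep(1) fixed[OF m(1)] fixed[OF m(2)]
      by simp_all
    hence "z = z0" using median_betweenness[OF z, of z0 z] sep(3) by simp
    hence "z \<in> metric_interval p c" unfolding z0_def using median_props(3)[of z p c] by simp
    moreover have "c \<in> C" unfolding c_def by (rule median_in_convex[OF C 3])
    ultimately show ?thesis by blast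
  qed
qed

text \<open>If a wall separated the median from \<open>d\<close> and \<open>d'\<close>, then \<open>c\<close> and \<open>c'\<close> would lie beyond it, hence
  \<open>p\<close> as well by the position of \<open>c'\<close>, and then \<open>d\<close> by its own position.\<close>

lemma median_pasch:
  fixes p :: "'a::median_space"
  assumes d: "d \<in> metric_interval p c" and c': "c' \<in> metric_interval p d'"
  shows "median c c' d' \<in> metric_interval d d'"
proof -
  define q where "q = median c c' d'"
  define q0 where "q0 = median q d d'"
  note sep = retraction_separates[of q d d', folded q0_def]
  let ?r = "median q0 q"
  have q: "q = median (?r c) (?r c') q0"
    using median_median[of q0 q c c' d'] sep unfolding q_def by simp
  have fixed: "?r w = q" if "q \<in> metric_interval (?r w) q0" for w
    using that median_props(1)[of q0 q w] zero_le_dist[of q "?r w"] unfolding in_metric_interval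
    by (simp add: dist_commute)
  have rc: "?r c = q" "?r c' = q" using fixed q median_props by metis+
  have "q \<in> metric_interval (?r p) q0" using median_betweenness[OF c', of q0 q] sep rc by simp
  hence "?r p = q" by (rule fixed)
  hence "q0 = q" using median_betweenness[OF d, of q0 q] sep rc by simp
  thus ?thesis using median_props(3)[of q d d'] unfolding q0_def q_def by simp
qed

lemma maximal_convex_disjoint:
  fixes A B :: "'a::metric_space set"
  assumes "median_convex A" "A \<inter> B = {}"
  obtains C where "median_convex C" "A \<subseteq> C" "C \<inter> B = {}"
    "\<And>C'. median_convex C' \<Longrightarrow> C \<subseteq> C' \<Longrightarrow> C' \<inter> B = {} \<Longrightarrow> C' = C"
proof -
  let ?S = "{C. median_convex C \<and> A \<subseteq> C \<and> C \<inter> B = {}}"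
  have "\<exists>M\<in>?S. \<forall>X\<in>?S. M \<subseteq> X \<longrightarrow> X = M"
  proof (rule subset_Zorn_nonempty)
    show "?S \<noteq> {}" using assms by blast
    fix \<C> assume ne: "\<C> \<noteq> {}" and ch: "subset.chain ?S \<C>"
    have "subset.chain {C. median_convex C} \<C>" using ch unfolding subset.chain_def by blast
    hence "median_convex (\<Union>\<C>)" by (rule median_convex_chain_Union)
    thus "\<Union>\<C> \<in> ?S" using ne ch unfolding subset.chain_def by blast
  qed
  thus ?thesis using that by (smt (verit) dual_order.trans mem_Collect_eq)
qed

text \<open>Take \<open>C\<close> maximal among the convex sets that contain \<open>A\<close> and avoid \<open>B\<close>, then \<open>D\<close> maximal
  among those that contain \<open>B\<close> and avoid \<open>C\<close>.  If they did not exhaust the space, the cones over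
  both from a missed point would meet the other one, against the Pasch property.\<close>

theorem halfspace_separation:
  fixes A B :: "'a::median_space set"
  assumes A: "median_convex A" and B: "median_convex B" and AB: "A \<inter> B = {}"
  obtains h where "median_halfspace h" "A \<subseteq> h" "B \<subseteq> - h"
proof -
  obtain C where C: "median_convex C" "A \<subseteq> C" "C \<inter> B = {}"
    and Cmax: "\<And>C'. median_convex C' \<Longrightarrow> C \<subseteq> C' \<Longrightarrow> C' \<inter> B = {} \<Longrightarrow> C' = C"
    by (rule maximal_convex_disjoint[OF A AB]) blast
  have BC: "B \<inter> C = {}" using C by blast
  obtain D where D: "median_convex D" "B \<subseteq> D" "D \<inter> C = {}"
    and Dmax: "\<And>C'. median_convex C' \<Longrightarrow> D \<subseteq> C' \<Longrightarrow> C' \<inter> C = {} \<Longrightarrow> C' = D"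
    by (rule maximal_convex_disjoint[OF B BC]) blast
  have "p \<in> C \<union> D" for p
  proof (rule ccontr)
    assume p: "p \<notin> C \<union> D"
    let ?J = "\<lambda>C. {z. \<exists>c\<in>insert p C. z \<in> metric_interval p c}"
    have sub: "insert p C \<subseteq> ?J C" for C
      by (intro subsetI CollectI bexI[where P = "\<lambda>c. _ \<in> metric_interval p c"]) auto
    have "?J C \<inter> D \<noteq> {}"
      using Cmax[OF median_convex_cone[OF C(1), of p]] sub[of C] p D(2) by blast
    then obtain d c where d: "d \<in> D" "c \<in> insert p C" "d \<in> metric_interval p c" by blast
    hence c: "c \<in> C" using p by auto
    have "?J D \<inter> C \<noteq> {}"
      using Dmax[OF median_convex_cone[OF D(1), of p]] sub[of D] p by blast
    then obtain c' d' where d': "c' \<in> C" "d' \<in> insert p D" "c' \<in> metric_interval p d'" by blast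
    hence d'D: "d' \<in> D" using p by auto
    have "median c c' d' \<in> D"
      using median_pasch[OF d(3) d'(3)] median_convexD[OF D(1) d(1) d'D] by blast
    moreover have "median c c' d' \<in> C" by (rule median_in_convex[OF C(1) c d'(1)])
    ultimately show False using D by blast
  qed
  hence "- C = D" using D by blast
  thus ?thesis using that[of C] C D by (auto simp: median_halfspace_def)
qed

lemma halfspace_separation_point:
  fixes C :: "'a::median_space set"
  assumes "median_convex C" "x \<notin> C"
  obtains h where "median_halfspace h" "C \<subseteq> h" "x \<notin> h"
  using halfspace_separation[of C "{x}"] assms by auto

lemma median_halfspace_Compl [simp]: "median_halfspace (- h) \<longleftrightarrow> median_halfspace h"
  by (auto simp: median_halfspace_def)


section \<open>Hulls in finite rank\<close>

lemma hull_finitary: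
  fixes x :: "'a::metric_space"
  assumes "x \<in> median_convex hull A"
  shows "\<exists>F\<subseteq>A. finite F \<and> x \<in> median_convex hull F"
proof -
  let ?U = "{x. \<exists>F\<subseteq>A. finite F \<and> x \<in> median_convex hull F}"
  have "median_convex ?U"
  proof (rule median_convexI)
    fix a b c assume "a \<in> ?U" "b \<in> ?U" and c: "c \<in> metric_interval a b"
    then obtain F G where "F \<subseteq> A" "finite F" "a \<in> median_convex hull F"
      "G \<subseteq> A" "finite G" "b \<in> median_convex hull G" by blast
    moreover have "c \<in> median_convex hull (F \<union> G)"
      by (rule median_convexD[OF median_convex_hull _ _ c])
         (use calculation hull_mono[of F "F \<union> G" median_convex] hull_mono[of G "F \<union> G" median_convex] in auto)
    ultimately show "c \<in> ?U" by (intro CollectI exI[of _ "F \<union> G"]) auto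
  qed
  moreover have "A \<subseteq> ?U"
  proof
    fix a assume "a \<in> A"
    thus "a \<in> ?U" using hull_inc[of a "{a}" median_convex] by (intro CollectI exI[of _ "{a}"]) auto
  qed
  ultimately have "median_convex hull A \<subseteq> ?U" by (rule hull_minimal[rotated])
  thus ?thesis using assms by blast
qed

definition rank_at_most :: "'a::median_space itself \<Rightarrow> nat \<Rightarrow> bool" where
  "rank_at_most _ n \<longleftrightarrow> (\<forall>H :: 'a set set. finite H \<longrightarrow> (\<forall>h\<in>H. median_halfspace h) \<longrightarrow>
     pairwise transverse H \<longrightarrow> card H \<le> n)"

lemma finite_rank_bound:
  assumes "finite_rank TYPE('a::median_space)"
  obtains n where "rank_at_most TYPE('a) n"
proof -
  obtain n where n: "median_rank TYPE('a) = enat n"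
    using assms unfolding finite_rank_def by (cases "median_rank TYPE('a)") auto
  have "card H \<le> n" if "finite H" "\<forall>h\<in>H. median_halfspace h" "pairwise transverse H" for H :: "'a set set"
  proof -
    have "enat (card H) \<le> median_rank TYPE('a)"
      unfolding median_rank_def using that by (intro SUP_upper) auto
    thus ?thesis using n by simp
  qed
  thus ?thesis using that[of n] by (simp add: rank_at_most_def)
qed

text \<open>Choose the finite set minimal.  Each of its points \<open>a\<close> is then cut off from the others by a
  halfspace containing \<open>x\<close> and \<open>a\<close>; with at least three points these halfspaces are pairwise
  transverse.\<close>

lemma median_caratheodory:
  fixes A :: "'a::median_space set"
  assumes n: "rank_at_most TYPE('a) n" and x: "x \<in> median_convex hull A"
  shows "\<exists>F\<subseteq>A. finite F \<and> card F \<le> max n 2 \<and> x \<in> median_convex hull F"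
proof -
  let ?P = "\<lambda>F. F \<subseteq> A \<and> finite F \<and> x \<in> median_convex hull F"
  obtain F0 where "?P F0" using hull_finitary[OF x] by blast
  then obtain F where F: "?P F" and Fmin: "\<And>G. ?P G \<Longrightarrow> card F \<le> card G"
    using ex_has_least_nat[of ?P F0 card] by blast
  have "card F \<le> max n 2"
  proof (rule ccontr)
    assume big: "\<not> card F \<le> max n 2"
    have "\<exists>h. median_halfspace h \<and> x \<in> h \<and> h \<inter> F = {a}" if a: "a \<in> F" for a
    proof -
      have "x \<notin> median_convex hull (F - {a})"
      proof
        assume "x \<in> median_convex hull (F - {a})"
        moreover have "F - {a} \<subseteq> A" "finite (F - {a})" using F by auto
        ultimately have "card F \<le> card (F - {a})" using Fmin[of "F - {a}"] by blast
        thus False using a F by (metis card_Diff1_less linorder_not_le)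
      qed
      then obtain g where g: "median_halfspace g" "median_convex hull (F - {a}) \<subseteq> g" "x \<notin> g"
        using halfspace_separation_point[of "median_convex hull (F - {a})" x] by auto
      have "F - {a} \<subseteq> g" using hull_subset g(2) by (rule order_trans)
      moreover have "a \<notin> g"
      proof
        assume "a \<in> g"
        hence "F \<subseteq> g" using calculation by auto
        hence "median_convex hull F \<subseteq> g"
          using g unfolding median_halfspace_def by (intro hull_minimal) auto
        thus False using F g by auto
      qed
      ultimately show ?thesis using g a by (intro exI[of _ "- g"]) auto
    qed
    then obtain h where h: "\<And>a. a \<in> F \<Longrightarrow> median_halfspace (h a) \<and> x \<in> h a \<and> h a \<inter> F = {a}" by metis
    have inj: "inj_on h F" using h by (intro inj_onI) (metis the_elem_eq)
    have "transverse (h a) (h b)" if ab: "a \<in> F" "b \<in> F" "h a \<noteq> h b" for a b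
    proof -
      have "F - {a, b} \<noteq> {}"
      proof
        assume "F - {a, b} = {}"
        hence "card F \<le> card {a, b}" by (intro card_mono) auto
        thus False using big by (metis card_2_iff ab(3) max.cobounded2 order_trans)
      qed
      then obtain c where "c \<in> F" "c \<noteq> a" "c \<noteq> b" by blast
      hence "c \<in> - h a \<inter> - h b" "b \<in> - h a \<inter> h b" "a \<in> h a \<inter> - h b" "x \<in> h a \<inter> h b"
        using h[OF ab(1)] h[OF ab(2)] ab by auto
      thus ?thesis unfolding transverse_def by blast
    qed
    hence "pairwise transverse (h ` F)" unfolding pairwise_def by blast
    hence "card (h ` F) \<le> n" using F h n by (auto simp: rank_at_most_def)
    thus False using card_image[OF inj] big by simp
  qed
  thus ?thesis using F by blast
qed

lemma median_lipschitz2: 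
  "dist (median a b z) (median a' b' (z::'a::median_space)) \<le> dist a a' + dist b b'"
proof -
  have "dist (median a b z) (median a' b z) \<le> dist a a'"
    using median_lipschitz[of b z a a'] by (metis median_swap12 median_swap23)
  moreover have "dist (median a' b z) (median a' b' z) \<le> dist b b'"
    using median_lipschitz[of a' z b b'] by (metis median_swap23)
  ultimately show ?thesis using dist_triangle[of "median a b z" "median a' b' z" "median a' b z"] by linarith
qed

text \<open>The hull of a finite set is obtained by successive cones, and a median moves by at most the
  sum of the displacements of two of its arguments.\<close>

lemma hull_near_convex:
  fixes C F :: "'a::median_space set" and \<delta> :: real
  assumes C: "median_convex C" and F: "finite F" "F \<noteq> {}" "\<And>z. z \<in> F \<Longrightarrow> \<exists>c\<in>C. dist z c < \<delta>"
    and z: "z \<in> median_convex hull F"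
  shows "\<exists>c\<in>C. dist z c < card F * \<delta>"
  using F z
proof (induction F arbitrary: z rule: finite_ne_induct)
  case (singleton x)
  have "median_convex hull {x} = {x}" by (intro hull_same) simp
  thus ?case using singleton by auto
next
  case (insert a F)
  let ?J = "{z. \<exists>c\<in>insert a (median_convex hull F). z \<in> metric_interval a c}"
  have "insert a F \<subseteq> ?J"
  proof
    fix x assume "x \<in> insert a F"
    thus "x \<in> ?J" using hull_inc[of x F median_convex] by (intro CollectI bexI[of _ x]) auto
  qed
  hence "median_convex hull (insert a F) \<subseteq> ?J" by (intro hull_minimal median_convex_cone) auto
  then obtain y where y: "y = a \<or> y \<in> median_convex hull F" "z \<in> metric_interval a y" using insert.prems by blast
  obtain c1 where c1: "c1 \<in> C" "dist a c1 < \<delta>" using insert.prems by auto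
  have \<delta>: "\<delta> > 0" using c1 zero_le_dist[of a c1] by linarith
  have pos: "card F * \<delta> > 0" using \<delta> insert by (simp add: card_gt_0_iff)
  obtain c2 where c2: "c2 \<in> C" "dist y c2 < card F * \<delta>"
  proof (cases "y = a")
    case True
    have "1 * \<delta> \<le> card F * \<delta>"
      using insert \<delta> by (intro mult_right_mono) (auto simp: Suc_le_eq card_gt_0_iff)
    thus ?thesis using that[of c1] c1 True by simp
  next
    case False
    thus ?thesis using that insert y by blast
  qed
  have "median a y z = z" using y by (simp add: median_eq_iff)
  moreover have "median c1 c2 z \<in> C" using C c1 c2 by (intro median_in_convex)
  moreover have "dist (median a y z) (median c1 c2 z) < \<delta> + card F * \<delta>"
    using median_lipschitz2[of a y z c1 c2] c1 c2 by linarith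
  ultimately show ?case using insert by (intro bexI[of _ "median c1 c2 z"]) (auto simp: algebra_simps)
qed

text \<open>A point of a hull is in the hull of boundedly many of the generating points.\<close>

lemma hull_neighbourhood:
  fixes C :: "'a::median_space set"
  assumes n: "rank_at_most TYPE('a) n"
    and C: "median_convex C" and z: "z \<in> median_convex hull {z. \<exists>c\<in>C. dist z c < \<delta>}"
  shows "\<exists>c\<in>C. dist z c < real (max n 2) * \<delta>"
proof -
  obtain F where F: "F \<subseteq> {z. \<exists>c\<in>C. dist z c < \<delta>}" "finite F" "card F \<le> max n 2" "z \<in> median_convex hull F"
    using median_caratheodory[OF n z] by blast
  have "F \<noteq> {}"
  proof
    assume "F = {}"
    moreover have "median_convex hull {} = ({}::'a set)" by (intro hull_same) (simp add: median_convex_def)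
    ultimately show False using F by simp
  qed
  then obtain c a where c: "c \<in> C" "dist z c < card F * \<delta>" "a \<in> F"
    using hull_near_convex[OF C F(2) _ _ F(4)] F(1) by blast
  have "\<delta> > 0" using c F(1) zero_le_dist le_less_trans by blast
  hence "card F * \<delta> \<le> max n 2 * \<delta>" using F by (intro mult_right_mono) auto
  thus ?thesis using c by force
qed

lemma bounded_hull:
  fixes S :: "'a::median_space set"
  assumes fr: "finite_rank TYPE('a)" and S: "bounded S"
  shows "bounded (median_convex hull S)"
proof -
  obtain n where n: "rank_at_most TYPE('a) n" using finite_rank_bound[OF fr] by blast
  fix x0
  obtain e where e: "\<And>y. y \<in> S \<Longrightarrow> dist x0 y \<le> e" using S bounded_any_center[of S x0] by auto
  have "S \<subseteq> {z. \<exists>c\<in>{x0}. dist z c < e + 1}" using e by (force simp: dist_commute)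
  hence "median_convex hull S \<subseteq> median_convex hull {z. \<exists>c\<in>{x0}. dist z c < e + 1}" by (rule hull_mono)
  hence "\<And>z. z \<in> median_convex hull S \<Longrightarrow> dist x0 z \<le> max n 2 * (e+1)"
    using hull_neighbourhood[OF n, of "{x0}"] by (force simp: dist_commute)
  thus ?thesis unfolding bounded_def by blast
qed

text \<open>The hulls of the two \<open>\<delta>\<close>-neighbourhoods are disjoint because each stays within a multiple of
  \<open>\<delta>\<close> of its own set.\<close>

lemma halfspace_between:
  fixes P Q :: "'a::median_space set"
  assumes n: "rank_at_most TYPE('a) n"
    and P: "median_convex P" and Q: "median_convex Q"
    and PQ: "\<And>p q. p \<in> P \<Longrightarrow> q \<in> Q \<Longrightarrow> dist p q \<ge> 2 * real (max n 2) * \<delta>"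
  obtains h where "median_halfspace h" "\<And>z p. p \<in> P \<Longrightarrow> dist z p < \<delta> \<Longrightarrow> z \<in> h"
    "\<And>z q. q \<in> Q \<Longrightarrow> dist z q < \<delta> \<Longrightarrow> z \<notin> h"
proof -
  let ?N = "\<lambda>P. {z. \<exists>c\<in>P. dist z c < \<delta>}"
  have "(median_convex hull ?N P) \<inter> (median_convex hull ?N Q) = {}"
  proof (intro equals0I)
    fix z assume "z \<in> (median_convex hull ?N P) \<inter> (median_convex hull ?N Q)"
    then obtain p q where "p \<in> P" "q \<in> Q" "dist z p < max n 2 * \<delta>" "dist z q < max n 2 * \<delta>"
      using hull_neighbourhood[OF n P, of z \<delta>] hull_neighbourhood[OF n Q, of z \<delta>] by blast
    thus False using PQ[of p q] dist_triangle3[of p q z] by linarith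
  qed
  then obtain h where "median_halfspace h" "median_convex hull ?N P \<subseteq> h" "median_convex hull ?N Q \<subseteq> - h"
    by (rule halfspace_separation[OF median_convex_hull median_convex_hull])
  thus ?thesis using that[of h] hull_subset[of "?N P" median_convex] hull_subset[of "?N Q" median_convex] by blast
qed

definition nested_separation :: "real \<Rightarrow> 'a::metric_space \<Rightarrow> 'a \<Rightarrow> 'a set \<Rightarrow> 'a set \<Rightarrow> bool" where
  "nested_separation \<gamma> x y h k \<longleftrightarrow> median_halfspace h \<and> median_halfspace k \<and> ball x \<gamma> \<subseteq> h \<and> h \<subseteq> k \<and>
     ball y \<gamma> \<inter> k = {} \<and> (\<forall>a\<in>h. \<forall>b\<in>-k. dist a b \<ge> \<gamma>)"

text \<open>One halfspace separates the two balls; a second one is inserted between the first and the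
  second ball.\<close>

lemma nested_halfspaces:
  assumes fr: "finite_rank TYPE('a::median_space)" and "\<eta> > 0"
  obtains \<gamma> where "\<gamma> > 0" "\<And>x y :: 'a. dist x y \<ge> \<eta> \<Longrightarrow> \<exists>h k. nested_separation \<gamma> x y h k"
proof -
  obtain n where n: "rank_at_most TYPE('a) n" using finite_rank_bound[OF fr] by blast
  define N where "N = 2 * real (max n 2)"
  have N: "N \<ge> 4" unfolding N_def by simp
  define \<delta> where "\<delta> = \<eta> / N"
  define \<gamma> where "\<gamma> = \<delta> / N"
  have \<gamma>: "\<gamma> > 0" "\<gamma> \<le> \<delta>" "N * \<delta> = \<eta>" "N * \<gamma> = \<delta>" using N \<open>\<eta> > 0\<close> by (auto simp: \<gamma>_def \<delta>_def field_simps)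
  show ?thesis
  proof (rule that[OF \<gamma>(1)])
    fix x y :: 'a assume xy: "dist x y \<ge> \<eta>"
    obtain h where h: "median_halfspace h" "\<And>z p. p \<in> {x} \<Longrightarrow> dist z p < \<delta> \<Longrightarrow> z \<in> h"
      "\<And>z q. q \<in> {y} \<Longrightarrow> dist z q < \<delta> \<Longrightarrow> z \<notin> h"
      by (rule halfspace_between[OF n, of "{x}" "{y}" \<delta>]) (use xy \<gamma> N_def in auto)
    have hy: "dist p y \<ge> \<delta>" if "p \<in> h" for p using h(3)[of y p] that by force
    obtain k where k: "median_halfspace k" "\<And>z p. p \<in> h \<Longrightarrow> dist z p < \<gamma> \<Longrightarrow> z \<in> k"
      "\<And>z q. q \<in> {y} \<Longrightarrow> dist z q < \<gamma> \<Longrightarrow> z \<notin> k"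
      by (rule halfspace_between[OF n, of h "{y}" \<gamma>]) 
         (use hy \<gamma> N_def h(1) in \<open>auto simp: median_halfspace_def\<close>)
    have "ball x \<gamma> \<subseteq> h" using h(2) \<gamma>(2) by (force simp: dist_commute)
    moreover have "h \<subseteq> k" using k(2) \<gamma>(1) by (metis dist_self subsetI)
    moreover have "ball y \<gamma> \<inter> k = {}" using k(3) by (force simp: dist_commute)
    moreover have "\<forall>a\<in>h. \<forall>b\<in>-k. dist a b \<ge> \<gamma>" using k(2) by (force simp: dist_commute)
    ultimately show "\<exists>h k. nested_separation \<gamma> x y h k"
      using h(1) k(1) unfolding nested_separation_def by blast
  qed
qed


section \<open>Common points of closed convex sets\<close>

text \<open>A minimising sequence for the distance to \<open>x\<close> is Cauchy: the median of \<open>x\<close> with two members of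
  the sequence is in \<open>C\<close>, so it is not closer to \<open>x\<close> than the infimum.\<close>

lemma gate_exists:
  fixes C :: "'a::{complete_space, median_space} set"
  assumes C: "closed C" "median_convex C" "C \<noteq> {}"
  shows "\<exists>p\<in>C. \<forall>y\<in>C. p \<in> metric_interval x y"
proof -
  define r where "r = infdist x C"
  have "\<exists>y\<in>C. dist x y < r + inverse (real (Suc n))" for n
  proof (rule ccontr)
    assume "\<not> ?thesis"
    hence "r + inverse (real (Suc n)) \<le> infdist x C"
      using C by (auto simp: infdist_def not_less intro!: cINF_greatest)
    thus False unfolding r_def by simp
  qed
  then obtain y where y: "\<And>n. y n \<in> C" "\<And>n. dist x (y n) < r + inverse (real (Suc n))" by metis
  have yy: "dist (y n) (y m) < inverse (real (Suc n)) + inverse (real (Suc m))" for n m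
  proof -
    have "median (y n) (y m) x \<in> C" by (rule median_in_convex[OF C(2) y(1) y(1)])
    hence "r \<le> dist x (median (y n) (y m) x)" unfolding r_def by (rule infdist_le)
    hence "r \<le> dist x (median x (y n) (y m))" by (metis median_swap12 median_swap23)
    thus ?thesis using dist_median[of x "y n" "y m"] y(2)[of n] y(2)[of m] by argo
  qed
  have "Cauchy y"
  proof (rule metric_CauchyI)
    fix e :: real assume "e > 0"
    then obtain N where N: "inverse (real (Suc N)) < e / 2" using reals_Archimedean[of "e/2"] by auto
    show "\<exists>M. \<forall>m\<ge>M. \<forall>n\<ge>M. dist (y m) (y n) < e"
    proof (intro exI allI impI)
      fix m n assume "N \<le> m" "N \<le> n"
      hence "inverse (real (Suc m)) \<le> inverse (real (Suc N))" "inverse (real (Suc n)) \<le> inverse (real (Suc N))"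
        by (auto intro!: le_imp_inverse_le)
      thus "dist (y m) (y n) < e" using yy[of m n] N by linarith
    qed
  qed
  then obtain p where p: "y \<longlonglongrightarrow> p" using Cauchy_convergent convergent_def by blast
  have pC: "p \<in> C" using C(1) y(1) p closed_sequentially by blast
  have "(\<lambda>n. dist x (y n)) \<longlonglongrightarrow> dist x p" by (intro tendsto_intros p)
  moreover have "(\<lambda>n. r + inverse (real (Suc n))) \<longlonglongrightarrow> r + 0"
    by (intro tendsto_intros LIMSEQ_inverse_real_of_nat)
  ultimately have pr: "dist x p \<le> r"
    using LIMSEQ_le[of "\<lambda>n. dist x (y n)" "dist x p" "\<lambda>n. r + inverse (real (Suc n))" r] less_imp_le[OF y(2)]
    by simp
  have "p \<in> metric_interval x z" if z: "z \<in> C" for z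
  proof -
    let ?m = "median p z x"
    have "?m \<in> C" by (rule median_in_convex[OF C(2) pC z])
    hence "r \<le> dist x ?m" unfolding r_def by (rule infdist_le)
    moreover have "dist x p = dist x ?m + dist ?m p"
      using median_props(2)[of p z x] by (simp add: in_metric_interval dist_commute)
    ultimately have "?m = p" using pr by (smt (verit) zero_le_dist dist_eq_0_iff)
    thus ?thesis using median_props(3)[of p z x] by (simp add: metric_interval_commute)
  qed
  thus ?thesis using pC by blast
qed

text \<open>For three sets take the median of one point in each pairwise intersection; the general case
  follows by intersecting the other sets with one of them.\<close>

lemma helly_finite:
  fixes F :: "'a::median_space set set"
  assumes "finite F" "F \<noteq> {}" "\<And>A. A \<in> F \<Longrightarrow> median_convex A" "\<And>A B. A \<in> F \<Longrightarrow> B \<in> F \<Longrightarrow> A \<inter> B \<noteq> {}"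
  shows "\<Inter>F \<noteq> {}"
  using assms
proof (induction "card F" arbitrary: F rule: less_induct)
  case (less F)
  obtain A where A: "A \<in> F" using less by blast
  show ?case
  proof (cases "F = {A}")
    case True
    thus ?thesis using less(5)[OF A A] by simp
  next
    case False
    let ?G = "(\<lambda>B. A \<inter> B) ` (F - {A})"
    have "card ?G \<le> card (F - {A})" using less by (intro card_image_le) auto
    hence 1: "card ?G < card F" using A less by (metis card_Diff1_less le_less_trans)
    have 2: "B \<inter> C \<noteq> {}" if BC: "B \<in> ?G" "C \<in> ?G" for B C
    proof -
      obtain B' C' where BC': "B' \<in> F" "C' \<in> F" "B = A \<inter> B'" "C = A \<inter> C'" using BC by blast
      obtain a b c where abc: "a \<in> B' \<inter> C'" "b \<in> A \<inter> C'" "c \<in> A \<inter> B'"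
        using less(5)[OF BC'(1,2)] less(5)[OF A BC'(2)] less(5)[OF A BC'(1)] by blast
      have "median b c a \<in> A" "median a c b \<in> B'" "median a b c \<in> C'"
        using abc A BC' by (auto intro!: median_in_convex less(4))
      hence "median a b c \<in> B \<inter> C" using BC'(3,4) median_swap12 median_swap23 by (metis IntI)
      thus ?thesis by blast
    qed
    have 3: "median_convex B" if "B \<in> ?G" for B
      using that less(4) A by (auto intro!: median_convex_Int)
    have 4: "finite ?G" "?G \<noteq> {}" using False A less(2,3) by auto
    have "\<Inter>?G \<noteq> {}" by (rule less(1)[OF 1 4 3 2])
    moreover have "\<Inter>?G \<subseteq> \<Inter>F" using False A by blast
    ultimately show ?thesis by blast
  qed
qed

text \<open>By the Lindeloef property countably many of the sets suffice.  The gates of a base point in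
  their finite intersections move monotonically away from it along intervals, at bounded
  distance, hence they converge.\<close>

theorem closed_convex_common_point:
  fixes F :: "'a::{polish_space, median_space} set set"
  assumes cl: "\<And>A. A \<in> F \<Longrightarrow> closed A" and cv: "\<And>A. A \<in> F \<Longrightarrow> median_convex A"
    and int: "\<And>A B. A \<in> F \<Longrightarrow> B \<in> F \<Longrightarrow> A \<inter> B \<noteq> {}"
    and K: "K \<in> F" "bounded K"
  shows "\<Inter>F \<noteq> {}"
proof -
  obtain U' where U': "U' \<subseteq> uminus ` F" "countable U'" "\<Union>U' = \<Union>(uminus ` F)"
    using Lindelof[of "uminus ` F"] cl by auto
  define G where "G = insert K (uminus ` U')"
  have GF: "G \<subseteq> F" "countable G" using U' K by (auto simp: G_def)
  have "\<Inter>G \<subseteq> \<Inter>F"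
  proof
    fix x assume x: "x \<in> \<Inter>G"
    have "x \<notin> \<Union>U'" using x by (auto simp: G_def)
    hence "x \<notin> \<Union>(uminus ` F)" using U' by simp
    thus "x \<in> \<Inter>F" by blast
  qed
  moreover have "\<Inter>G \<noteq> {}"
  proof -
    have Gne: "G \<noteq> {}" by (auto simp: G_def)
    define c where "c = from_nat_into G"
    have c: "c n \<in> F" for n using from_nat_into[OF Gne] GF by (auto simp: c_def)
    define D where "D n = K \<inter> \<Inter>(c ` {..n})" for n
    have D: "closed (D n)" "median_convex (D n)" "D n \<noteq> {}" for n
    proof -
      show "closed (D n)" unfolding D_def using cl c K by (intro closed_Int closed_Inter) auto
      show "median_convex (D n)" unfolding D_def using cv c K by (intro median_convex_Int median_convex_Inter) auto
      have "\<Inter>(insert K (c ` {..n})) \<noteq> {}" using c K int cv by (intro helly_finite) blast+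
      thus "D n \<noteq> {}" unfolding D_def by simp
    qed
    have Dmono: "D n \<subseteq> D m" if "m \<le> n" for m n using that unfolding D_def by force
    fix x0
    obtain p where p: "\<And>n. p n \<in> D n" "\<And>n y. y \<in> D n \<Longrightarrow> p n \<in> metric_interval x0 y"
      using gate_exists[OF D, of _ x0] by metis
    have pd: "dist x0 (p n) = dist x0 (p m) + dist (p m) (p n)" if "m \<le> n" for m n
      using p(2)[of "p n" m] p(1)[of n] Dmono[OF that] by (auto simp: in_metric_interval)
    obtain B where B: "\<And>y. y \<in> K \<Longrightarrow> dist x0 y \<le> B" using K(2) bounded_any_center[of K x0] by auto
    have "incseq (\<lambda>n. dist x0 (p n))" using pd by (intro monoI) (smt (verit) zero_le_dist)
    moreover have "dist x0 (p n) \<le> B" for n using p(1)[of n] B by (auto simp: D_def)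
    ultimately have conv: "convergent (\<lambda>n. dist x0 (p n))"
      by (meson Bseq_monoseq_convergent incseq_convergent convergentI)
    have "Cauchy p"
    proof (rule metric_CauchyI)
      fix e :: real assume "e > 0"
      then obtain M where M: "\<And>m n. m \<ge> M \<Longrightarrow> n \<ge> M \<Longrightarrow> dist (dist x0 (p m)) (dist x0 (p n)) < e"
        using metric_CauchyD[OF convergent_Cauchy[OF conv]] by blast
      have "dist (p m) (p n) < e" if "m \<ge> M" "n \<ge> M" for m n
      proof (cases "m \<le> n")
        case True
        thus ?thesis using pd[OF True] M[OF that] by (simp add: dist_real_def)
      next
        case False
        hence "n \<le> m" by simp
        from pd[OF this] show ?thesis using M[OF that] by (simp add: dist_real_def dist_commute)
      qed
      thus "\<exists>M. \<forall>m\<ge>M. \<forall>n\<ge>M. dist (p m) (p n) < e" by blast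
    qed
    then obtain q where q: "p \<longlonglongrightarrow> q" using Cauchy_convergent convergent_def by blast
    have "q \<in> A" if AG: "A \<in> G" for A
    proof -
      obtain m where m: "A = c m" using from_nat_into_surj[OF GF(2) AG] c_def by metis
      have "eventually (\<lambda>n. p n \<in> A) sequentially"
        using eventually_ge_at_top[of m]
      proof eventually_elim
        case (elim n)
        thus ?case using p(1)[of n] m by (auto simp: D_def)
      qed
      thus ?thesis using Lim_in_closed_set[OF cl _ _ q, of A] AG GF by auto
    qed
    thus ?thesis by blast
  qed
  ultimately show ?thesis by blast
qed


section \<open>Signed distance to a halfspace\<close>

lemma continuous_median: "continuous_on UNIV (median x (y::'a::median_space))"
proof (rule continuous_onI)
  fix z :: 'a and e :: real assume "e > 0"
  thus "\<exists>d>0. \<forall>x'\<in>UNIV. dist x' z < d \<longrightarrow> dist (median x y x') (median x y z) \<le> e"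
    by (intro exI[of _ e] conjI ballI impI) (auto intro: order.trans[OF median_lipschitz] less_imp_le)
qed

text \<open>An interval is a retract of the space.\<close>

lemma connected_metric_interval:
  assumes "connected (UNIV :: 'a::median_space set)"
  shows "connected (metric_interval x (y::'a))"
proof -
  have "metric_interval x y = range (median x y)"
  proof
    show "metric_interval x y \<subseteq> range (median x y)"
      by (metis median_eq_iff rangeI subsetI)
    show "range (median x y) \<subseteq> metric_interval x y" using median_props(1)[of x y] by blast
  qed
  thus ?thesis using connected_continuous_image[OF continuous_median assms, of x y] by simp
qed

lemma closure_median_convex:
  fixes C :: "'a::median_space set"
  assumes "median_convex C"
  shows "median_convex (closure C)"
proof (rule median_convexI)
  fix a b c assume "a \<in> closure C" "b \<in> closure C" and c: "c \<in> metric_interval a b"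
  then obtain f g where f: "\<And>n::nat. f n \<in> C" "f \<longlonglongrightarrow> a" and g: "\<And>n::nat. g n \<in> C" "g \<longlonglongrightarrow> b"
    by (auto simp: closure_sequential)
  have "(\<lambda>n. dist (f n) a + dist (g n) b) \<longlonglongrightarrow> dist a a + dist b b" by (intro tendsto_intros f g)
  hence "(\<lambda>n. dist (f n) a + dist (g n) b) \<longlonglongrightarrow> 0" by (simp only: dist_self add_0_left)
  hence "(\<lambda>n. dist (median (f n) (g n) c) (median a b c)) \<longlonglongrightarrow> 0"
    by (rule metric_tendsto_imp_tendsto[where b = 0])
       (intro always_eventually allI, metis abs_of_nonneg add_nonneg_nonneg diff_0_right dist_real_def
          median_lipschitz2 zero_le_dist)
  hence "(\<lambda>n. median (f n) (g n) c) \<longlonglongrightarrow> median a b c" by (rule tendsto_dist_iff[THEN iffD2])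
  moreover have "median a b c = c" using c by (simp add: median_eq_iff)
  moreover have "median (f n) (g n) c \<in> C" for n by (rule median_in_convex[OF assms f(1) g(1)])
  ultimately show "c \<in> closure C" unfolding closure_sequential by (intro exI[of _ "\<lambda>n. median (f n) (g n) c"]) simp
qed

definition signed_dist :: "'a::metric_space \<Rightarrow> 'a set \<Rightarrow> real" where
  "signed_dist x h = infdist x (- h) - infdist x h"

lemma signed_dist_lipschitz: "signed_dist x h \<le> signed_dist y h + 2 * dist x y"
  using infdist_triangle[of x "- h" y] infdist_triangle[of y h x] unfolding signed_dist_def by (simp add: dist_commute)

text \<open>An interval from inside \<open>h\<close> to outside \<open>k\<close> crosses the frontier of \<open>h\<close> because it is connected.\<close>

lemma infdist_gap:
  fixes h k :: "'a::median_space set"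
  assumes conn: "connected (UNIV :: 'a set)" and hk: "h \<subseteq> k" "k \<noteq> UNIV" "x \<in> h"
    and gap: "\<And>a b. a \<in> h \<Longrightarrow> b \<notin> k \<Longrightarrow> dist a b \<ge> \<gamma>"
  shows "infdist x (- k) \<ge> infdist x (- h) + \<gamma>"
proof -
  have "infdist x (- h) + \<gamma> \<le> dist x b" if b: "b \<in> - k" for b
  proof -
    have "metric_interval x b \<inter> frontier h \<noteq> {}"
      by (rule connected_Int_frontier[OF connected_metric_interval[OF conn]])
         (use hk b metric_interval_ends[of x b] metric_interval_ends(2)[of b x] in blast)+
    then obtain z where z: "z \<in> metric_interval x b" "z \<in> closure h" "z \<in> closure (- h)"
      by (auto simp: frontier_closures)
    have "closure h \<subseteq> {z. \<gamma> \<le> dist z b}"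
      using gap b by (intro closure_minimal closed_Collect_le continuous_intros) auto
    hence "\<gamma> \<le> dist z b" using z by blast
    moreover have "infdist z (- h) = 0" using z(3) hk b in_closure_iff_infdist_zero[of "- h" z] by auto
    hence "infdist x (- h) \<le> dist x z" using infdist_triangle[of x "- h" z] by simp
    ultimately show ?thesis using z(1) by (simp add: in_metric_interval)
  qed
  thus ?thesis using hk(2) unfolding infdist_def[of x "- k"] by (auto intro!: cINF_greatest)
qed

lemma signed_dist_gap:
  fixes h k :: "'a::median_space set"
  assumes conn: "connected (UNIV :: 'a set)" and hk: "h \<subseteq> k" "k \<noteq> UNIV" "h \<noteq> {}"
    and gap: "\<And>a b. a \<in> h \<Longrightarrow> b \<notin> k \<Longrightarrow> dist a b \<ge> \<gamma>"
  shows "signed_dist x k \<ge> signed_dist x h + \<gamma>"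
proof -
  consider "x \<in> h" | "x \<notin> k" | "x \<in> k" "x \<notin> h" by blast
  thus ?thesis
  proof cases
    case 1
    thus ?thesis using infdist_gap[OF conn hk(1,2) 1 gap] hk by (auto simp: signed_dist_def)
  next
    case 2
    have gap': "\<gamma> \<le> dist a b" if "a \<in> - k" "b \<notin> - h" for a b
      using gap[of b a] that by (simp add: dist_commute)
    have "infdist x (- (- h)) \<ge> infdist x (- (- k)) + \<gamma>"
      by (rule infdist_gap[OF conn _ _ _ gap']) (use 2 hk in auto)
    moreover have "x \<in> - h" "x \<in> - k" using 2 hk by auto
    ultimately show ?thesis by (simp add: signed_dist_def)
  next
    case 3
    have "\<gamma> - infdist x h \<le> dist x b" if b: "b \<in> - k" for b
    proof -
      have "\<gamma> - dist x b \<le> infdist x h"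
      proof -
        have "\<gamma> - dist x b \<le> dist x a" if "a \<in> h" for a
          using gap[of a b] that b dist_triangle[of a b x] by (simp add: dist_commute)
        thus ?thesis unfolding infdist_def using hk(3) by (auto intro!: cINF_greatest)
      qed
      thus ?thesis by simp
    qed
    hence "\<gamma> - infdist x h \<le> infdist x (- k)"
      using hk(2) unfolding infdist_def[of x "- k"] by (auto intro!: cINF_greatest)
    thus ?thesis using 3 by (simp add: signed_dist_def)
  qed
qed


section \<open>Centres of weighted bounded sets\<close>

text \<open>The wall of a halfspace is balanced if the weighted set \<open>S\<close> reaches equally deep into both sides;
  the centre lies on the deeper side of all other walls.  For constant weight in the plane with
  the sum metric this is the centre of the bounding box.  The point of this choice is that moving a
  wall by a positive distance changes the depths on its two sides in opposite directions, so that
  the centre is unique and stable.\<close>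

definition depth :: "'a::metric_space set \<Rightarrow> ('a \<Rightarrow> real) \<Rightarrow> 'a set \<Rightarrow> real" where
  "depth S w h = (SUP x\<in>S. signed_dist x h + w x)"

definition majority_halfspace :: "'a::metric_space set \<Rightarrow> ('a \<Rightarrow> real) \<Rightarrow> 'a set \<Rightarrow> bool" where
  "majority_halfspace S w h \<longleftrightarrow> median_halfspace h \<and> depth S w (- h) < depth S w h"

definition centre_set :: "'a::metric_space set \<Rightarrow> ('a \<Rightarrow> real) \<Rightarrow> 'a set" where
  "centre_set S w = \<Inter>{closure h |h. majority_halfspace S w h}"

lemma depth_bdd_above:
  assumes "bounded S" "bdd_above (w ` S)"
  shows "bdd_above ((\<lambda>x. signed_dist x h + w x) ` S)"
proof (cases "S = {}")
  case False
  then obtain x0 where "x0 \<in> S" by blast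
  obtain B where B: "\<And>x. x \<in> S \<Longrightarrow> dist x0 x \<le> B" using assms(1) bounded_any_center[of S x0] by auto
  obtain W where W: "\<And>x. x \<in> S \<Longrightarrow> w x \<le> W" using assms(2) by (auto simp: bdd_above_def)
  have "signed_dist x h + w x \<le> signed_dist x0 h + 2 * B + W" if "x \<in> S" for x
    using signed_dist_lipschitz[of x h x0] B[OF that] W[OF that] by (simp add: dist_commute)
  thus ?thesis unfolding bdd_above_def by blast
qed simp

lemma depth_upper:
  assumes "bounded S" "bdd_above (w ` S)" "x \<in> S"
  shows "signed_dist x h + w x \<le> depth S w h"
  unfolding depth_def by (rule cSUP_upper[OF assms(3) depth_bdd_above[OF assms(1,2)]])

lemma depth_gap:
  fixes h k :: "'a::median_space set"
  assumes S: "bounded S" "S \<noteq> {}" "bdd_above (w ` S)" and conn: "connected (UNIV :: 'a set)"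
    and hk: "h \<subseteq> k" "k \<noteq> UNIV" "h \<noteq> {}"
    and gap: "\<And>a b. a \<in> h \<Longrightarrow> b \<notin> k \<Longrightarrow> dist a b \<ge> \<gamma>"
  shows "depth S w k \<ge> depth S w h + \<gamma>"
proof -
  have "depth S w h \<le> depth S w k - \<gamma>"
    unfolding depth_def[of S w h]
  proof (rule cSUP_least[OF S(2)])
    fix x assume x: "x \<in> S"
    show "signed_dist x h + w x \<le> depth S w k - \<gamma>"
      using depth_upper[OF S(1,3) x, of k] signed_dist_gap[OF conn hk gap, of x] by linarith
  qed
  thus ?thesis by simp
qed

lemma majority_halfspace_proper:
  assumes "majority_halfspace S w h"
  shows "h \<noteq> {}" "h \<noteq> UNIV"
proof -
  have "infdist x {} = 0" for x :: 'a by (simp add: infdist_def)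
  thus "h \<noteq> {}" "h \<noteq> UNIV"
    using assms by (auto simp: majority_halfspace_def depth_def signed_dist_def)
qed

text \<open>Of two disjoint majority halfspaces each would be contained in the complement of the other,
  which is less deep.\<close>

lemma majority_halfspaces_meet:
  fixes h k :: "'a::median_space set"
  assumes S: "bounded S" "S \<noteq> {}" "bdd_above (w ` S)" and conn: "connected (UNIV :: 'a set)"
    and h: "majority_halfspace S w h" and k: "majority_halfspace S w k"
  shows "h \<inter> k \<noteq> {}"
proof
  assume "h \<inter> k = {}"
  hence sub: "h \<subseteq> - k" "k \<subseteq> - h" by auto
  note p = majority_halfspace_proper[OF h] majority_halfspace_proper[OF k]
  have "depth S w (- k) \<ge> depth S w h + 0"
    by (rule depth_gap[OF S conn]) (use sub p in auto)
  moreover have "depth S w (- h) \<ge> depth S w k + 0"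
    by (rule depth_gap[OF S conn]) (use sub p in auto)
  ultimately show False using h k by (auto simp: majority_halfspace_def)
qed

lemma majority_halfspace_meets_support:
  assumes S: "bounded S" "S \<noteq> {}" "bdd_above (w ` S)" and h: "majority_halfspace S w h"
  shows "h \<inter> S \<noteq> {}"
proof
  assume "h \<inter> S = {}"
  hence "signed_dist x h \<le> signed_dist x (- h)" if "x \<in> S" for x
  proof -
    have "x \<in> - h" using that \<open>h \<inter> S = {}\<close> by blast
    thus ?thesis by (simp add: signed_dist_def infdist_nonneg)
  qed
  hence "depth S w h \<le> depth S w (- h)"
    unfolding depth_def by (intro cSUP_mono depth_bdd_above S) (meson add_right_mono)
  thus False using h by (simp add: majority_halfspace_def)
qed

text \<open>Majority halfspaces meet each other and the support.  Finite rank is used for the boundedness of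
  the hull of the support, without which the intersection might escape to infinity.\<close>

theorem centre_set_nonempty:
  fixes S :: "'a::{polish_space, median_space} set"
  assumes S: "bounded S" "S \<noteq> {}" "bdd_above (w ` S)" and conn: "connected (UNIV :: 'a set)"
    and fr: "finite_rank TYPE('a)"
  shows "centre_set S w \<noteq> {}"
proof -
  define K where "K = closure (median_convex hull S)"
  let ?F = "insert K {closure h |h. majority_halfspace S w h}"
  have "S \<subseteq> K" unfolding K_def using hull_subset[of S median_convex] closure_subset by (rule order_trans)
  hence Kh: "K \<inter> closure h \<noteq> {}" if "majority_halfspace S w h" for h
    using majority_halfspace_meets_support[OF S that] closure_subset[of h] by blast
  have hh: "closure h \<inter> closure k \<noteq> {}" if "majority_halfspace S w h" "majority_halfspace S w k" for h k
    using majority_halfspaces_meet[OF S conn that] closure_subset[of h] closure_subset[of k] by blast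
  have "K \<noteq> {}" using S \<open>S \<subseteq> K\<close> by blast
  have "\<Inter>?F \<noteq> {}"
  proof (rule closed_convex_common_point[where K = K])
    show "median_convex A" if "A \<in> ?F" for A
      using that unfolding K_def
      by (auto intro!: closure_median_convex simp: majority_halfspace_def median_halfspace_def)
    show "A \<inter> B \<noteq> {}" if "A \<in> ?F" "B \<in> ?F" for A B
      using that Kh hh \<open>K \<noteq> {}\<close> by (auto simp: Int_commute)
    show "bounded K" unfolding K_def by (intro bounded_closure bounded_hull fr S)
  qed (auto simp: K_def)
  thus ?thesis unfolding centre_set_def by blast
qed

text \<open>If the centres are apart, two nested halfspaces with a gap separate them, and the depths
  for the two weights compare differently.\<close>

theorem centre_set_stable:
  assumes fr: "finite_rank TYPE('a::median_space)" and conn: "connected (UNIV :: 'a set)" and "\<eta> > 0"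
  obtains \<theta> where "\<theta> > 0"
    "\<And>(S :: 'a set) w S' w' c c'. bounded S' \<Longrightarrow> S' \<noteq> {} \<Longrightarrow> bdd_above (w' ` S') \<Longrightarrow>
       (\<And>h. \<bar>depth S w h - depth S' w' h\<bar> < \<theta>) \<Longrightarrow>
       c \<in> centre_set S w \<Longrightarrow> c' \<in> centre_set S' w' \<Longrightarrow> dist c c' < \<eta>"
proof -
  obtain \<gamma> where \<gamma>: "\<gamma> > 0" and nest: "\<And>x y :: 'a. dist x y \<ge> \<eta> \<Longrightarrow> \<exists>h k. nested_separation \<gamma> x y h k"
    using nested_halfspaces[OF fr \<open>\<eta> > 0\<close>] by blast
  show ?thesis
  proof (rule that[OF \<gamma>])
    fix S S' :: "'a set" and w w' c c'
    assume S': "bounded S'" "S' \<noteq> {}" "bdd_above (w' ` S')"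
      and close: "\<And>h. \<bar>depth S w h - depth S' w' h\<bar> < \<gamma>"
      and c: "c \<in> centre_set S w" and c': "c' \<in> centre_set S' w'"
    show "dist c c' < \<eta>"
    proof (rule ccontr)
      assume "\<not> dist c c' < \<eta>"
      then obtain h k where "nested_separation \<gamma> c c' h k" using nest[of c c'] by auto
      hence hk: "median_halfspace h" "median_halfspace k" "ball c \<gamma> \<subseteq> h" "h \<subseteq> k"
        "ball c' \<gamma> \<inter> k = {}" "\<And>a b. a \<in> h \<Longrightarrow> b \<notin> k \<Longrightarrow> dist a b \<ge> \<gamma>"
        unfolding nested_separation_def by auto
      have "c \<notin> closure (- h)" using hk(3) \<gamma> closure_approachable[of c "- h"] by (force simp: dist_commute)
      hence "\<not> majority_halfspace S w (- h)" using c by (auto simp: centre_set_def)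
      hence 1: "depth S w (- h) \<le> depth S w h" using hk(1) by (simp add: majority_halfspace_def not_less)
      have "c' \<notin> closure k" using hk(5) \<gamma> closure_approachable[of c' k] by (force simp: dist_commute)
      hence "\<not> majority_halfspace S' w' k" using c' by (auto simp: centre_set_def)
      hence 2: "depth S' w' k \<le> depth S' w' (- k)" using hk(2) by (simp add: majority_halfspace_def not_less)
      have ne: "c \<in> h" "c' \<notin> k" using hk \<gamma> by force+
      have "depth S' w' k \<ge> depth S' w' h + \<gamma>"
        by (rule depth_gap[OF S' conn]) (use hk ne in auto)
      moreover have "depth S' w' (- h) \<ge> depth S' w' (- k) + \<gamma>"
      proof (rule depth_gap[OF S' conn])
        show "\<gamma> \<le> dist a b" if "a \<in> - k" "b \<notin> - h" for a b
          using hk(6)[of b a] that by (simp add: dist_commute)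
      qed (use hk ne in auto)
      ultimately show False using 1 2 close[of h] close[of "- h"] by linarith
    qed
  qed
qed

definition isometric_bij :: "('a::metric_space \<Rightarrow> 'a) \<Rightarrow> bool" where
  "isometric_bij a \<longleftrightarrow> bij a \<and> (\<forall>x y. dist (a x) (a y) = dist x y)"

lemma isometries_iff: "a \<in> isometries \<longleftrightarrow> isometric_bij a"
proof -
  have "inj a" if "\<forall>x y. dist (a x) (a y) = dist x y"
    using that by (intro injI) (metis dist_eq_0_iff)
  thus ?thesis unfolding isometries_def isometric_bij_def bij_def by blast
qed

lemma isometric_image_interval:
  assumes "isometric_bij a"
  shows "a c \<in> metric_interval (a x) (a y) \<longleftrightarrow> c \<in> metric_interval x y"
  using assms by (simp add: in_metric_interval isometric_bij_def)

lemma isometric_image_infdist: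
  assumes a: "isometric_bij a"
  shows "infdist (a x) (a ` A) = infdist x A"
  using a by (simp add: infdist_def image_image isometric_bij_def)

lemma isometric_image_signed_dist:
  assumes a: "isometric_bij a"
  shows "signed_dist (a x) (a ` h) = signed_dist x h"
  using isometric_image_infdist[OF a] a
  by (simp add: signed_dist_def isometric_bij_def bij_image_Compl_eq[symmetric])

lemma centre_set_isometric_image:
  assumes a: "isometric_bij a" and w: "\<And>x. w' (a x) = w x" and c: "c \<in> centre_set S w"
  shows "a c \<in> centre_set (a ` S) w'"
proof -
  have bij: "bij a" using a by (simp add: isometric_bij_def)
  have d: "depth (a ` S) w' (a ` h) = depth S w h" for h
    using w isometric_image_signed_dist[OF a] by (simp add: depth_def image_image)
  have "a c \<in> closure k" if k: "majority_halfspace (a ` S) w' k" for k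
  proof -
    define h where "h = a -` k"
    have k_h: "k = a ` h" "- k = a ` (- h)" unfolding h_def using bij
      by (auto simp: surj_image_vimage_eq bij_is_surj vimage_Compl[symmetric])
    have "median_convex (a -` C)" if "median_convex C" for C
      by (rule median_convexI) (use that isometric_image_interval[OF a] in \<open>auto dest: median_convexD\<close>)
    hence "median_halfspace h"
      using k unfolding h_def majority_halfspace_def median_halfspace_def by (metis vimage_Compl)
    hence "majority_halfspace S w h" using k d k_h unfolding majority_halfspace_def by metis
    hence "c \<in> closure h" using c by (auto simp: centre_set_def)
    hence "\<forall>e>0. \<exists>y\<in>h. dist y c < e" by (simp add: closure_approachable)
    hence "\<forall>e>0. \<exists>y\<in>k. dist y (a c) < e" using a unfolding k_h by (auto simp: isometric_bij_def)
    thus ?thesis by (simp add: closure_approachable)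
  qed
  thus ?thesis by (auto simp: centre_set_def)
qed


section \<open>The centre of a function vanishing at infinity\<close>

definition profile :: "('a::metric_space \<Rightarrow> real) \<Rightarrow> bool" where
  "profile u \<longleftrightarrow> (\<forall>x. 0 \<le> u x) \<and> bdd_above (range u) \<and> (\<exists>x. u x > 0) \<and> (\<forall>e>0. bounded {x. u x \<ge> e})"

definition peak :: "('a \<Rightarrow> real) \<Rightarrow> real" where
  "peak u = (SUP x. u x)"

text \<open>The support is the set where \<open>u\<close> exceeds a quarter of its supremum; the weight tends to minus
  infinity towards its edge, so that the depths depend continuously on \<open>u\<close>.\<close>

definition profile_support :: "('a \<Rightarrow> real) \<Rightarrow> 'a set" where
  "profile_support u = {x. u x / peak u > 1/4}"

definition profile_weight :: "('a \<Rightarrow> real) \<Rightarrow> 'a \<Rightarrow> real" where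
  "profile_weight u x = - 1 / (u x / peak u - 1/4)"

definition centre :: "('a::metric_space \<Rightarrow> real) \<Rightarrow> 'a" where
  "centre u = (SOME c. c \<in> centre_set (profile_support u) (profile_weight u))"

lemma profile_peak:
  assumes "profile u"
  shows "peak u > 0" "u x \<le> peak u" "e < peak u \<Longrightarrow> \<exists>x. u x > e"
proof -
  obtain x0 where x0: "u x0 > 0" using assms by (auto simp: profile_def)
  show le: "u x \<le> peak u" for x unfolding peak_def using assms by (intro cSUP_upper) (auto simp: profile_def)
  show "peak u > 0" using x0 le[of x0] by linarith
  show "e < peak u \<Longrightarrow> \<exists>x. u x > e"
    unfolding peak_def using assms by (subst (asm) less_cSUP_iff) (auto simp: profile_def)
qed

lemma profile_support_props:
  assumes u: "profile u"
  shows "bounded (profile_support u)" "profile_support u \<noteq> {}" "bdd_above (profile_weight u ` profile_support u)"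
proof -
  note p = profile_peak[OF u]
  have "profile_support u \<subseteq> {x. u x \<ge> peak u / 4}" using p(1) by (auto simp: profile_support_def field_simps)
  moreover have "bounded {x. u x \<ge> peak u / 4}" using u p(1) unfolding profile_def by (metis zero_less_divide_iff zero_less_numeral)
  ultimately show "bounded (profile_support u)" using bounded_subset by blast
  obtain x where "u x > peak u / 2" using p(3)[of "peak u / 2"] p(1) by auto
  hence "x \<in> profile_support u" using p(1) by (auto simp: profile_support_def field_simps)
  thus "profile_support u \<noteq> {}" by blast
  show "bdd_above (profile_weight u ` profile_support u)"
    unfolding bdd_above_def by (rule exI[of _ 0]) (auto simp: profile_weight_def profile_support_def)
qed

lemma weight_perturbation:
  fixes s t :: real
  assumes s: "s - 1/4 \<ge> 2 * \<kappa>" and st: "\<bar>s - t\<bar> \<le> \<tau>" and \<tau>: "\<tau> \<le> \<kappa>" and \<kappa>: "\<kappa> > 0"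
  shows "t > 1/4" "- 1 / (s - 1/4) \<le> - 1 / (t - 1/4) + \<tau> / \<kappa>\<^sup>2"
proof -
  have t: "t - 1/4 \<ge> \<kappa>" using assms by linarith
  thus "t > 1/4" using \<kappa> by linarith
  have "1 / (t - 1/4) - 1 / (s - 1/4) = (s - t) / ((t - 1/4) * (s - 1/4))"
    using t s \<kappa> by (simp add: field_simps)
  also have "\<dots> \<le> \<tau> / (\<kappa> * \<kappa>)"
  proof (rule frac_le)
    show "\<kappa> * \<kappa> \<le> (t - 1/4) * (s - 1/4)" using t s \<kappa> by (intro mult_mono) auto
  qed (use st \<kappa> in auto)
  finally show "- 1 / (s - 1/4) \<le> - 1 / (t - 1/4) + \<tau> / \<kappa>\<^sup>2" by (simp add: power2_eq_square)
qed

text \<open>Points near the edge of the support are irrelevant for the depth, because a point where \<open>u\<close>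
  is near its peak does better.\<close>

lemma depth_profile_le:
  fixes u v :: "'a::metric_space \<Rightarrow> real"
  assumes u: "profile u" and v: "profile v"
    and x0: "u x0 / peak u > 5/8" "v x0 / peak v > 5/8"
    and D: "\<And>x. x \<in> profile_support u \<Longrightarrow> dist x x0 \<le> D" "D \<ge> 0"
    and uv: "\<And>x. \<bar>u x / peak u - v x / peak v\<bar> \<le> \<tau>" and \<tau>: "\<tau> \<le> 1 / (2 * (2 * D + 3))"
  shows "depth (profile_support u) (profile_weight u) h
    \<le> depth (profile_support v) (profile_weight v) h + \<tau> * (2 * (2 * D + 3))\<^sup>2"
proof -
  \<comment> \<open>Over the support the signed distance varies by at most \<open>2 * D\<close>, and \<open>3\<close> exceeds the penalty at \<open>x0\<close>.\<close>
  define \<kappa> where "\<kappa> = 1 / (2 * (2 * D + 3))"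
  have \<kappa>: "\<kappa> > 0" "2 * \<kappa> = 1 / (2 * D + 3)" "\<tau> / \<kappa>\<^sup>2 = \<tau> * (2 * (2 * D + 3))\<^sup>2" "2 * \<kappa> \<le> 3/8"
    using D(2) by (auto simp: \<kappa>_def field_simps power2_eq_square)
  have relevant: "signed_dist x h + profile_weight u x
      \<le> depth (profile_support v) (profile_weight v) h + \<tau> / \<kappa>\<^sup>2" if x: "u x / peak u - 1/4 \<ge> 2 * \<kappa>" for x
  proof -
    note w = weight_perturbation[OF x uv[of x] \<tau>[folded \<kappa>_def] \<kappa>(1)]
    have "x \<in> profile_support v" using w(1) by (simp add: profile_support_def)
    hence "signed_dist x h + profile_weight v x \<le> depth (profile_support v) (profile_weight v) h"
      by (intro depth_upper profile_support_props v)
    thus ?thesis using w(2) unfolding profile_weight_def by linarith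
  qed
  have x0w: "profile_weight u x0 \<ge> - 3"
  proof -
    have "1 / (u x0 / peak u - 1/4) \<le> 1 / (3/8)" using x0 by (intro divide_left_mono) auto
    thus ?thesis unfolding profile_weight_def by (simp add: field_simps)
  qed
  have "signed_dist x h + profile_weight u x
      \<le> depth (profile_support v) (profile_weight v) h + \<tau> / \<kappa>\<^sup>2" if x: "x \<in> profile_support u" for x
  proof (cases "u x / peak u - 1/4 \<ge> 2 * \<kappa>")
    case True
    thus ?thesis by (rule relevant)
  next
    case False
    define r where "r = u x / peak u - 1/4"
    have r: "r > 0" "r < 1 / (2 * D + 3)" using x False \<kappa>(2) by (auto simp: r_def profile_support_def)
    have "1 / r > 2 * D + 3" using r D(2) by (simp add: field_simps)
    hence "profile_weight u x < - (2 * D + 3)" by (simp add: profile_weight_def r_def)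
    moreover have "signed_dist x h \<le> signed_dist x0 h + 2 * D"
      using signed_dist_lipschitz[of x h x0] D(1)[OF x] by linarith
    ultimately have "signed_dist x h + profile_weight u x \<le> signed_dist x0 h + profile_weight u x0"
      using x0w by linarith
    also have "\<dots> \<le> depth (profile_support v) (profile_weight v) h + \<tau> / \<kappa>\<^sup>2"
      using x0 \<kappa> by (intro relevant) linarith
    finally show ?thesis .
  qed
  thus ?thesis unfolding depth_def[of "profile_support u"] \<kappa>(3)[symmetric]
    by (intro cSUP_least profile_support_props u)
qed

lemma peak_close:
  assumes u: "profile u" and v: "profile v" and uv: "\<And>x. \<bar>u x - v x\<bar> \<le> e"
  shows "\<bar>peak u - peak v\<bar> \<le> e"
proof -
  have "peak u \<le> peak v + e" unfolding peak_def[of u]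
    using profile_peak(2)[OF v] uv by (intro cSUP_least) (simp, metis abs_diff_le_iff add.commute diff_le_eq order_trans)
  moreover have "peak v \<le> peak u + e" unfolding peak_def[of v]
    using profile_peak(2)[OF u] uv by (intro cSUP_least) (simp, metis abs_diff_le_iff add.commute diff_le_eq order_trans)
  ultimately show ?thesis by linarith
qed

lemma normalised_close:
  assumes u: "profile u" and v: "profile v" and uv: "\<And>x. \<bar>u x - v x\<bar> \<le> e"
  shows "\<bar>u x / peak u - v x / peak v\<bar> \<le> 2 * e / peak u"
proof -
  note pu = profile_peak[OF u] and pv = profile_peak[OF v]
  have "u x / peak u - v x / peak v = (u x - v x) / peak u + (v x / peak v) * ((peak v - peak u) / peak u)"
    using pu(1) pv(1) by (simp add: field_simps)
  also have "\<bar>\<dots>\<bar> \<le> \<bar>(u x - v x) / peak u\<bar> + \<bar>v x / peak v\<bar> * \<bar>(peak v - peak u) / peak u\<bar>"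
    by (metis abs_mult abs_triangle_ineq)
  also have "\<dots> \<le> e / peak u + 1 * (e / peak u)"
  proof (intro add_mono mult_mono)
    show "\<bar>(u x - v x) / peak u\<bar> \<le> e / peak u" using uv[of x] pu(1) by (simp add: abs_divide divide_right_mono)
    show "\<bar>(peak v - peak u) / peak u\<bar> \<le> e / peak u"
      using peak_close[OF u v uv] pu(1) by (simp add: abs_divide divide_right_mono abs_minus_commute)
    have "0 \<le> v x" using v by (simp add: profile_def)
    thus "\<bar>v x / peak v\<bar> \<le> 1" using pv(1) pv(2)[of x] by simp
  qed auto
  finally show ?thesis by simp
qed

context
  fixes u :: "'a::{polish_space, median_space} \<Rightarrow> real"
  assumes fr: "finite_rank TYPE('a)" and conn: "connected (UNIV :: 'a set)" and u: "profile u"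
begin

lemma centre_in: "centre u \<in> centre_set (profile_support u) (profile_weight u)"
  unfolding centre_def
  using centre_set_nonempty[OF profile_support_props[OF u] conn fr] by (metis equals0I someI_ex)

lemma centre_unique:
  assumes "c \<in> centre_set (profile_support u) (profile_weight u)"
  shows "c = centre u"
proof (rule ccontr)
  assume "c \<noteq> centre u"
  hence pos: "dist c (centre u) > 0" by simp
  obtain \<theta> where \<theta>: "\<theta> > 0"
    "\<And>(S :: 'a set) w S' w' b b'. bounded S' \<Longrightarrow> S' \<noteq> {} \<Longrightarrow> bdd_above (w' ` S') \<Longrightarrow>
       (\<And>h. \<bar>depth S w h - depth S' w' h\<bar> < \<theta>) \<Longrightarrow>
       b \<in> centre_set S w \<Longrightarrow> b' \<in> centre_set S' w' \<Longrightarrow> dist b b' < dist c (centre u)"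
    by (rule centre_set_stable[OF fr conn pos]) blast
  from \<theta>(2)[OF profile_support_props[OF u] _ assms centre_in] \<theta>(1) 
  have "dist c (centre u) < dist c (centre u)" by simp
  thus False by simp
qed

text \<open>Functions that are uniformly close have uniformly close depths, so stability applies.\<close>

theorem centre_continuous:
  assumes v: "\<And>n::nat. profile (v n)"
    and lim: "\<And>e. e > 0 \<Longrightarrow> \<forall>\<^sub>F n in sequentially. \<forall>x. \<bar>u x - v n x\<bar> \<le> e"
  shows "(\<lambda>n. centre (v n)) \<longlonglongrightarrow> centre u"
proof (rule metric_LIMSEQ_I)
  fix \<eta> :: real assume "\<eta> > 0"
  obtain \<theta> where \<theta>: "\<theta> > 0"
    "\<And>(S :: 'a set) w S' w' c c'. bounded S' \<Longrightarrow> S' \<noteq> {} \<Longrightarrow> bdd_above (w' ` S') \<Longrightarrow>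
       (\<And>h. \<bar>depth S w h - depth S' w' h\<bar> < \<theta>) \<Longrightarrow>
       c \<in> centre_set S w \<Longrightarrow> c' \<in> centre_set S' w' \<Longrightarrow> dist c c' < \<eta>"
    by (rule centre_set_stable[OF fr conn \<open>\<eta> > 0\<close>]) blast
  note p = profile_peak[OF u]
  obtain x0 where x0: "u x0 > 3/4 * peak u" using p(3)[of "3/4 * peak u"] p(1) by auto
  have "bounded {x. u x \<ge> peak u / 8}" using u p(1) unfolding profile_def by (metis zero_less_divide_iff zero_less_numeral)
  then obtain D0 where D0: "\<And>x. u x \<ge> peak u / 8 \<Longrightarrow> dist x0 x \<le> D0"
    using bounded_any_center[of _ x0] by (metis mem_Collect_eq)
  define D where "D = max D0 0"
  define L where "L = (2 * (2 * D + 3))\<^sup>2"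
  have L: "2 * D + 3 > 0" "L > 0" unfolding L_def D_def by auto
  define \<tau> where "\<tau> = min (1 / 9) (min (1 / (2 * (2 * D + 3))) (\<theta> / (2 * L)))"
  have \<tau>: "\<tau> > 0" "\<tau> < 1/8" "\<tau> \<le> 1 / (2 * (2 * D + 3))" "\<tau> * L < \<theta>"
  proof -
    show "\<tau> > 0" using \<theta>(1) L unfolding \<tau>_def D_def by (auto simp: max_def)
    have "\<tau> * L \<le> \<theta> / (2 * L) * L" using L unfolding \<tau>_def by (intro mult_right_mono) auto
    also have "\<dots> < \<theta>" using L \<theta>(1) by simp
    finally show "\<tau> * L < \<theta>" .
  qed (auto simp: \<tau>_def)
  from lim[of "\<tau> * peak u / 2"] \<tau>(1) p(1)
  obtain N where N: "\<And>n x. n \<ge> N \<Longrightarrow> \<bar>u x - v n x\<bar> \<le> \<tau> * peak u / 2"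
    by (auto simp: eventually_sequentially)
  have "dist (centre (v n)) (centre u) < \<eta>" if n: "n \<ge> N" for n
  proof -
    have uv: "\<bar>u x / peak u - v n x / peak (v n)\<bar> \<le> \<tau>" for x
      using normalised_close[OF u v N[OF n], of x] p(1) by simp
    have ux0: "u x0 / peak u > 3/4" using x0 p(1) by (simp add: field_simps)
    hence ux0': "u x0 / peak u > 5/8" by linarith
    have vx0: "v n x0 / peak (v n) > 5/8" using ux0 uv[of x0] \<tau>(2) by linarith
    have Du: "dist x x0 \<le> D" if "x \<in> profile_support u" for x
    proof -
      have "u x \<ge> peak u / 8" using that p(1) by (auto simp: profile_support_def field_simps)
      thus ?thesis using D0[of x] by (simp add: D_def dist_commute)
    qed
    have Dv: "dist x x0 \<le> D" if "x \<in> profile_support (v n)" for x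
    proof -
      have "v n x / peak (v n) > 1 / 4" using that by (simp add: profile_support_def)
      hence "u x / peak u \<ge> 1 / 8" using uv[of x] \<tau>(2) by linarith
      hence "u x \<ge> peak u / 8" using p(1) by (auto simp: field_simps)
      thus ?thesis using D0[of x] by (simp add: D_def dist_commute)
    qed
    have D: "D \<ge> 0" by (simp add: D_def)
    have "\<bar>depth (profile_support (v n)) (profile_weight (v n)) h - depth (profile_support u) (profile_weight u) h\<bar> < \<theta>" for h
      using depth_profile_le[OF u v ux0' vx0 Du D uv \<tau>(3), of h]
        depth_profile_le[OF v u vx0 ux0' Dv D _ \<tau>(3), of h] uv \<tau>(4) unfolding L_def
      by (simp add: abs_minus_commute abs_less_iff)
    thus ?thesis
      using \<theta>(2)[OF profile_support_props[OF u]] centre_in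
        someI_ex[of "\<lambda>c. c \<in> centre_set (profile_support (v n)) (profile_weight (v n))"]
        centre_set_nonempty[OF profile_support_props[OF v] conn fr, of n]
      unfolding centre_def by blast
  qed
  thus "\<exists>N. \<forall>n\<ge>N. dist (centre (v n)) (centre u) < \<eta>" by blast
qed

end

theorem centre_equivariant:
  fixes u v :: "'a::{polish_space, median_space} \<Rightarrow> real"
  assumes fr: "finite_rank TYPE('a)" and conn: "connected (UNIV :: 'a set)"
    and u: "profile u" and v: "profile v"
    and a: "isometric_bij a" and va: "\<And>x. v (a x) = u x"
  shows "centre v = a (centre u)"
proof -
  have surj: "\<exists>x. y = a x" for y using a by (metis bij_pointE isometric_bij_def)
  have "range v = range u" using surj va by (metis (mono_tags, opaque_lifting) rangeE rangeI subsetI subset_antisym)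
  hence pk: "peak v = peak u" by (simp add: peak_def)
  have S: "profile_support v = a ` profile_support u"
    using surj va pk unfolding profile_support_def by (auto simp: image_iff) metis
  have "a (centre u) \<in> centre_set (a ` profile_support u) (profile_weight v)"
    by (rule centre_set_isometric_image[OF a _ centre_in[OF fr conn u]]) (simp add: profile_weight_def va pk)
  thus ?thesis using centre_unique[OF fr conn v, of "a (centre u)"] S by simp
qed


section \<open>The kernel of exponentials of distances is positive definite\<close>

text \<open>Each factor is a convex combination of the constant kernel and of a kernel of rank one, and
  multiplication by the latter amounts to a change of the coefficients \<open>c\<close>.\<close>

lemma positive_product_kernel:
  fixes p :: "'w \<Rightarrow> real" and s :: "'w \<Rightarrow> 'i \<Rightarrow> real" and c :: "'i \<Rightarrow> real"
  assumes "finite W" "\<And>w. w \<in> W \<Longrightarrow> 0 \<le> p w" "\<And>w. w \<in> W \<Longrightarrow> p w \<le> 1"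
  shows "0 \<le> (\<Sum>i\<in>I. \<Sum>j\<in>I. c i * c j * (\<Prod>w\<in>W. (1 - p w) + p w * s w i * s w j))"
  using assms
proof (induction W arbitrary: c rule: finite_induct)
  case empty
  have "(\<Sum>i\<in>I. \<Sum>j\<in>I. c i * c j) = (\<Sum>i\<in>I. c i)\<^sup>2"
    by (simp add: power2_eq_square sum_product)
  thus ?case by simp
next
  case (insert v W)
  let ?P = "\<lambda>i j. \<Prod>w\<in>W. (1 - p w) + p w * s w i * s w j"
  have "c i * c j * (\<Prod>w\<in>insert v W. (1 - p w) + p w * s w i * s w j)
      = (1 - p v) * (c i * c j * ?P i j) + p v * ((c i * s v i) * (c j * s v j) * ?P i j)" for i j
    using insert(1,2) by (simp add: algebra_simps)
  hence "(\<Sum>i\<in>I. \<Sum>j\<in>I. c i * c j * (\<Prod>w\<in>insert v W. (1 - p w) + p w * s w i * s w j))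
     = (1 - p v) * (\<Sum>i\<in>I. \<Sum>j\<in>I. c i * c j * ?P i j)
       + p v * (\<Sum>i\<in>I. \<Sum>j\<in>I. (c i * s v i) * (c j * s v j) * ?P i j)"
    by (simp add: sum.distrib sum_distrib_left)
  also have "\<dots> \<ge> 0"
    using insert by (intro add_nonneg_nonneg mult_nonneg_nonneg insert.IH) auto
  finally show ?case .
qed

lemma moebius_inversion_exists:
  fixes \<rho> :: "'a \<Rightarrow> real" and le :: "'a \<Rightarrow> 'a \<Rightarrow> bool"
  assumes "finite L" "\<And>x. le x x" "\<And>w x. le w x \<Longrightarrow> w \<noteq> x \<Longrightarrow> \<rho> w < \<rho> x"
  shows "\<exists>g. \<forall>x\<in>L. \<rho> x = (\<Sum>w\<in>{w\<in>L. le w x}. g w)"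
  using assms(1)
proof (induction L rule: finite_ranking_induct[where f = \<rho>])
  case empty
  show ?case by simp
next
  case (insert x S)
  show ?case
  proof (cases "x \<in> S")
    case True
    thus ?thesis using insert by (simp add: insert_absorb)
  next
    case False
    from insert obtain g where g: "\<And>y. y \<in> S \<Longrightarrow> \<rho> y = (\<Sum>w\<in>{w\<in>S. le w y}. g w)" by blast
    define g' where "g' = g(x := \<rho> x - (\<Sum>w\<in>{w\<in>S. le w x}. g w))"
    have eq: "(\<Sum>w\<in>{w\<in>S. le w y}. g' w) = (\<Sum>w\<in>{w\<in>S. le w y}. g w)" for y
      using False by (intro sum.cong) (auto simp: g'_def)
    have "\<rho> y = (\<Sum>w\<in>{w\<in>insert x S. le w y}. g' w)" if y: "y \<in> insert x S" for y
    proof (cases "y = x")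
      case True
      have "{w\<in>insert x S. le w x} = insert x {w\<in>S. le w x}" using assms by auto
      thus ?thesis using insert(1) False eq[of x] True by (simp add: g'_def)
    next
      case yx: False
      hence "\<not> le x y" using insert(2)[of y] y assms(3)[of x y] by auto
      hence "{w\<in>insert x S. le w y} = {w\<in>S. le w y}" by auto
      thus ?thesis using g[of y] y yx eq[of y] by simp
    qed
    thus ?thesis by blast
  qed
qed

context
  fixes o' :: "'a::median_space"
begin

abbreviation (input) below :: "'a \<Rightarrow> 'a \<Rightarrow> bool" where "below a b \<equiv> a \<in> metric_interval o' b"
abbreviation (input) meet :: "'a \<Rightarrow> 'a \<Rightarrow> 'a" where "meet \<equiv> median o'"
abbreviation (input) height :: "'a \<Rightarrow> real" where "height \<equiv> dist o'"

lemma meet_commute: "meet a b = meet b a"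
  by (rule median_swap23)

lemma below_meet_iff: "below w (meet a b) \<longleftrightarrow> below w a \<and> below w b"
proof safe
  assume "below w (meet a b)"
  thus "below w a" "below w b"
    using median_props[of o' a b] metric_interval_nest(1) by blast+
next
  assume "below w a" "below w b"
  hence 1: "meet w a = w" "meet w b = w" unfolding meet_commute[of w] by (simp_all only: median_eq_iff)
  have 2: "meet w o' = o'" "meet w w = w" by (rule median_unique; simp)+
  have "meet w (meet a b) = median (meet w o') (meet w a) (meet w b)"
    by (rule median_median)
  also have "\<dots> = w" unfolding 1 2 ..
  finally have "meet w (meet a b) = w" .
  thus "below w (meet a b)" using median_props(2)[of o' w "meet a b"] by metis
qed

lemma below_antisym: "below a b \<Longrightarrow> below b a \<Longrightarrow> a = b"
  by (auto simp: in_metric_interval dist_commute)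

lemma meet_assoc: "meet (meet a b) c = meet a (meet b c)"
proof (rule below_antisym)
  let ?l = "meet (meet a b) c" and ?r = "meet a (meet b c)"
  have "below ?l ?l" "below ?r ?r" by simp_all
  hence l: "below ?l a" "below ?l b" "below ?l c" and r: "below ?r a" "below ?r b" "below ?r c"
    unfolding below_meet_iff[of _ "meet a b" c] below_meet_iff[of _ a "meet b c"]
      below_meet_iff[of _ a b] below_meet_iff[of _ b c] by auto
  show "below ?l ?r" using l unfolding below_meet_iff[of ?l] by blast
  show "below ?r ?l" using r unfolding below_meet_iff[of ?r] by blast
qed

lemma meet_closed_superset:
  assumes "finite P"
  shows "\<exists>L. finite L \<and> P \<subseteq> L \<and> (\<forall>a\<in>L. \<forall>b\<in>L. meet a b \<in> L)"
  using assms
proof (induction P rule: finite_induct)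
  case empty
  show ?case by (rule exI[of _ "{}"]) auto
next
  case (insert p P)
  then obtain L where L: "finite L" "P \<subseteq> L" "\<And>a b. a \<in> L \<Longrightarrow> b \<in> L \<Longrightarrow> meet a b \<in> L" by blast
  let ?L = "insert p (L \<union> meet p ` L)"
  have idem: "meet a a = a" for a by (rule median_unique) auto
  have "meet a b \<in> ?L" if a: "a \<in> ?L" and b: "b \<in> ?L" for a b
  proof -
    have rep: "c = p \<or> c \<in> L \<or> (\<exists>l\<in>L. c = meet p l)" if "c \<in> ?L" for c using that by auto
    have pp: "meet p (meet p l) = meet p l" for l using meet_assoc[of p p l] idem by simp
    have 1: "meet p l \<in> ?L" if "l \<in> L" for l using that by blast
    have 2: "meet l (meet p l') = meet p (meet l l')" for l l' using meet_assoc meet_commute by metis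
    have 3: "meet (meet p l) (meet p l') = meet p (meet l l')" for l l' using meet_assoc meet_commute pp by metis
    have 4: "c \<in> ?L" if "c \<in> L" for c using that by blast
    from rep[OF a] consider "a = p" | "a \<in> L" | l where "l \<in> L" "a = meet p l" by blast
    thus ?thesis
    proof cases
      case 1
      from rep[OF b] show ?thesis using 1 \<open>\<And>l. l \<in> L \<Longrightarrow> meet p l \<in> ?L\<close> by (elim disjE bexE) (simp_all only: idem pp insertI1)
    next
      case a: 2
      from rep[OF b] show ?thesis
        using 1[OF a] 4[OF L(3)[OF a]] 1[OF L(3)[OF a]] by (elim disjE bexE) (simp_all only: 2 meet_commute[of a p])
    next
      case a: 3
      have *: "meet (meet p l) b' = meet p (meet l b')" for b' by (rule meet_assoc)
      from rep[OF b] show ?thesis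
        using 1[OF a(1)] 1[OF L(3)[OF a(1)]]
        by (elim disjE bexE) (simp_all only: a(2) 3 meet_commute[of _ p] pp *)
    qed
  qed
  thus ?case using L by (intro exI[of _ ?L]) auto
qed

text \<open>Inside the interval from \<open>o'\<close> to \<open>z\<close> the join of \<open>a\<close> and \<open>b\<close> is \<open>median z a b\<close>.\<close>

definition joins :: "'a \<Rightarrow> 'a list \<Rightarrow> 'a" where
  "joins z as = foldr (median z) as o'"

lemma joins_below: "set as \<subseteq> {a. below a z} \<Longrightarrow> below (joins z as) z"
proof (induction as)
  case Nil
  show ?case by (simp add: joins_def)
next
  case (Cons a as)
  have "median z a (joins z as) \<in> metric_interval a (joins z as)" by (rule median_props)
  moreover have "below a z" "below (joins z as) z" using Cons by auto
  ultimately show ?case using metric_interval_convex[of a o' z "joins z as"] by (auto simp: joins_def)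
qed

lemma meet_joins:
  assumes "below c z"
  shows "meet c (joins z as) = joins c (map (meet c) as)"
proof (induction as)
  case Nil
  show ?case by (auto simp: joins_def intro!: median_unique)
next
  case (Cons a as)
  have "meet c z = c" using assms by (metis median_eq_iff median_swap23)
  hence "meet c (median z a (joins z as)) = median c (meet c a) (meet c (joins z as))"
    using median_median[of o' c z a "joins z as"] by simp
  thus ?case using Cons by (simp add: joins_def)
qed

lemma height_join:
  assumes a: "below a z" and b: "below b z"
  shows "height (median z a b) = height a + height b - height (meet a b)"
proof -
  have ab: "below (median z a b) z"
    using metric_interval_convex[OF a b] median_props(3)[of z a b] by auto
  have "height z = height a + dist a z" "height z = height b + dist b z"
    "height z = height (median z a b) + dist (median z a b) z"
    using a b ab by (auto simp: in_metric_interval)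
  thus ?thesis using dist_median[of z a b] dist_median[of o' a b] dist_commute[of z a] dist_commute[of z b]
      dist_commute[of z "median z a b"] by argo
qed

text \<open>The Moebius inverse of the height is nonnegative: by inclusion and exclusion its sum over the
  elements below some member of a list is the height of the join of the list.\<close>

lemma moebius_height_joins:
  assumes L: "finite L" "\<And>a b. a \<in> L \<Longrightarrow> b \<in> L \<Longrightarrow> meet a b \<in> L"
    and g: "\<And>x. x \<in> L \<Longrightarrow> height x = (\<Sum>w\<in>{w\<in>L. below w x}. g w)"
    and as: "set as \<subseteq> L" "set as \<subseteq> {a. below a z}"
  shows "(\<Sum>w\<in>{w\<in>L. \<exists>a\<in>set as. below w a}. g w) = height (joins z as)"
  using as
proof (induction "length as" arbitrary: as z)
  case 0
  thus ?case by (simp add: joins_def)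
next
  case (Suc n)
  then obtain a bs where as: "as = a # bs" by (cases as) auto
  let ?G = "\<lambda>as. {w\<in>L. \<exists>a\<in>set as. below w a}"
  have a: "a \<in> L" "below a z" and bs: "set bs \<subseteq> L" "set bs \<subseteq> {a. below a z}" using Suc.prems as by auto
  have U: "?G as = {w\<in>L. below w a} \<union> ?G bs" using as by auto
  have I: "{w\<in>L. below w a} \<inter> ?G bs = ?G (map (meet a) bs)"
    by (auto simp: below_meet_iff)
  have "sum g (?G as) + sum g (?G (map (meet a) bs)) = sum g {w\<in>L. below w a} + sum g (?G bs)"
    unfolding U I[symmetric] using L(1) by (intro sum.union_inter) auto
  moreover have "sum g (?G bs) = height (joins z bs)"
    using Suc.hyps as bs by simp
  moreover have "sum g (?G (map (meet a) bs)) = height (joins a (map (meet a) bs))"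
    using Suc.hyps(2) as bs(1) a(1) L(2) median_props(2)[of o' a] 
    by (intro Suc.hyps(1)) (auto simp: meet_commute[of a] median_props(2))
  ultimately show ?case
    using g[OF a(1)] height_join[OF a(2) joins_below[OF bs(2)]] meet_joins[OF a(2), of bs] as
    by (simp add: joins_def)
qed

lemma moebius_height_nonneg:
  assumes L: "finite L" "\<And>a b. a \<in> L \<Longrightarrow> b \<in> L \<Longrightarrow> meet a b \<in> L"
    and g: "\<And>x. x \<in> L \<Longrightarrow> height x = (\<Sum>w\<in>{w\<in>L. below w x}. g w)" and z: "z \<in> L"
  shows "g z \<ge> 0"
proof -
  obtain as where as: "set as = {w\<in>L. below w z \<and> w \<noteq> z}"
    using finite_list[of "{w\<in>L. below w z \<and> w \<noteq> z}"] L(1) by auto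
  have eq: "{w\<in>L. \<exists>a\<in>set as. below w a} = set as"
  proof safe
    fix w a assume w: "w \<in> L" "a \<in> set as" "below w a"
    hence a: "below a z" "a \<noteq> z" using as by auto
    hence "below w z" using metric_interval_nest(1)[OF a(1) w(3)] by simp
    moreover have "w \<noteq> z" using w(3) a below_antisym[of a z] by auto
    ultimately show "w \<in> set as" using as w by simp
  next
    fix w assume w: "w \<in> set as"
    thus "w \<in> L" using as by simp
    show "\<exists>a\<in>set as. below w a" by (rule bexI[OF _ w]) simp
  qed
  have "sum g {w\<in>L. \<exists>a\<in>set as. below w a} = height (joins z as)"
  proof (rule moebius_height_joins)
    show "set as \<subseteq> L" "set as \<subseteq> {a. below a z}" by (auto simp: as)
  qed (fact L g)+
  hence sj: "sum g (set as) = height (joins z as)" unfolding eq .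
  have "{w\<in>L. below w z} = insert z (set as)" unfolding as using z by auto
  moreover have "z \<notin> set as" unfolding as by blast
  ultimately have "height z = g z + sum g (set as)" using g[OF z] by (simp only: sum.insert finite_set not_False_eq_True)
  moreover have "height (joins z as) \<le> height z"
  proof -
    have "below (joins z as) z" by (rule joins_below) (auto simp: as)
    thus ?thesis by (simp add: in_metric_interval)
  qed
  ultimately show ?thesis using sj by linarith
qed

text \<open>Each \<open>w\<close> cuts the points into those above \<open>w\<close> and the others; the cut has weight \<open>g w\<close>.\<close>

lemma dist_as_sum_of_cuts:
  assumes L: "finite L" "\<And>a b. a \<in> L \<Longrightarrow> b \<in> L \<Longrightarrow> meet a b \<in> L"
    and g: "\<And>x. x \<in> L \<Longrightarrow> height x = (\<Sum>w\<in>{w\<in>L. below w x}. g w)" and xy: "x \<in> L" "y \<in> L"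
  shows "dist x y = (\<Sum>w\<in>L. if below w x \<longleftrightarrow> below w y then 0 else g w)"
proof -
  have s: "height v = (\<Sum>w\<in>L. if below w v then g w else 0)" if "v \<in> L" for v
    using g[OF that] L(1) by (simp add: sum.inter_filter)
  have "dist x y = height x + height y - 2 * height (meet x y)"
    using dist_median[of o' x y] by simp
  also have "\<dots> = (\<Sum>w\<in>L. (if below w x then g w else 0) + (if below w y then g w else 0)
      - 2 * (if below w (meet x y) then g w else 0))"
    by (simp add: s xy L(2) sum.distrib sum_subtractf sum_distrib_left)
  also have "\<dots> = (\<Sum>w\<in>L. if below w x \<longleftrightarrow> below w y then 0 else g w)"
    by (intro sum.cong) (auto simp: below_meet_iff)
  finally show ?thesis .
qed

end

text \<open>After the points are closed up under meets their distances are sums of weighted cuts, so the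
  exponential is a product of kernels that depend on a single cut.\<close>

theorem exp_dist_positive_definite:
  fixes x :: "'i \<Rightarrow> 'a::median_space" and c :: "'i \<Rightarrow> real"
  assumes I: "finite I" and t: "t \<ge> 0"
  shows "0 \<le> (\<Sum>i\<in>I. \<Sum>j\<in>I. c i * c j * exp (- t * dist (x i) (x j)))"
proof -
  fix o' :: 'a
  obtain L where L: "finite L" "x ` I \<subseteq> L" "\<And>a b. a \<in> L \<Longrightarrow> b \<in> L \<Longrightarrow> median o' a b \<in> L"
    using meet_closed_superset[OF finite_imageI[OF I, of x], of o'] by metis
  have "\<exists>g. \<forall>y\<in>L. dist o' y = (\<Sum>w\<in>{w\<in>L. w \<in> metric_interval o' y}. g w)"
    by (rule moebius_inversion_exists[OF L(1)]) (auto simp: in_metric_interval dist_commute)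
  then obtain g where g: "\<And>y. y \<in> L \<Longrightarrow> dist o' y = (\<Sum>w\<in>{w\<in>L. w \<in> metric_interval o' y}. g w)" by blast
  note g0 = moebius_height_nonneg[OF L(1,3) g]
  define p where "p w = (1 - exp (- t * g w)) / 2" for w
  define s where "s w i = (if w \<in> metric_interval o' (x i) then 1 else - 1 :: real)" for w i
  have "exp (- t * dist (x i) (x j)) = (\<Prod>w\<in>L. (1 - p w) + p w * s w i * s w j)" if ij: "i \<in> I" "j \<in> I" for i j
  proof -
    have "dist (x i) (x j)
        = (\<Sum>w\<in>L. if w \<in> metric_interval o' (x i) \<longleftrightarrow> w \<in> metric_interval o' (x j) then 0 else g w)"
      using L(2) ij by (intro dist_as_sum_of_cuts L(1,3) g) auto
    hence "exp (- t * dist (x i) (x j))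
        = exp (\<Sum>w\<in>L. - t * (if w \<in> metric_interval o' (x i) \<longleftrightarrow> w \<in> metric_interval o' (x j) then 0 else g w))"
      by (simp only: sum_distrib_left)
    also have "\<dots> = (\<Prod>w\<in>L. (1 - p w) + p w * s w i * s w j)"
      unfolding exp_sum[OF L(1)] by (intro prod.cong) (auto simp: s_def p_def field_simps)
    finally show ?thesis .
  qed
  hence "(\<Sum>i\<in>I. \<Sum>j\<in>I. c i * c j * exp (- t * dist (x i) (x j)))
      = (\<Sum>i\<in>I. \<Sum>j\<in>I. c i * c j * (\<Prod>w\<in>L. (1 - p w) + p w * s w i * s w j))"
    by (intro sum.cong) auto
  also have "\<dots> \<ge> 0"
    by (rule positive_product_kernel[OF L(1)]) (use g0 t in \<open>auto simp: p_def field_simps add_nonneg_nonneg\<close>)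
  finally show ?thesis .
qed


section \<open>The Hilbert space of a positive definite kernel\<close>

definition fadd :: "('x \<Rightarrow> complex) \<Rightarrow> ('x \<Rightarrow> complex) \<Rightarrow> 'x \<Rightarrow> complex" where
  "fadd f g = (\<lambda>x. f x + g x)"

definition fscale :: "complex \<Rightarrow> ('x \<Rightarrow> complex) \<Rightarrow> 'x \<Rightarrow> complex" where
  "fscale c f = (\<lambda>x. c * f x)"

definition fzero :: "'x \<Rightarrow> complex" where
  "fzero = (\<lambda>x. 0)"

abbreviation fdiff :: "('x \<Rightarrow> complex) \<Rightarrow> ('x \<Rightarrow> complex) \<Rightarrow> 'x \<Rightarrow> complex" where
  "fdiff f g \<equiv> fadd f (fscale (- 1) g)"

definition fsupp :: "('x \<Rightarrow> complex) \<Rightarrow> 'x set" where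
  "fsupp a = {x. a x \<noteq> 0}"

definition dirac :: "'x \<Rightarrow> 'x \<Rightarrow> complex" where
  "dirac x = (\<lambda>y. if y = x then 1 else 0)"

lemma cauchy_schwarz_expansion:
  fixes l A B :: real and z :: complex
  defines "c \<equiv> - (of_real l * z)"
  shows "of_real A + cnj c * z + c * cnj z + c * cnj c * of_real B
    = of_real (A - 2 * l * (cmod z)\<^sup>2 + l\<^sup>2 * (cmod z)\<^sup>2 * B)"
  unfolding c_def cmod_power2 by (auto simp: complex_eq_iff power2_eq_square algebra_simps)

locale positive_kernel =
  fixes K :: "'x \<Rightarrow> 'x \<Rightarrow> real"
  assumes K_sym: "K x y = K y x"
    and K_pos: "finite S \<Longrightarrow> 0 \<le> (\<Sum>x\<in>S. \<Sum>y\<in>S. c x * c y * K x y)"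
begin

definition V :: "('x \<Rightarrow> complex) set" where
  "V = {a. finite (fsupp a)}"

definition bil :: "('x \<Rightarrow> complex) \<Rightarrow> ('x \<Rightarrow> complex) \<Rightarrow> complex" where
  "bil a b = (\<Sum>x\<in>fsupp a. \<Sum>y\<in>fsupp b. a x * cnj (b y) * of_real (K x y))"

definition nrm :: "('x \<Rightarrow> complex) \<Rightarrow> real" where
  "nrm a = sqrt (Re (bil a a))"

definition ev :: "('x \<Rightarrow> complex) \<Rightarrow> 'x \<Rightarrow> complex" where
  "ev a = (\<lambda>x. bil a (dirac x))"

lemma V_closed [simp]:
  "fzero \<in> V" "dirac x \<in> V" "a \<in> V \<Longrightarrow> b \<in> V \<Longrightarrow> fadd a b \<in> V" "a \<in> V \<Longrightarrow> fscale c a \<in> V"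
proof -
  show "fzero \<in> V" by (simp add: V_def fsupp_def fzero_def)
  show "dirac x \<in> V" by (simp add: V_def fsupp_def dirac_def)
  show "fadd a b \<in> V" if "a \<in> V" "b \<in> V"
    using that unfolding V_def by (auto simp: fsupp_def fadd_def intro: finite_subset[of _ "{x. a x \<noteq> 0} \<union> {x. b x \<noteq> 0}"])
  show "fscale c a \<in> V" if "a \<in> V"
    using that unfolding V_def by (auto simp: fsupp_def fscale_def intro: finite_subset[of _ "{x. a x \<noteq> 0}"])
qed

lemma bil_superset:
  assumes "finite S" "fsupp a \<subseteq> S" "finite T" "fsupp b \<subseteq> T"
  shows "bil a b = (\<Sum>x\<in>S. \<Sum>y\<in>T. a x * cnj (b y) * of_real (K x y))"
proof -
  have "bil a b = (\<Sum>x\<in>fsupp a. \<Sum>y\<in>T. a x * cnj (b y) * of_real (K x y))"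
    unfolding bil_def using assms by (intro sum.cong sum.mono_neutral_left) (auto simp: fsupp_def)
  also have "\<dots> = (\<Sum>x\<in>S. \<Sum>y\<in>T. a x * cnj (b y) * of_real (K x y))"
    using assms by (intro sum.mono_neutral_left) (auto simp: fsupp_def)
  finally show ?thesis .
qed

lemma bil_add_left:
  assumes "a \<in> V" "a' \<in> V" "b \<in> V"
  shows "bil (fadd a a') b = bil a b + bil a' b"
proof -
  let ?S = "fsupp a \<union> fsupp a'"
  have fin: "finite ?S" "finite (fsupp b)" using assms by (auto simp: V_def)
  have "fsupp (fadd a a') \<subseteq> ?S" by (auto simp: fsupp_def fadd_def)
  thus ?thesis
    using bil_superset[OF fin(1) _ fin(2), of "fadd a a'" b] bil_superset[OF fin(1) _ fin(2), of a b]
      bil_superset[OF fin(1) _ fin(2), of a' b]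
    by (simp add: sum.distrib[symmetric] fadd_def algebra_simps)
qed

lemma bil_scale_left:
  assumes "a \<in> V" "b \<in> V"
  shows "bil (fscale c a) b = c * bil a b"
proof -
  have fin: "finite (fsupp a)" "finite (fsupp b)" using assms by (auto simp: V_def)
  have "fsupp (fscale c a) \<subseteq> fsupp a" by (auto simp: fsupp_def fscale_def)
  thus ?thesis
    using bil_superset[OF fin(1) _ fin(2), of "fscale c a" b]
    by (simp add: bil_def sum_distrib_left fscale_def mult.assoc)
qed

lemma bil_commute: "bil a b = cnj (bil b a)"
  unfolding bil_def by (subst sum.swap) (auto simp: cnj_sum K_sym intro!: sum.cong)

lemma bil_add_right:
  assumes "a \<in> V" "b \<in> V" "b' \<in> V"
  shows "bil a (fadd b b') = bil a b + bil a b'"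
  using assms by (subst (1 2 3) bil_commute) (simp add: bil_add_left)

lemma bil_scale_right:
  assumes "a \<in> V" "b \<in> V"
  shows "bil a (fscale c b) = cnj c * bil a b"
  using assms by (subst (1 2) bil_commute) (simp add: bil_scale_left)

lemma bil_self:
  assumes "a \<in> V"
  shows "Re (bil a a) \<ge> 0" "bil a a = of_real (Re (bil a a))"
proof -
  let ?S = "fsupp a"
  have fin: "finite ?S" using assms by (simp add: V_def)
  have "Re (bil a a) = (\<Sum>x\<in>?S. \<Sum>y\<in>?S. Re (a x) * Re (a y) * K x y) + (\<Sum>x\<in>?S. \<Sum>y\<in>?S. Im (a x) * Im (a y) * K x y)"
    unfolding bil_def by (simp add: sum.distrib[symmetric] algebra_simps)
  thus "Re (bil a a) \<ge> 0" using K_pos[OF fin, of "\<lambda>x. Re (a x)"] K_pos[OF fin, of "\<lambda>x. Im (a x)"] by simp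
  have "Im (bil a a) = 0" using bil_commute[of a a] by (simp add: complex_eq_iff)
  thus "bil a a = of_real (Re (bil a a))" by (simp add: complex_eq_iff)
qed

lemma nrm_nonneg [simp]: "a \<in> V \<Longrightarrow> nrm a \<ge> 0"
  using bil_self(1)[of a] by (simp add: nrm_def)

lemma bil_self_nrm: "a \<in> V \<Longrightarrow> bil a a = of_real ((nrm a)\<^sup>2)"
  using bil_self[of a] by (simp add: nrm_def)

lemma cauchy_schwarz:
  assumes "a \<in> V" "b \<in> V"
  shows "cmod (bil a b) \<le> nrm a * nrm b"
proof -
  let ?z = "bil a b" and ?A = "(nrm a)\<^sup>2" and ?B = "(nrm b)\<^sup>2"
  have key: "0 \<le> ?A - 2 * l * (cmod ?z)\<^sup>2 + l\<^sup>2 * (cmod ?z)\<^sup>2 * ?B" for l :: real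
  proof -
    let ?c = "- (of_real l * ?z)"
    have "bil (fadd a (fscale ?c b)) (fadd a (fscale ?c b))
        = bil a a + cnj ?c * ?z + ?c * cnj ?z + ?c * cnj ?c * bil b b"
      using assms bil_commute[of b a]
      by (simp add: bil_add_left bil_add_right bil_scale_left bil_scale_right algebra_simps)
    also have "\<dots> = of_real ?A + cnj ?c * ?z + ?c * cnj ?z + ?c * cnj ?c * of_real ?B"
      using assms by (simp only: bil_self_nrm)
    also have "\<dots> = of_real (?A - 2 * l * (cmod ?z)\<^sup>2 + l\<^sup>2 * (cmod ?z)\<^sup>2 * ?B)"
      by (rule cauchy_schwarz_expansion)
    finally show ?thesis
      using bil_self(1)[of "fadd a (fscale ?c b)"] assms by simp
  qed
  have "(cmod ?z)\<^sup>2 \<le> ?A * ?B"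
  proof (cases "?B = 0")
    case True
    have "cmod ?z = 0"
    proof (rule ccontr)
      assume "cmod ?z \<noteq> 0"
      thus False using key[of "(?A + 1) / (2 * (cmod ?z)\<^sup>2)"] True by (simp add: field_simps)
    qed
    thus ?thesis by simp
  next
    case False
    define B where "B = ?B"
    have B: "B > 0" using False unfolding B_def by (simp add: zero_less_power2)
    have "(1 / B)\<^sup>2 * (cmod ?z)\<^sup>2 * B = (cmod ?z)\<^sup>2 / B" using B by (simp add: power2_eq_square)
    hence "(cmod ?z)\<^sup>2 / B \<le> ?A" using key[of "1 / B", folded B_def] by simp
    thus ?thesis using B by (simp add: field_simps B_def)
  qed
  hence "(cmod ?z)\<^sup>2 \<le> (nrm a * nrm b)\<^sup>2" by (simp add: power_mult_distrib)
  thus ?thesis by (rule power2_le_imp_le) (use assms in auto)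
qed

lemma nrm_triangle:
  assumes "a \<in> V" "b \<in> V"
  shows "nrm (fadd a b) \<le> nrm a + nrm b"
proof -
  have "bil (fadd a b) (fadd a b) = bil a a + bil a b + bil b a + bil b b"
    using assms by (simp add: bil_add_left bil_add_right algebra_simps)
  hence "of_real ((nrm (fadd a b))\<^sup>2) = of_real ((nrm a)\<^sup>2) + bil a b + bil b a + of_real ((nrm b)\<^sup>2)"
    using assms by (simp only: bil_self_nrm V_closed)
  hence "(nrm (fadd a b))\<^sup>2 = (nrm a)\<^sup>2 + 2 * Re (bil a b) + (nrm b)\<^sup>2"
    using bil_commute[of b a] by (simp add: complex_eq_iff)
  also have "\<dots> \<le> (nrm a + nrm b)\<^sup>2"
    using cauchy_schwarz[OF assms] complex_Re_le_cmod[of "bil a b"] by (simp add: power2_sum)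
  finally show ?thesis by (rule power2_le_imp_le) (use assms in auto)
qed

lemma nrm_scale: "a \<in> V \<Longrightarrow> nrm (fscale c a) = cmod c * nrm a"
proof -
  assume a: "a \<in> V"
  have "of_real ((nrm (fscale c a))\<^sup>2) = (c * cnj c) * of_real ((nrm a)\<^sup>2)"
    using a bil_scale_left[of a "fscale c a" c] bil_scale_right[of a a c]
    by (simp only: bil_self_nrm V_closed mult.assoc)
  also have "\<dots> = of_real ((cmod c * nrm a)\<^sup>2)"
    by (simp only: complex_norm_square[symmetric] power_mult_distrib of_real_mult)
  finally have "(nrm (fscale c a))\<^sup>2 = (cmod c * nrm a)\<^sup>2" by (simp only: of_real_eq_iff)
  thus ?thesis by (rule power2_eq_imp_eq) (use a in auto)
qed

lemma bil_difference:
  assumes "a \<in> V" "b \<in> V" "a' \<in> V" "b' \<in> V"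
  shows "cmod (bil a b - bil a' b') \<le> nrm (fdiff a a') * nrm b + nrm a' * nrm (fdiff b b')"
proof -
  have "bil a b - bil a' b' = bil (fdiff a a') b + bil a' (fdiff b b')"
    using assms by (simp add: bil_add_left bil_add_right bil_scale_left bil_scale_right)
  moreover have "cmod (bil (fdiff a a') b) \<le> nrm (fdiff a a') * nrm b"
    "cmod (bil a' (fdiff b b')) \<le> nrm a' * nrm (fdiff b b')"
    by (rule cauchy_schwarz; use assms in simp)+
  ultimately show ?thesis
    using norm_triangle_ineq[of "bil (fdiff a a') b" "bil a' (fdiff b b')"] by simp
qed

definition kernel_cauchy :: "(nat \<Rightarrow> 'x \<Rightarrow> complex) \<Rightarrow> bool" where
  "kernel_cauchy s \<longleftrightarrow> (\<forall>n. s n \<in> V) \<and> (\<forall>e>0. \<exists>N. \<forall>m\<ge>N. \<forall>n\<ge>N. nrm (fdiff (s m) (s n)) < e)"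

text \<open>The completion of the finitely supported functions is realised by honest functions: its elements
  are the pointwise limits of the evaluations of Cauchy sequences.\<close>

definition represents :: "(nat \<Rightarrow> 'x \<Rightarrow> complex) \<Rightarrow> ('x \<Rightarrow> complex) \<Rightarrow> bool" where
  "represents s f \<longleftrightarrow> kernel_cauchy s \<and> (\<forall>x. (\<lambda>n. ev (s n) x) \<longlonglongrightarrow> f x)"

lemma representsD:
  assumes "represents s f"
  shows "s n \<in> V" "(\<lambda>n. ev (s n) x) \<longlonglongrightarrow> f x"
    "e > 0 \<Longrightarrow> \<exists>N. \<forall>m\<ge>N. \<forall>n\<ge>N. nrm (fdiff (s m) (s n)) < e" "kernel_cauchy s"
  using assms unfolding represents_def kernel_cauchy_def by blast+

lemma nrm_fzero [simp]: "nrm fzero = 0"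
  by (simp add: nrm_def bil_def fzero_def fsupp_def)

lemma fdiff_self [simp]: "fdiff a a = fzero"
  by (simp add: fadd_def fscale_def fzero_def)

lemma kernel_cauchy_bounded:
  assumes "kernel_cauchy s"
  obtains B where "B > 0" "\<And>n. nrm (s n) \<le> B"
proof -
  have V: "\<And>n. s n \<in> V" using assms by (simp add: kernel_cauchy_def)
  obtain N where N: "\<And>n. n \<ge> N \<Longrightarrow> nrm (fdiff (s n) (s N)) < 1"
    using assms unfolding kernel_cauchy_def by (metis less_numeral_extra(1) order_refl)
  define B where "B = Max ((\<lambda>n. nrm (s n)) ` {..N}) + 1"
  have le: "nrm (s n) \<le> B - 1" if "n \<le> N" for n
    unfolding B_def using that by simp
  have "nrm (s n) \<le> B" for n
  proof (cases "n \<le> N")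
    case False
    have "s n = fadd (fdiff (s n) (s N)) (s N)" by (simp add: fadd_def fscale_def)
    hence "nrm (s n) \<le> nrm (fdiff (s n) (s N)) + nrm (s N)" using nrm_triangle V by (metis V_closed(3,4))
    thus ?thesis using N[of n] False le[of N] by simp
  qed (use le in force)
  moreover have "B > 0" using le[of N] nrm_nonneg[OF V[of N]] by simp
  ultimately show ?thesis using that by blast
qed

text \<open>A Cauchy sequence that tends to zero weakly tends to zero in norm: compare its terms with
  a fixed late term.\<close>

lemma represents_zero_imp_null:
  assumes "represents s fzero"
  shows "(\<lambda>n. nrm (s n)) \<longlonglongrightarrow> 0"
proof (rule LIMSEQ_I)
  fix r :: real assume r: "r > 0"
  note s = representsD[OF assms]
  obtain B where B: "B > 0" "\<And>n. nrm (s n) \<le> B" using kernel_cauchy_bounded[OF s(4)] by blast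
  define e where "e = r\<^sup>2 / (2 * B)"
  have e: "e > 0" using r B by (simp add: e_def)
  obtain N where N: "\<And>m n. m \<ge> N \<Longrightarrow> n \<ge> N \<Longrightarrow> nrm (fdiff (s m) (s n)) < e" using s(3)[OF e] by blast
  have "bil a b = (\<Sum>y\<in>fsupp b. cnj (b y) * ev a y)" for a b
    unfolding ev_def bil_def by (subst sum.swap) (simp add: sum_distrib_left fsupp_def dirac_def mult.assoc mult.left_commute)
  hence "(\<lambda>n. bil (s n) (s N)) \<longlonglongrightarrow> (\<Sum>y\<in>fsupp (s N). cnj (s N y) * fzero y)"
    using s(2) by (auto intro!: tendsto_intros)
  hence "(\<lambda>n. bil (s n) (s N)) \<longlonglongrightarrow> 0" by (simp add: fzero_def)
  moreover have r2: "r\<^sup>2 / 2 > 0" using r by simp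
  ultimately obtain M where M: "\<And>n. n \<ge> M \<Longrightarrow> cmod (bil (s n) (s N)) < r\<^sup>2 / 2"
    using LIMSEQ_D by (metis diff_zero)
  have "norm (nrm (s n) - 0) < r" if n: "n \<ge> max M N" for n
  proof -
    have "bil (s n) (s n) = bil (s n) (s N) + bil (s n) (fdiff (s n) (s N))"
      using s(1) by (simp add: bil_add_right bil_scale_right)
    hence "of_real ((nrm (s n))\<^sup>2) = bil (s n) (s N) + bil (s n) (fdiff (s n) (s N))"
      by (simp only: bil_self_nrm[OF s(1)])
    hence "cmod (of_real ((nrm (s n))\<^sup>2)) \<le> cmod (bil (s n) (s N)) + cmod (bil (s n) (fdiff (s n) (s N)))"
      by (metis norm_triangle_ineq)
    hence "(nrm (s n))\<^sup>2 \<le> cmod (bil (s n) (s N)) + cmod (bil (s n) (fdiff (s n) (s N)))"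
      by (simp only: norm_of_real abs_power2)
    also have "\<dots> < r\<^sup>2 / 2 + r\<^sup>2 / 2"
    proof (rule add_less_le_mono)
      show "cmod (bil (s n) (s N)) < r\<^sup>2 / 2" using M n by simp
      have "cmod (bil (s n) (fdiff (s n) (s N))) \<le> nrm (s n) * nrm (fdiff (s n) (s N))"
        using s(1) by (intro cauchy_schwarz) auto
      also have "\<dots> \<le> B * e" using B(2)[of n] N[of n N] n s(1) B(1) by (intro mult_mono) auto
      finally show "cmod (bil (s n) (fdiff (s n) (s N))) \<le> r\<^sup>2 / 2" using B(1) by (simp add: e_def)
    qed
    finally have "(nrm (s n))\<^sup>2 < r\<^sup>2" by simp
    thus ?thesis using s(1)[of n] r by (simp add: power_less_imp_less_base)
  qed
  thus "\<exists>no. \<forall>n\<ge>no. norm (nrm (s n) - 0) < r" by blast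
qed

lemma ev_add: "a \<in> V \<Longrightarrow> b \<in> V \<Longrightarrow> ev (fadd a b) = fadd (ev a) (ev b)"
  by (simp add: fun_eq_iff ev_def bil_add_left) (simp add: fadd_def)

lemma ev_scale: "a \<in> V \<Longrightarrow> ev (fscale c a) = fscale c (ev a)"
  by (simp add: fun_eq_iff ev_def bil_scale_left) (simp add: fscale_def)

lemma represents_add:
  assumes s: "represents s f" and t: "represents t g"
  shows "represents (\<lambda>n. fadd (s n) (t n)) (fadd f g)"
  unfolding represents_def kernel_cauchy_def
proof (intro conjI allI impI)
  note s' = representsD[OF s] and t' = representsD[OF t]
  show "fadd (s n) (t n) \<in> V" for n using s' t' by simp
  show "(\<lambda>n. ev (fadd (s n) (t n)) x) \<longlonglongrightarrow> fadd f g x" for x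
    using tendsto_add[OF s'(2) t'(2)] s'(1) t'(1) by (simp add: ev_add) (simp add: fadd_def)
  fix e :: real assume "e > 0"
  then obtain N M where N: "\<And>m n. m \<ge> N \<Longrightarrow> n \<ge> N \<Longrightarrow> nrm (fdiff (s m) (s n)) < e / 2"
    and M: "\<And>m n. m \<ge> M \<Longrightarrow> n \<ge> M \<Longrightarrow> nrm (fdiff (t m) (t n)) < e / 2"
    using s'(3)[of "e/2"] t'(3)[of "e/2"] by (meson half_gt_zero)
  have "nrm (fdiff (fadd (s m) (t m)) (fadd (s n) (t n))) < e" if "m \<ge> max N M" "n \<ge> max N M" for m n
  proof -
    have "fdiff (fadd (s m) (t m)) (fadd (s n) (t n)) = fadd (fdiff (s m) (s n)) (fdiff (t m) (t n))"
      by (simp add: fadd_def fscale_def algebra_simps)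
    hence "nrm (fdiff (fadd (s m) (t m)) (fadd (s n) (t n))) \<le> nrm (fdiff (s m) (s n)) + nrm (fdiff (t m) (t n))"
      using nrm_triangle s'(1) t'(1) by simp
    thus ?thesis using N[of m n] M[of m n] that by simp
  qed
  thus "\<exists>N. \<forall>m\<ge>N. \<forall>n\<ge>N. nrm (fdiff (fadd (s m) (t m)) (fadd (s n) (t n))) < e" by blast
qed

lemma represents_scale:
  assumes s: "represents s f"
  shows "represents (\<lambda>n. fscale c (s n)) (fscale c f)"
  unfolding represents_def kernel_cauchy_def
proof (intro conjI allI impI)
  note s' = representsD[OF s]
  show "fscale c (s n) \<in> V" for n using s' by simp
  show "(\<lambda>n. ev (fscale c (s n)) x) \<longlonglongrightarrow> fscale c f x" for x
    using tendsto_mult_left[OF s'(2)] s'(1) by (simp add: ev_scale) (simp add: fscale_def)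
  fix e :: real assume e: "e > 0"
  have "e / (cmod c + 1) > 0" using e by (simp add: add_nonneg_pos)
  then obtain N where N: "\<And>m n. m \<ge> N \<Longrightarrow> n \<ge> N \<Longrightarrow> nrm (fdiff (s m) (s n)) < e / (cmod c + 1)"
    using s'(3) by meson
  have "nrm (fdiff (fscale c (s m)) (fscale c (s n))) < e" if "m \<ge> N" "n \<ge> N" for m n
  proof -
    have "fdiff (fscale c (s m)) (fscale c (s n)) = fscale c (fdiff (s m) (s n))"
      by (simp add: fadd_def fscale_def algebra_simps)
    hence "nrm (fdiff (fscale c (s m)) (fscale c (s n))) = cmod c * nrm (fdiff (s m) (s n))"
      using nrm_scale s'(1) by simp
    also have "\<dots> \<le> (cmod c + 1) * nrm (fdiff (s m) (s n))" using s'(1) by (intro mult_right_mono) auto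
    also have "\<dots> < e" using N[OF that] pos_less_divide_eq[of "cmod c + 1" _ e] by (simp add: add_nonneg_pos mult.commute)
    finally show ?thesis .
  qed
  thus "\<exists>N. \<forall>m\<ge>N. \<forall>n\<ge>N. nrm (fdiff (fscale c (s m)) (fscale c (s n))) < e" by blast
qed

lemma represents_const: "a \<in> V \<Longrightarrow> represents (\<lambda>n. a) (ev a)"
  by (auto simp: represents_def kernel_cauchy_def)

definition H :: "('x \<Rightarrow> complex) set" where
  "H = {f. \<exists>s. represents s f}"

definition rep :: "('x \<Rightarrow> complex) \<Rightarrow> nat \<Rightarrow> 'x \<Rightarrow> complex" where
  "rep f = (SOME s. represents s f)"

definition ip :: "('x \<Rightarrow> complex) \<Rightarrow> ('x \<Rightarrow> complex) \<Rightarrow> complex" where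
  "ip f g = lim (\<lambda>n. bil (rep f n) (rep g n))"

definition hn :: "('x \<Rightarrow> complex) \<Rightarrow> real" where
  "hn f = sqrt (Re (ip f f))"

lemma represents_rep: "f \<in> H \<Longrightarrow> represents (rep f) f"
  using someI_ex[of "\<lambda>s. represents s f"] unfolding H_def rep_def by simp

lemma represents_unique_limit:
  assumes "represents s f" "represents s' f"
  shows "(\<lambda>n. nrm (fdiff (s n) (s' n))) \<longlonglongrightarrow> 0"
  using represents_zero_imp_null represents_add[OF assms(1) represents_scale[OF assms(2), of "-1"]] by simp

lemma represents_bil_convergent:
  assumes s: "represents s f" and t: "represents t g"
  shows "convergent (\<lambda>n. bil (s n) (t n))"
proof -
  note s' = representsD[OF s] and t' = representsD[OF t]
  obtain B where B: "B > 0" "\<And>n. nrm (s n) \<le> B" using kernel_cauchy_bounded[OF s'(4)] by blast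
  obtain C where C: "C > 0" "\<And>n. nrm (t n) \<le> C" using kernel_cauchy_bounded[OF t'(4)] by blast
  have "Cauchy (\<lambda>n. bil (s n) (t n))"
  proof (rule CauchyI)
    fix e :: real assume e: "e > 0"
    obtain N where N: "\<And>m n. m \<ge> N \<Longrightarrow> n \<ge> N \<Longrightarrow> nrm (fdiff (s m) (s n)) < e / (2 * C)"
      using s'(3)[of "e / (2 * C)"] e C by auto
    obtain M where M: "\<And>m n. m \<ge> M \<Longrightarrow> n \<ge> M \<Longrightarrow> nrm (fdiff (t m) (t n)) < e / (2 * B)"
      using t'(3)[of "e / (2 * B)"] e B by auto
    have "norm (bil (s m) (t m) - bil (s n) (t n)) < e" if "m \<ge> max N M" "n \<ge> max N M" for m n
    proof -
      have "norm (bil (s m) (t m) - bil (s n) (t n))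
          \<le> nrm (fdiff (s m) (s n)) * nrm (t m) + nrm (s n) * nrm (fdiff (t m) (t n))"
        using s'(1) t'(1) by (intro bil_difference)
      also have "\<dots> \<le> nrm (fdiff (s m) (s n)) * C + B * nrm (fdiff (t m) (t n))"
        using s'(1) t'(1) B C by (intro add_mono mult_mono) auto
      also have "\<dots> < e / (2 * C) * C + B * (e / (2 * B))"
        using N[of m n] M[of m n] that B C by (intro add_strict_mono mult_strict_right_mono mult_strict_left_mono) auto
      also have "\<dots> = e" using B C by simp
      finally show ?thesis .
    qed
    thus "\<exists>M. \<forall>m\<ge>M. \<forall>n\<ge>M. norm (bil (s m) (t m) - bil (s n) (t n)) < e" by blast
  qed
  thus ?thesis by (rule Cauchy_convergent)
qed

lemma ip_limit:
  assumes s: "represents s f" and t: "represents t g"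
  shows "(\<lambda>n. bil (s n) (t n)) \<longlonglongrightarrow> ip f g"
proof -
  have f: "represents (rep f) f" and g: "represents (rep g) g" using s t represents_rep by (auto simp: H_def)
  note s' = representsD[OF s] and t' = representsD[OF t] and f' = representsD[OF f] and g' = representsD[OF g]
  have 1: "(\<lambda>n. bil (rep f n) (rep g n)) \<longlonglongrightarrow> ip f g"
    unfolding ip_def using represents_bil_convergent[OF f g] convergent_LIMSEQ_iff by blast
  obtain B where B: "B > 0" "\<And>n. nrm (rep f n) \<le> B" using kernel_cauchy_bounded[OF f'(4)] by blast
  obtain C where C: "C > 0" "\<And>n. nrm (t n) \<le> C" using kernel_cauchy_bounded[OF t'(4)] by blast
  have "(\<lambda>n. bil (s n) (t n) - bil (rep f n) (rep g n)) \<longlonglongrightarrow> 0"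
  proof (rule Lim_null_comparison)
    show "(\<lambda>n. nrm (fdiff (s n) (rep f n)) * C + B * nrm (fdiff (t n) (rep g n))) \<longlonglongrightarrow> 0"
      using tendsto_add[OF tendsto_mult_right[OF represents_unique_limit[OF s f], of C]
          tendsto_mult_left[OF represents_unique_limit[OF t g], of B]] by simp
    show "\<forall>\<^sub>F n in sequentially. norm (bil (s n) (t n) - bil (rep f n) (rep g n))
        \<le> nrm (fdiff (s n) (rep f n)) * C + B * nrm (fdiff (t n) (rep g n))"
    proof (rule always_eventually, rule allI)
      fix n
      have "norm (bil (s n) (t n) - bil (rep f n) (rep g n))
          \<le> nrm (fdiff (s n) (rep f n)) * nrm (t n) + nrm (rep f n) * nrm (fdiff (t n) (rep g n))"
        using s'(1) t'(1) f'(1) g'(1) by (intro bil_difference)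
      also have "\<dots> \<le> nrm (fdiff (s n) (rep f n)) * C + B * nrm (fdiff (t n) (rep g n))"
        using s'(1) t'(1) f'(1) g'(1) B C by (intro add_mono mult_mono) auto
      finally show "norm (bil (s n) (t n) - bil (rep f n) (rep g n)) \<le> \<dots>" .
    qed
  qed
  from tendsto_add[OF this 1] show ?thesis by simp
qed

lemma hn_limit:
  assumes s: "represents s f"
  shows "(\<lambda>n. nrm (s n)) \<longlonglongrightarrow> hn f"
  unfolding nrm_def hn_def by (intro tendsto_intros ip_limit s)

lemma H_closed [simp]:
  "fzero \<in> H" "f \<in> H \<Longrightarrow> g \<in> H \<Longrightarrow> fadd f g \<in> H" "f \<in> H \<Longrightarrow> fscale c f \<in> H" "a \<in> V \<Longrightarrow> ev a \<in> H"
proof -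
  have "ev fzero = fzero" by (simp add: ev_def bil_def fsupp_def fzero_def)
  thus "fzero \<in> H" using represents_const[of fzero] by (auto simp: H_def)
  show "f \<in> H \<Longrightarrow> g \<in> H \<Longrightarrow> fadd f g \<in> H" unfolding H_def using represents_add by blast
  show "f \<in> H \<Longrightarrow> fscale c f \<in> H" unfolding H_def using represents_scale by blast
  show "a \<in> V \<Longrightarrow> ev a \<in> H" unfolding H_def using represents_const by blast
qed

lemma ip_add_left: "f \<in> H \<Longrightarrow> g \<in> H \<Longrightarrow> h \<in> H \<Longrightarrow> ip (fadd f g) h = ip f h + ip g h"
proof -
  assume H: "f \<in> H" "g \<in> H" "h \<in> H"
  note f = represents_rep[OF H(1)] and g = represents_rep[OF H(2)] and h = represents_rep[OF H(3)]
  have "(\<lambda>n. bil (rep f n) (rep h n) + bil (rep g n) (rep h n)) \<longlonglongrightarrow> ip (fadd f g) h"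
    using ip_limit[OF represents_add[OF f g] h] representsD(1)[OF f] representsD(1)[OF g] representsD(1)[OF h]
    by (simp add: bil_add_left)
  moreover have "(\<lambda>n. bil (rep f n) (rep h n) + bil (rep g n) (rep h n)) \<longlonglongrightarrow> ip f h + ip g h"
    by (intro tendsto_add ip_limit f g h)
  ultimately show ?thesis using LIMSEQ_unique by blast
qed

lemma ip_scale_left: "f \<in> H \<Longrightarrow> h \<in> H \<Longrightarrow> ip (fscale c f) h = c * ip f h"
proof -
  assume H: "f \<in> H" "h \<in> H"
  note f = represents_rep[OF H(1)] and h = represents_rep[OF H(2)]
  have "(\<lambda>n. c * bil (rep f n) (rep h n)) \<longlonglongrightarrow> ip (fscale c f) h"
    using ip_limit[OF represents_scale[OF f, of c] h] representsD(1)[OF f] representsD(1)[OF h]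
    by (simp add: bil_scale_left)
  moreover have "(\<lambda>n. c * bil (rep f n) (rep h n)) \<longlonglongrightarrow> c * ip f h"
    by (intro tendsto_mult_left ip_limit f h)
  ultimately show ?thesis using LIMSEQ_unique by blast
qed

lemma ip_commute: "f \<in> H \<Longrightarrow> g \<in> H \<Longrightarrow> ip f g = cnj (ip g f)"
proof -
  assume H: "f \<in> H" "g \<in> H"
  note f = represents_rep[OF H(1)] and g = represents_rep[OF H(2)]
  have "(\<lambda>n. cnj (bil (rep g n) (rep f n))) \<longlonglongrightarrow> cnj (ip g f)"
    by (intro tendsto_cnj ip_limit f g)
  hence "(\<lambda>n. bil (rep f n) (rep g n)) \<longlonglongrightarrow> cnj (ip g f)" by (simp add: bil_commute[symmetric])
  thus ?thesis using ip_limit[OF f g] LIMSEQ_unique by blast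
qed

lemma ev_bound: "a \<in> V \<Longrightarrow> cmod (ev a x) \<le> nrm a * nrm (dirac x)"
  unfolding ev_def by (rule cauchy_schwarz) auto

lemma hn_zero_imp:
  assumes f: "f \<in> H" and 0: "hn f = 0"
  shows "f = fzero"
proof
  fix x
  note r = represents_rep[OF f]
  have "(\<lambda>n. nrm (rep f n) * nrm (dirac x)) \<longlonglongrightarrow> 0"
    using tendsto_mult_right[OF hn_limit[OF r], of "nrm (dirac x)"] 0 by simp
  hence "(\<lambda>n. ev (rep f n) x) \<longlonglongrightarrow> 0"
    by (rule Lim_null_comparison[rotated]) (use ev_bound representsD(1)[OF r] in auto)
  thus "f x = fzero x" using representsD(2)[OF r, of x] LIMSEQ_unique by (fastforce simp: fzero_def)
qed

lemma hn_nonneg: "f \<in> H \<Longrightarrow> hn f \<ge> 0" "f \<in> H \<Longrightarrow> Re (ip f f) \<ge> 0"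
proof -
  assume f: "f \<in> H"
  note r = represents_rep[OF f]
  show "hn f \<ge> 0" by (rule LIMSEQ_le_const[OF hn_limit[OF r]]) (use representsD(1)[OF r] in auto)
  thus "Re (ip f f) \<ge> 0" by (simp add: hn_def)
qed

lemma hn_triangle:
  assumes f: "f \<in> H" and g: "g \<in> H"
  shows "hn (fadd f g) \<le> hn f + hn g"
proof -
  note r = represents_rep[OF f] and t = represents_rep[OF g]
  show ?thesis
    by (rule LIMSEQ_le[OF hn_limit[OF represents_add[OF r t]] tendsto_add[OF hn_limit[OF r] hn_limit[OF t]]])
       (use nrm_triangle representsD(1)[OF r] representsD(1)[OF t] in auto)
qed

lemma hn_ev: "a \<in> V \<Longrightarrow> hn (ev a) = nrm a"
  using LIMSEQ_unique[OF hn_limit[OF represents_const[of a]] tendsto_const] by simp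

lemma hn_diff_swap: "f \<in> H \<Longrightarrow> g \<in> H \<Longrightarrow> hn (fdiff f g) = hn (fdiff g f)"
proof -
  assume H: "f \<in> H" "g \<in> H"
  have "fdiff f g = fscale (- 1) (fdiff g f)" by (simp add: fadd_def fscale_def)
  moreover have "ip (fscale (- 1) k) (fscale (- 1) k) = ip k k" if "k \<in> H" for k
    using that ip_commute[of k "fscale (-1) k"] ip_commute[of k k] by (simp add: ip_scale_left)
  ultimately show ?thesis using H by (simp add: hn_def)
qed

lemma hn_diff_triangle:
  assumes "f \<in> H" "g \<in> H" "h \<in> H"
  shows "hn (fdiff f h) \<le> hn (fdiff f g) + hn (fdiff g h)"
proof -
  have "fdiff f h = fadd (fdiff f g) (fdiff g h)" by (simp add: fadd_def fscale_def)
  thus ?thesis using hn_triangle[of "fdiff f g" "fdiff g h"] assms by simp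
qed

lemma ev_approximation:
  assumes s: "represents s f"
  shows "(\<lambda>n. hn (fdiff (ev (s n)) f)) \<longlonglongrightarrow> 0"
proof (rule LIMSEQ_I)
  fix r :: real assume r: "r > 0"
  note s' = representsD[OF s]
  obtain N where N: "\<And>m n. m \<ge> N \<Longrightarrow> n \<ge> N \<Longrightarrow> nrm (fdiff (s m) (s n)) < r / 2"
    using s'(3)[of "r / 2"] r by auto
  have "norm (hn (fdiff (ev (s n)) f) - 0) < r" if n: "n \<ge> N" for n
  proof -
    have rr: "represents (\<lambda>k. fdiff (s n) (s k)) (fdiff (ev (s n)) f)"
      by (intro represents_add represents_scale represents_const s s')
    have "hn (fdiff (ev (s n)) f) \<le> r / 2"
      by (rule LIMSEQ_le_const2[OF hn_limit[OF rr]]) (use N[OF n] in \<open>auto intro!: exI[of _ N] less_imp_le\<close>)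
    moreover have "fdiff (ev (s n)) f \<in> H" using rr by (auto simp: H_def)
    ultimately show ?thesis using hn_nonneg(1)[of "fdiff (ev (s n)) f"] r by simp
  qed
  thus "\<exists>no. \<forall>n\<ge>no. norm (hn (fdiff (ev (s n)) f) - 0) < r" by blast
qed

lemma ev_dense:
  assumes "f \<in> H" "e > 0"
  shows "\<exists>a\<in>V. hn (fdiff (ev a) f) < e"
proof -
  note r = represents_rep[OF assms(1)]
  obtain n where "norm (hn (fdiff (ev (rep f n)) f) - 0) < e"
    using LIMSEQ_D[OF ev_approximation[OF r] assms(2)] by blast
  thus ?thesis using representsD(1)[OF r] by (intro bexI[of _ "rep f n"]) auto
qed

text \<open>Finitely supported functions close to the members of a Cauchy sequence form a Cauchy sequence
  themselves, and the function that they represent is the limit.\<close>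

lemma H_complete:
  assumes F: "\<And>n. F n \<in> H" and C: "\<And>e. e > 0 \<Longrightarrow> \<exists>N. \<forall>m\<ge>N. \<forall>n\<ge>N. hn (fdiff (F m) (F n)) < e"
  shows "\<exists>f\<in>H. (\<lambda>n. hn (fdiff (F n) f)) \<longlonglongrightarrow> 0"
proof -
  have "\<exists>a\<in>V. hn (fdiff (ev a) (F n)) < inverse (real (Suc n))" for n
    by (rule ev_dense[OF F]) simp
  then obtain a where a: "\<And>n. a n \<in> V" "\<And>n. hn (fdiff (ev (a n)) (F n)) < inverse (real (Suc n))" by metis
  have aF: "nrm (fdiff (a m) (a n)) \<le> inverse (real (Suc m)) + hn (fdiff (F m) (F n)) + inverse (real (Suc n))" for m n
  proof -
    have "nrm (fdiff (a m) (a n)) = hn (fdiff (ev (a m)) (ev (a n)))"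
      using a(1) hn_ev[of "fdiff (a m) (a n)"] by (simp add: ev_add ev_scale)
    also have "\<dots> \<le> hn (fdiff (ev (a m)) (F m)) + (hn (fdiff (F m) (F n)) + hn (fdiff (F n) (ev (a n))))"
      using hn_diff_triangle[of "ev (a m)" "F m" "ev (a n)"] hn_diff_triangle[of "F m" "F n" "ev (a n)"] a(1) F
      by fastforce
    finally show ?thesis using a(2)[of m] a(2)[of n] hn_diff_swap[of "F n" "ev (a n)"] a(1) F by fastforce
  qed
  have inv: "\<exists>N. \<forall>n\<ge>N. inverse (real (Suc n)) < e" if "e > 0" for e
    using LIMSEQ_D[OF LIMSEQ_inverse_real_of_nat that] by auto
  have cau: "kernel_cauchy a"
    unfolding kernel_cauchy_def
  proof (intro conjI allI impI a(1))
    fix e :: real assume "e > 0"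
    hence e3: "e / 3 > 0" by simp
    obtain N where N: "\<And>n. n \<ge> N \<Longrightarrow> inverse (real (Suc n)) < e / 3" using inv[OF e3] by blast
    obtain M where M: "\<And>m n. m \<ge> M \<Longrightarrow> n \<ge> M \<Longrightarrow> hn (fdiff (F m) (F n)) < e / 3" using C[OF e3] by blast
    have "nrm (fdiff (a m) (a n)) < e" if "m \<ge> max N M" "n \<ge> max N M" for m n
      using aF[of m n] N[of m] N[of n] M[of m n] that by simp
    thus "\<exists>N. \<forall>m\<ge>N. \<forall>n\<ge>N. nrm (fdiff (a m) (a n)) < e" by blast
  qed
  have "convergent (\<lambda>n. ev (a n) x)" for x
  proof (rule Cauchy_convergent, rule CauchyI)
    fix e :: real assume e: "e > 0"
    let ?c = "nrm (dirac x) + 1"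
    have c: "?c > 0" by (simp add: add_nonneg_pos)
    obtain N where N: "\<And>m n. m \<ge> N \<Longrightarrow> n \<ge> N \<Longrightarrow> nrm (fdiff (a m) (a n)) < e / ?c"
      using cau e c unfolding kernel_cauchy_def by (metis zero_less_divide_iff)
    have "norm (ev (a m) x - ev (a n) x) < e" if "m \<ge> N" "n \<ge> N" for m n
    proof -
      have "ev (a m) x - ev (a n) x = ev (fdiff (a m) (a n)) x"
        using a(1) by (simp add: ev_add ev_scale) (simp add: fadd_def fscale_def)
      hence "norm (ev (a m) x - ev (a n) x) = cmod (ev (fdiff (a m) (a n)) x)" by (rule arg_cong)
      also have "\<dots> \<le> nrm (fdiff (a m) (a n)) * nrm (dirac x)" using a(1) by (intro ev_bound) simp
      also have "\<dots> \<le> nrm (fdiff (a m) (a n)) * ?c" using a(1) by (intro mult_left_mono) auto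
      also have "\<dots> < e" using N[OF that] c by (simp add: field_simps)
      finally show ?thesis .
    qed
    thus "\<exists>M. \<forall>m\<ge>M. \<forall>n\<ge>M. norm (ev (a m) x - ev (a n) x) < e" by blast
  qed
  then obtain f where f: "\<And>x. (\<lambda>n. ev (a n) x) \<longlonglongrightarrow> f x" unfolding convergent_def by metis
  have r: "represents a f" using cau f by (simp add: represents_def)
  hence fH: "f \<in> H" by (auto simp: H_def)
  have "(\<lambda>n. hn (fdiff (F n) f)) \<longlonglongrightarrow> 0"
  proof (rule Lim_null_comparison)
    show "(\<lambda>n. inverse (real (Suc n)) + hn (fdiff (ev (a n)) f)) \<longlonglongrightarrow> 0"
      using tendsto_add[OF LIMSEQ_inverse_real_of_nat ev_approximation[OF r]] by simp
    have "norm (hn (fdiff (F n) f)) \<le> inverse (real (Suc n)) + hn (fdiff (ev (a n)) f)" for n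
      using hn_diff_triangle[of "F n" "ev (a n)" f] hn_diff_swap[of "F n" "ev (a n)"] a(1)[of n] a(2)[of n] F[of n] fH
        hn_nonneg(1)[of "fdiff (F n) f"] by simp
    thus "\<forall>\<^sub>F n in sequentially. norm (hn (fdiff (F n) f)) \<le> inverse (real (Suc n)) + hn (fdiff (ev (a n)) f)"
      by simp
  qed
  thus ?thesis using fH by blast
qed

lemma hilbert: "complex_hilbert_space H fzero fadd fscale ip"
proof
  show "\<And>x. x \<in> H \<Longrightarrow> x \<noteq> fzero \<Longrightarrow> 0 < Re (ip x x)"
    using hn_zero_imp hn_nonneg unfolding hn_def by (metis less_eq_real_def real_sqrt_zero)
  show "\<exists>x\<in>H. (\<lambda>n. sqrt (Re (ip (fdiff (s n) x) (fdiff (s n) x)))) \<longlonglongrightarrow> 0"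
    if "\<And>n. s n \<in> H" "\<And>e. e > 0 \<Longrightarrow> \<exists>N. \<forall>m\<ge>N. \<forall>n\<ge>N. sqrt (Re (ip (fdiff (s m) (s n)) (fdiff (s m) (s n)))) < e" for s
    using H_complete[of s] that unfolding hn_def by blast
qed (auto simp: ip_add_left ip_scale_left intro: ip_commute, auto simp: fadd_def fscale_def fzero_def algebra_simps)

end


section \<open>The translation representation and Property (T)\<close>

definition translate :: "'g::group_add \<Rightarrow> ('g \<Rightarrow> complex) \<Rightarrow> 'g \<Rightarrow> complex" where
  "translate k f = (\<lambda>x. f (- k + x))"

lemma translate_zero [simp]: "translate 0 f = f"
  by (simp add: translate_def)

lemma translate_plus: "translate (g + h) f = translate g (translate h f)"
  unfolding translate_def minus_add by (simp only: add.assoc)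

lemma translate_linear:
  "translate k (fadd f g) = fadd (translate k f) (translate k g)"
  "translate k (fscale c f) = fscale c (translate k f)"
  by (simp_all add: translate_def fadd_def fscale_def)

lemma translate_dirac: "translate k (dirac x) = dirac (k + x)"
proof -
  have "- k + y = x \<longleftrightarrow> y = k + x" for y by (metis add.assoc add.left_neutral add.right_inverse left_minus)
  thus ?thesis by (simp add: translate_def dirac_def)
qed

lemma fsupp_translate: "fsupp (translate k a) = (+) k ` fsupp (a :: 'g::group_add \<Rightarrow> complex)"
proof -
  have "y \<in> (+) k ` fsupp a" if "a (- k + y) \<noteq> 0" for y
    by (rule image_eqI[of _ _ "- k + y"]) (use that in \<open>auto simp: fsupp_def add.assoc[symmetric]\<close>)
  thus ?thesis by (auto simp: fsupp_def translate_def add.assoc[symmetric])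
qed

locale invariant_kernel = positive_kernel K for K :: "'g::{topological_group_add, t2_space} \<Rightarrow> 'g \<Rightarrow> real" +
  assumes K_translate: "K (k + x) (k + y) = K x y"
    and K_continuous: "continuous_on UNIV (K 0)"
begin

lemma translate_V [simp]: "a \<in> V \<Longrightarrow> translate k a \<in> V"
  by (simp add: V_def fsupp_translate)

lemma bil_translate2:
  "bil (translate h a) (translate k b) = (\<Sum>x\<in>fsupp a. \<Sum>y\<in>fsupp b. a x * cnj (b y) * of_real (K (h + x) (k + y)))"
proof -
  have inj: "inj_on ((+) k) A" for k :: 'g and A by (simp add: inj_on_def)
  show ?thesis
    unfolding bil_def fsupp_translate sum.reindex[OF inj]
    by (simp add: translate_def add.assoc[symmetric])
qed

lemma bil_translate: "bil (translate k a) (translate k b) = bil a b"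
  by (simp only: bil_translate2 K_translate) (simp only: bil_def)

lemma nrm_translate: "nrm (translate k a) = nrm a"
  by (simp add: nrm_def bil_translate)

lemma ev_translate: "ev (translate k a) = translate k (ev a)"
proof
  fix x
  have "ev (translate k a) x = bil (translate k a) (translate k (dirac (- k + x)))"
    by (simp add: ev_def translate_dirac add.assoc[symmetric])
  thus "ev (translate k a) x = translate k (ev a) x" by (simp add: bil_translate) (simp add: translate_def ev_def)
qed

lemma represents_translate:
  assumes s: "represents s f"
  shows "represents (\<lambda>n. translate k (s n)) (translate k f)"
  unfolding represents_def kernel_cauchy_def
proof (intro conjI allI impI)
  note s' = representsD[OF s]
  show "translate k (s n) \<in> V" for n using s' by simp
  show "(\<lambda>n. ev (translate k (s n)) x) \<longlonglongrightarrow> translate k f x" for x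
    using s'(2)[of "- k + x"] by (simp add: ev_translate) (simp add: translate_def)
  show "\<exists>N. \<forall>m\<ge>N. \<forall>n\<ge>N. nrm (fdiff (translate k (s m)) (translate k (s n))) < e" if "e > 0" for e
    using s'(3)[OF that] nrm_translate[of k] by (simp add: translate_linear[symmetric])
qed

lemma translate_H [simp]: "f \<in> H \<Longrightarrow> translate k f \<in> H"
  unfolding H_def using represents_translate by blast

lemma ip_translate: "f \<in> H \<Longrightarrow> g \<in> H \<Longrightarrow> ip (translate k f) (translate k g) = ip f g"
proof -
  assume H: "f \<in> H" "g \<in> H"
  note f = represents_rep[OF H(1)] and g = represents_rep[OF H(2)]
  have "(\<lambda>n. bil (rep f n) (rep g n)) \<longlonglongrightarrow> ip (translate k f) (translate k g)"
    using ip_limit[OF represents_translate[OF f, of k] represents_translate[OF g, of k]] by (simp add: bil_translate)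
  thus ?thesis using ip_limit[OF f g] LIMSEQ_unique by blast
qed

lemma hn_translate: "f \<in> H \<Longrightarrow> hn (translate k f) = hn f"
  by (simp add: hn_def ip_translate)

lemma K_tendsto: "((\<lambda>h. K (h + x) (g + y)) \<longlongrightarrow> K (g + x) (g + y)) (at g)"
proof -
  have eq: "K (h + x) (g + y) = K 0 (- (h + x) + (g + y))" for h
    using K_translate[of "h + x" 0 "- (h + x) + (g + y)"] by (simp add: add.assoc[symmetric])
  have "((\<lambda>h. - (h + x) + (g + y)) \<longlongrightarrow> - (g + x) + (g + y)) (at g)" by (intro tendsto_intros)
  moreover have "isCont (K 0) (- (g + x) + (g + y))" using K_continuous by (simp add: continuous_on_eq_continuous_at)
  ultimately show ?thesis unfolding eq by (rule isCont_tendsto_compose[rotated])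
qed

lemma nrm_translate_diff:
  assumes "a \<in> V"
  shows "(nrm (fdiff (translate h a) (translate g a)))\<^sup>2 = 2 * (nrm a)\<^sup>2 - 2 * Re (bil (translate h a) (translate g a))"
proof -
  let ?h = "translate h a" and ?g = "translate g a"
  have "bil (fdiff ?h ?g) (fdiff ?h ?g) = bil ?h ?h - bil ?h ?g - bil ?g ?h + bil ?g ?g"
    using assms by (simp add: bil_add_left bil_add_right bil_scale_left bil_scale_right)
  hence "Re (bil (fdiff ?h ?g) (fdiff ?h ?g)) = 2 * Re (bil a a) - 2 * Re (bil ?h ?g)"
    using bil_commute[of ?g ?h] by (simp add: bil_translate)
  thus ?thesis using assms by (simp add: bil_self_nrm)
qed

lemma nrm_translate_tendsto:
  assumes a: "a \<in> V"
  shows "((\<lambda>h. nrm (fdiff (translate h a) (translate g a))) \<longlongrightarrow> 0) (at g)"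
proof -
  have "((\<lambda>h. bil (translate h a) (translate g a)) \<longlongrightarrow> bil (translate g a) (translate g a)) (at g)"
    unfolding bil_translate2 by (intro tendsto_intros K_tendsto)
  hence "((\<lambda>h. 2 * (nrm a)\<^sup>2 - 2 * Re (bil (translate h a) (translate g a))) \<longlongrightarrow> 2 * (nrm a)\<^sup>2 - 2 * Re (bil a a)) (at g)"
    unfolding bil_translate by (intro tendsto_intros)
  hence "((\<lambda>h. (nrm (fdiff (translate h a) (translate g a)))\<^sup>2) \<longlongrightarrow> 0) (at g)"
    using a by (simp add: nrm_translate_diff bil_self_nrm)
  hence "((\<lambda>h. sqrt ((nrm (fdiff (translate h a) (translate g a)))\<^sup>2)) \<longlongrightarrow> sqrt 0) (at g)"
    by (rule tendsto_real_sqrt)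
  thus ?thesis using a by simp
qed

text \<open>For finitely supported functions this is continuity of the kernel; the others are approximated,
  uniformly in the translation.\<close>

lemma hn_translate_tendsto:
  assumes f: "f \<in> H"
  shows "((\<lambda>h. hn (fdiff (translate h f) (translate g f))) \<longlongrightarrow> 0) (at g)"
proof (rule tendstoI)
  fix e :: real assume e: "e > 0"
  obtain a where a: "a \<in> V" "hn (fdiff (ev a) f) < e / 3" using ev_dense[OF f, of "e/3"] e by auto
  have "\<forall>\<^sub>F h in at g. nrm (fdiff (translate h a) (translate g a)) < e / 3"
    using order_tendstoD(2)[OF nrm_translate_tendsto[OF a(1)], of "e/3"] e by simp
  thus "\<forall>\<^sub>F h in at g. dist (hn (fdiff (translate h f) (translate g f))) 0 < e"
  proof eventually_elim
    case (elim h)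
    have t: "hn (fdiff (translate k (ev a)) (translate k f)) < e / 3" for k
      using hn_translate[of "fdiff (ev a) f" k] a f by (simp add: translate_linear)
    have "hn (fdiff (translate h (ev a)) (translate g (ev a))) < e / 3"
      using hn_ev[of "fdiff (translate h a) (translate g a)"] elim a(1) by (simp add: ev_add ev_scale ev_translate)
    moreover have "hn (fdiff (translate h f) (translate g f))
        \<le> hn (fdiff (translate h f) (translate h (ev a))) + (hn (fdiff (translate h (ev a)) (translate g (ev a)))
          + hn (fdiff (translate g (ev a)) (translate g f)))"
      using hn_diff_triangle[of "translate h f" "translate h (ev a)" "translate g f"]
        hn_diff_triangle[of "translate h (ev a)" "translate g (ev a)" "translate g f"] a(1) f by simp
    ultimately have "hn (fdiff (translate h f) (translate g f)) < e"
      using t[of h] t[of g] hn_diff_swap[of "translate h f" "translate h (ev a)"] a(1) f by simp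
    thus ?case using hn_nonneg(1)[of "fdiff (translate h f) (translate g f)"] f by simp
  qed
qed

lemma hnorm_eq:
  fixes x y :: "'g \<Rightarrow> complex"
  shows "complex_hilbert_space.hnorm ip = hn" "complex_hilbert_space.hdiff fadd fscale x y = fdiff x y"
proof -
  interpret complex_hilbert_space H fzero fadd fscale ip by (rule hilbert)
  show "hnorm = hn" by (simp add: fun_eq_iff hnorm_def hn_def)
  show "hdiff x y = fdiff x y" by (rule hdiff_def)
qed

lemma unitary: "unitary_representation H fzero fadd fscale ip translate"
proof -
  interpret complex_hilbert_space H fzero fadd fscale ip by (rule hilbert)
  show ?thesis
    by unfold_locales (simp_all add: translate_linear ip_translate translate_plus hnorm_eq hn_translate_tendsto)
qed

text \<open>The evaluation of the unit mass at zero is almost invariant because the kernel is close to one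
  on \<open>Q\<close>.  An invariant vector is a translation invariant function, that is, a constant.\<close>

theorem property_T_invariant_function:
  assumes T: "\<And>(H :: ('g \<Rightarrow> complex) set) zero add scale ip (\<pi> :: 'g \<Rightarrow> _).
           unitary_representation H zero add scale ip \<pi> \<Longrightarrow>
           (\<exists>v. unitary_representation.almost_invariant H zero add scale ip \<pi> Q \<epsilon> v) \<Longrightarrow>
           unitary_representation.has_invariant_vector H zero \<pi>"
    and \<epsilon>: "\<epsilon> > 0" and K0: "K 0 0 = 1" and Q: "\<And>g. g \<in> Q \<Longrightarrow> 2 - 2 * K 0 g < \<epsilon>\<^sup>2"
  obtains v s where "v \<noteq> 0" "represents s (\<lambda>_. v)" "\<And>k. (\<lambda>n. nrm (fdiff (translate k (s n)) (s n))) \<longlonglongrightarrow> 0"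
proof -
  interpret unitary_representation H fzero fadd fscale ip translate by (rule unitary)
  let ?d = "dirac 0"
  have dd: "bil (dirac x) (dirac y) = of_real (K x y)" for x y
    by (simp add: bil_def fsupp_def dirac_def)
  have n1: "nrm ?d = 1" using K0 by (simp add: nrm_def dd)
  have "hn (fdiff (translate g (ev ?d)) (ev ?d)) < \<epsilon> * hn (ev ?d)" if g: "g \<in> Q" for g
  proof -
    have "hn (fdiff (translate g (ev ?d)) (ev ?d)) = nrm (fdiff (translate g ?d) (translate 0 ?d))"
      using hn_ev[of "fdiff (translate g ?d) ?d"] by (simp add: ev_add ev_scale ev_translate)
    moreover have "(nrm (fdiff (translate g ?d) (translate 0 ?d)))\<^sup>2 < \<epsilon>\<^sup>2"
      using nrm_translate_diff[of ?d g 0] n1 Q[OF g] dd[of g 0] K_sym[of g 0] by (simp add: translate_dirac)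
    ultimately show ?thesis using \<epsilon> n1 by (simp add: hn_ev power_less_imp_less_base)
  qed
  moreover have "ev ?d \<noteq> fzero"
  proof
    assume "ev ?d = fzero"
    hence "ev ?d 0 = 0" by (simp add: fzero_def)
    thus False using dd[of 0 0] K0 by (simp add: ev_def)
  qed
  ultimately have "almost_invariant Q \<epsilon> (ev ?d)" by (simp add: almost_invariant_def hnorm_eq)
  hence "has_invariant_vector" using T[OF unitary] by blast
  then obtain f where f: "f \<in> H" "f \<noteq> fzero" "\<And>g. translate g f = f" by (auto simp: has_invariant_vector_def)
  have f0: "f x = f 0" for x
    using fun_cong[OF f(3)[of "x"], of x] by (simp add: translate_def)
  hence fc: "f = (\<lambda>_. f 0)" by blast
  have "f 0 \<noteq> 0" using f(2) f0 by (auto simp: fzero_def fun_eq_iff)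
  note r = represents_rep[OF f(1)]
  have inv: "(\<lambda>n. nrm (fdiff (translate k (rep f n)) (rep f n))) \<longlonglongrightarrow> 0" for k
    using represents_unique_limit[OF _ r] represents_translate[OF r, of k] unfolding f(3) by blast
  have "represents (rep f) (\<lambda>_. f 0)" by (subst fc[symmetric]) (rule r)
  from that[OF \<open>f 0 \<noteq> 0\<close> this inv] show ?thesis .
qed

end


section \<open>Covering numbers in a topological group\<close>

definition rtrans :: "'g::plus set \<Rightarrow> 'g \<Rightarrow> 'g set" where
  "rtrans U g = (\<lambda>u. u + g) ` U"

definition covers :: "'g::plus set \<Rightarrow> 'g set \<Rightarrow> 'g set \<Rightarrow> bool" where
  "covers T U K \<longleftrightarrow> finite T \<and> K \<subseteq> (\<Union>g\<in>T. rtrans U g)"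

definition cover_num :: "'g::plus set \<Rightarrow> 'g set \<Rightarrow> nat" where
  "cover_num K U = (LEAST n. \<exists>T. covers T U K \<and> card T = n)"

lemma covers_iff: "covers T U K \<longleftrightarrow> finite T \<and> (\<forall>x\<in>K. \<exists>g\<in>T. x \<in> rtrans U g)"
  unfolding covers_def by blast

lemma in_rtrans_iff: "x \<in> rtrans U g \<longleftrightarrow> x - g \<in> U" for x g :: "'g::group_add"
  by (auto simp: rtrans_def image_iff) (metis diff_add_cancel)

lemma rtrans_plus: "rtrans (rtrans U g) h = rtrans U (g + h)" for g h :: "'g::group_add"
  by (simp add: rtrans_def image_image add.assoc)

lemma rtrans_zero [simp]: "rtrans U 0 = (U :: 'g::group_add set)"
  by (simp add: rtrans_def)

lemma rtrans_vimage: "rtrans U g = (\<lambda>x. x - g) -` U" for g :: "'g::group_add"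
  by (auto simp: in_rtrans_iff)

lemma open_rtrans: "open U \<Longrightarrow> open (rtrans U g)" for g :: "'g::topological_group_add"
  unfolding rtrans_vimage by (intro open_vimage continuous_intros)

lemma compact_rtrans: "compact K \<Longrightarrow> compact (rtrans K g)" for g :: "'g::topological_group_add"
  unfolding rtrans_def by (intro compact_continuous_image continuous_intros)

lemma covers_exists:
  fixes U :: "'g::topological_group_add set"
  assumes "compact K" "open U" "0 \<in> U"
  shows "\<exists>T. covers T U K"
proof -
  have "\<And>g. g \<in> K \<Longrightarrow> open (rtrans U g)" "K \<subseteq> (\<Union>g\<in>K. rtrans U g)"
    using assms by (auto simp: in_rtrans_iff intro: open_rtrans)
  then obtain T where "T \<subseteq> K" "finite T" "K \<subseteq> (\<Union>g\<in>T. rtrans U g)" using compactE_image[OF assms(1)] by metis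
  thus ?thesis by (auto simp: covers_def)
qed

lemma cover_num_attained:
  fixes U :: "'g::topological_group_add set"
  assumes "compact K" "open U" "0 \<in> U"
  obtains T where "covers T U K" "card T = cover_num K U"
  using LeastI_ex[of "\<lambda>n. \<exists>T. covers T U K \<and> card T = n"] covers_exists[OF assms] unfolding cover_num_def by blast

lemma cover_num_le: "covers T U K \<Longrightarrow> cover_num K U \<le> card T"
  unfolding cover_num_def by (rule Least_le) blast

context
  fixes U :: "'g::topological_group_add set"
  assumes U: "open U" "0 \<in> U"
begin

lemma cover_num_mono:
  assumes "compact L" "K \<subseteq> L"
  shows "cover_num K U \<le> cover_num L U"
proof -
  obtain T where "covers T U L" "card T = cover_num L U" using cover_num_attained[OF assms(1) U] by blast
  thus ?thesis using cover_num_le[of T U K] assms by (auto simp: covers_def)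
qed

lemma cover_num_Un:
  assumes "compact K" "compact L"
  shows "cover_num (K \<union> L) U \<le> cover_num K U + cover_num L U"
proof -
  obtain S where S: "covers S U K" "card S = cover_num K U" using cover_num_attained[OF assms(1) U] by blast
  obtain T where T: "covers T U L" "card T = cover_num L U" using cover_num_attained[OF assms(2) U] by blast
  have "covers (S \<union> T) U (K \<union> L)" using S T by (auto simp: covers_def)
  thus ?thesis using cover_num_le[of "S \<union> T" U "K \<union> L"] card_Un_le[of S T] S(2) T(2) by linarith
qed

text \<open>A cover of the union splits into a cover of either set if no translate meets both.\<close>

lemma cover_num_disjoint_Un:
  assumes "compact K" "compact L" and sep: "\<And>g. rtrans U g \<inter> K = {} \<or> rtrans U g \<inter> L = {}"
  shows "cover_num K U + cover_num L U \<le> cover_num (K \<union> L) U"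
proof -
  obtain T where T: "covers T U (K \<union> L)" "card T = cover_num (K \<union> L) U"
    using cover_num_attained[OF compact_Un[OF assms(1,2)] U] by blast
  let ?A = "{g\<in>T. rtrans U g \<inter> K \<noteq> {}}" and ?B = "{g\<in>T. rtrans U g \<inter> L \<noteq> {}}"
  have fin: "finite T" using T by (simp add: covers_def)
  have "covers ?A U K" using T unfolding covers_iff by (intro conjI) (simp, blast)
  moreover have "covers ?B U L" using T unfolding covers_iff by (intro conjI) (simp, blast)
  ultimately have "cover_num K U + cover_num L U \<le> card ?A + card ?B" by (intro add_mono cover_num_le)
  also have "\<dots> = card (?A \<union> ?B)" using fin sep by (intro card_Un_disjoint[symmetric]) auto
  also have "\<dots> \<le> card T" using fin by (intro card_mono) auto
  finally show ?thesis using T by simp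
qed

lemma cover_num_rtrans_le:
  assumes "compact K"
  shows "cover_num (rtrans K h) U \<le> cover_num K U"
proof -
  obtain T where T: "covers T U K" "card T = cover_num K U" using cover_num_attained[OF assms U] by blast
  have "rtrans K h \<subseteq> (\<Union>g\<in>T. rtrans (rtrans U g) h)" using T unfolding covers_def rtrans_def by blast
  hence "covers ((\<lambda>g. g + h) ` T) U (rtrans K h)" using T by (auto simp: covers_def rtrans_plus)
  hence "cover_num (rtrans K h) U \<le> card ((\<lambda>g. g + h) ` T)" by (rule cover_num_le)
  thus ?thesis using card_image_le[of T "\<lambda>g. g + h"] T by (auto simp: covers_def)
qed

lemma cover_num_rtrans:
  assumes "compact K"
  shows "cover_num (rtrans K h) U = cover_num K U"
  using cover_num_rtrans_le[OF assms, of h] cover_num_rtrans_le[OF compact_rtrans[OF assms, of h], of "- h"]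
  by (simp add: rtrans_plus)

lemma cover_num_pos:
  assumes "compact K" "K \<noteq> {}"
  shows "cover_num K U \<ge> 1"
proof -
  obtain T where T: "covers T U K" "card T = cover_num K U" using cover_num_attained[OF assms(1) U] by blast
  hence "T \<noteq> {}" "finite T" using assms by (auto simp: covers_def)
  thus ?thesis using T by (metis One_nat_def Suc_leI card_gt_0_iff)
qed

lemma cover_num_trans:
  assumes "compact K" "compact L" "open W" "0 \<in> W" "W \<subseteq> L"
  shows "cover_num K U \<le> cover_num K W * cover_num L U"
proof -
  obtain S where S: "covers S W K" "card S = cover_num K W" using cover_num_attained[OF assms(1,3,4)] by blast
  obtain T where T: "covers T U L" "card T = cover_num L U" using cover_num_attained[OF assms(2) U] by blast
  have "K \<subseteq> (\<Union>p\<in>S \<times> T. rtrans U (snd p + fst p))"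
  proof
    fix x assume "x \<in> K"
    then obtain g where g: "g \<in> S" "x - g \<in> L" using S assms(5) unfolding covers_iff in_rtrans_iff by blast
    then obtain h where "h \<in> T" "x - g - h \<in> U" using T unfolding covers_iff in_rtrans_iff by blast
    moreover have "x - g - h = x - (h + g)" by (simp add: diff_conv_add_uminus minus_add add.assoc del: add_uminus_conv_diff)
    ultimately show "x \<in> (\<Union>p\<in>S \<times> T. rtrans U (snd p + fst p))" using g by (auto simp: in_rtrans_iff intro!: bexI[of _ "(g, h)"])
  qed
  hence "covers ((\<lambda>p. snd p + fst p) ` (S \<times> T)) U K" using S T by (auto simp: covers_def)
  hence "cover_num K U \<le> card ((\<lambda>p. snd p + fst p) ` (S \<times> T))" by (rule cover_num_le)
  also have "\<dots> \<le> card (S \<times> T)" using S T by (intro card_image_le) (auto simp: covers_def)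
  finally show ?thesis using S T by (simp add: card_cartesian_product)
qed

end

lemma cover_num_empty [simp]: "cover_num {} U = 0"
  using cover_num_le[of "{}" U "{}"] by (simp add: covers_def)

text \<open>If \<open>k\<close> and \<open>l\<close> lie in one right translate of a small neighbourhood of zero, then \<open>l - k\<close> is close
  to zero; by the tube lemma, adding it to any point of \<open>K\<close> avoids the closed set \<open>L\<close>.\<close>

lemma separating_neighbourhood:
  fixes K L :: "'g::{topological_group_add, t2_space} set"
  assumes K: "compact K" and L: "compact L" and KL: "K \<inter> L = {}"
  obtains U where "open U" "0 \<in> U" "\<And>g. rtrans U g \<inter> K = {} \<or> rtrans U g \<inter> L = {}"
proof -
  define W where "W = (\<lambda>p :: ('g \<times> 'g) \<times> 'g. snd (fst p) - fst (fst p) + snd p) -` (- L)"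
  have "open W" unfolding W_def
    using compact_imp_closed[OF L] by (intro open_vimage continuous_intros) (auto simp: open_Compl)
  moreover have "{(0, 0)} \<times> K \<subseteq> W" using KL by (auto simp: W_def)
  ultimately obtain X where X: "(0, 0) \<in> X" "open X" "X \<times> K \<subseteq> W" using Elementary_Topology.tube_lemma[OF K, of W "(0, 0)"] by metis
  obtain A B where AB': "open A" "open B" "(0, 0) \<in> A \<times> B" "A \<times> B \<subseteq> X" by (rule open_prod_elim[OF X(2,1)])
  hence AB: "open A" "open B" "0 \<in> A" "0 \<in> B" "A \<times> B \<subseteq> X" by simp_all
  have "rtrans (A \<inter> B) g \<inter> K = {} \<or> rtrans (A \<inter> B) g \<inter> L = {}" for g
  proof (rule ccontr)
    assume "\<not> ?thesis"
    then obtain k l where kl: "k \<in> K" "l \<in> L" "k - g \<in> A" "l - g \<in> B" by (auto simp: in_rtrans_iff)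
    hence "((k - g, l - g), k) \<in> W" using AB(5) X(3) by blast
    hence "l - g - (k - g) + k \<notin> L" by (simp add: W_def)
    moreover have "l - g - (k - g) + k = l"
      by (simp add: diff_conv_add_uminus minus_add add.assoc del: add_uminus_conv_diff)
    ultimately show False using kl by simp
  qed
  thus ?thesis using that[of "A \<inter> B"] AB by auto
qed


section \<open>A right invariant content\<close>

locale right_content =
  fixes c :: "'g::{topological_group_add, t2_space, second_countable_topology} set \<Rightarrow> real" and K0 :: "'g set"
  assumes c_nonneg: "compact K \<Longrightarrow> c K \<ge> 0"
    and c_mono: "compact K \<Longrightarrow> compact L \<Longrightarrow> K \<subseteq> L \<Longrightarrow> c K \<le> c L"
    and c_Un: "compact K \<Longrightarrow> compact L \<Longrightarrow> c (K \<union> L) \<le> c K + c L"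
    and c_disjoint: "compact K \<Longrightarrow> compact L \<Longrightarrow> K \<inter> L = {} \<Longrightarrow> c (K \<union> L) = c K + c L"
    and c_rtrans: "compact K \<Longrightarrow> c (rtrans K g) = c K"
    and K0: "compact K0" "c K0 = 1"
    and lc: "\<exists>U L. open U \<and> compact L \<and> (x :: 'g) \<in> U \<and> U \<subseteq> L"

text \<open>The content is a cluster point of the covering numbers, normalised by those of \<open>K0\<close>, for
  neighbourhoods of zero that shrink to zero.\<close>

theorem right_content_exists:
  assumes lc: "locally_compact_space (euclidean :: 'g::{topological_group_add, t2_space, second_countable_topology} topology)"
  shows "\<exists>(c :: 'g set \<Rightarrow> real) K0. right_content c K0"
proof -
  have lc': "\<exists>U L. open U \<and> compact L \<and> x \<in> U \<and> U \<subseteq> L" for x :: 'g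
    using lc by (auto simp: locally_compact_space_def)
  obtain W and K0 :: "'g set" where W: "open W" "compact K0" "0 \<in> W" "W \<subseteq> K0" using lc'[of 0] by blast
  obtain U :: "nat \<Rightarrow> 'g set" where U: "\<And>n. open (U n)" "\<And>n. 0 \<in> U n"
    "\<And>S. open S \<Longrightarrow> 0 \<in> S \<Longrightarrow> eventually (\<lambda>n. U n \<subseteq> S) sequentially"
    using countable_basis_at_decseq[of "0::'g"] by blast
  define l where "l n K = (if compact K then real (cover_num K (U n)) / real (cover_num K0 (U n)) else 0)" for n K
  define b where "b K = (if compact K then real (cover_num K W) else 0)" for K
  have K0pos: "real (cover_num K0 (U n)) > 0" for n
  proof -
    have "cover_num K0 (U n) \<ge> 1" using W by (intro cover_num_pos U) auto
    thus ?thesis by linarith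
  qed
  have lb: "l n K \<in> {0..b K}" for n K
  proof (cases "compact K")
    case True
    have "real (cover_num K (U n)) \<le> real (cover_num K W) * real (cover_num K0 (U n))"
      unfolding of_nat_mult[symmetric] of_nat_le_iff by (rule cover_num_trans[OF U(1,2) True W(2,1,3,4)])
    thus ?thesis using True K0pos[of n] by (simp add: l_def b_def field_simps)
  qed (simp add: l_def b_def)
  let ?S = "PiE UNIV (\<lambda>K. {0..b K})"
  have "compactin (product_topology (\<lambda>_. euclidean) UNIV) ?S" by (simp add: compactin_PiE)
  hence "compact ?S" by (simp add: euclidean_product_topology)
  moreover have "filtermap l sequentially \<noteq> bot" by (simp add: filtermap_bot_iff)
  moreover have "eventually (\<lambda>x. x \<in> ?S) (filtermap l sequentially)"
    using lb unfolding eventually_filtermap by (intro always_eventually allI PiE_I) auto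
  ultimately obtain c where c: "inf (nhds c) (filtermap l sequentially) \<noteq> bot"
    unfolding compact_filter by blast
  have cl: "c \<in> C" if C: "closed C" "eventually (\<lambda>n. l n \<in> C) sequentially" for C
  proof (rule ccontr)
    assume "c \<notin> C"
    hence "eventually (\<lambda>x. x \<in> - C) (nhds c)" using C(1) by (intro eventually_nhds_in_open) auto
    moreover have "eventually (\<lambda>x. x \<in> C) (filtermap l sequentially)" using C(2) by (simp add: eventually_filtermap)
    ultimately have "eventually (\<lambda>x. False) (inf (nhds c) (filtermap l sequentially))"
      unfolding eventually_inf by blast
    thus False using c by (simp add: eventually_False)
  qed
  note coord = continuous_on_product_coordinates
  have "right_content c K0"
  proof
    fix K L :: "'g set" and g x :: 'g
    assume K: "compact K"
    show "c K \<ge> 0"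
    proof -
      have "closed {f :: 'g set \<Rightarrow> real. 0 \<le> f K}" by (intro closed_Collect_le continuous_on_const coord)
      thus ?thesis using cl[of "{f. 0 \<le> f K}"] lb by auto
    qed
    show "c (rtrans K g) = c K"
    proof -
      have "closed {f :: 'g set \<Rightarrow> real. f (rtrans K g) = f K}" by (intro closed_Collect_eq coord)
      moreover have "l n (rtrans K g) = l n K" for n
        using K by (simp add: l_def compact_rtrans cover_num_rtrans[OF U(1,2)])
      ultimately show ?thesis using cl[of "{f. f (rtrans K g) = f K}"] by simp
    qed
    assume L: "compact L"
    show "c (K \<union> L) \<le> c K + c L"
    proof -
      have "l n (K \<union> L) \<le> l n K + l n L" for n
        using cover_num_Un[OF U(1)[of n] U(2)[of n] K L] K L K0pos[of n]
        by (simp add: l_def add_divide_distrib[symmetric] divide_le_cancel flip: of_nat_add)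
      moreover have "closed {f :: 'g set \<Rightarrow> real. f (K \<union> L) \<le> f K + f L}"
        by (intro closed_Collect_le continuous_on_add coord)
      ultimately show ?thesis using cl[of "{f. f (K \<union> L) \<le> f K + f L}"] by simp
    qed
    show "c K \<le> c L" if "K \<subseteq> L"
    proof -
      have "l n K \<le> l n L" for n
        using cover_num_mono[OF U(1)[of n] U(2)[of n] L that] K L K0pos[of n] by (simp add: l_def divide_le_cancel)
      moreover have "closed {f :: 'g set \<Rightarrow> real. f K \<le> f L}" by (intro closed_Collect_le coord)
      ultimately show ?thesis using cl[of "{f. f K \<le> f L}"] by simp
    qed
    show "c (K \<union> L) = c K + c L" if KL: "K \<inter> L = {}"
    proof -
      obtain V where V: "open V" "0 \<in> V" "\<And>g. rtrans V g \<inter> K = {} \<or> rtrans V g \<inter> L = {}"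
        using separating_neighbourhood[OF K L KL] by blast
      have "eventually (\<lambda>n. l n (K \<union> L) = l n K + l n L) sequentially"
        using U(3)[OF V(1,2)]
      proof eventually_elim
        case (elim n)
        have "rtrans (U n) g \<inter> K = {} \<or> rtrans (U n) g \<inter> L = {}" for g
          using V(3)[of g] elim unfolding rtrans_def by blast
        hence "cover_num (K \<union> L) (U n) = cover_num K (U n) + cover_num L (U n)"
          by (intro antisym cover_num_Un cover_num_disjoint_Un U K L)
        thus ?case using K L compact_Un[OF K L] by (simp add: l_def add_divide_distrib)
      qed
      moreover have "closed {f :: 'g set \<Rightarrow> real. f (K \<union> L) = f K + f L}"
        by (intro closed_Collect_eq continuous_on_add coord)
      ultimately show ?thesis using cl[of "{f. f (K \<union> L) = f K + f L}"] by simp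
    qed
  next
    have "l n K0 = 1" for n using K0pos[of n] W by (simp add: l_def)
    moreover have "closed {f :: 'g set \<Rightarrow> real. f K0 = 1}" by (intro closed_Collect_eq continuous_on_const coord)
    ultimately show "c K0 = 1" using cl[of "{f. f K0 = 1}"] by simp
  qed (use W lc' in auto)
  thus ?thesis by blast
qed

lemma Hausdorff_space_t2: "Hausdorff_space (euclidean :: 'b::t2_space topology)"
  using hausdorff by (auto simp: Hausdorff_space_def disjnt_def)

lemma compact_split:
  fixes K :: "'b::t2_space set"
  assumes K: "compact K" "K \<subseteq> A \<union> B" and AB: "open A" "open B"
  obtains K1 K2 where "compact K1" "compact K2" "K1 \<subseteq> A" "K2 \<subseteq> B" "K = K1 \<union> K2"
proof -
  have "compact (K - A)" "compact (K - B)" using K AB by (auto intro: compact_diff)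
  moreover have "disjnt (K - A) (K - B)" using K by (auto simp: disjnt_def)
  ultimately obtain U V where UV: "open U" "open V" "K - A \<subseteq> U" "K - B \<subseteq> V" "disjnt U V"
    using Hausdorff_space_compact_separation[OF Hausdorff_space_t2, of "K - A" "K - B"] by auto
  show ?thesis
    by (rule that[of "K - U" "K - V"]) (use UV K in \<open>auto intro: compact_diff simp: disjnt_def\<close>)
qed

section \<open>Haar measure\<close>

context right_content
begin

text \<open>Open sets are measured from inside by the contents of compact sets, arbitrary sets from outside
  by open sets; the resulting outer measure is a measure on the Borel sets.\<close>

definition inner_content :: "'g set \<Rightarrow> ennreal" where
  "inner_content U = (SUP K\<in>{K. compact K \<and> K \<subseteq> U}. ennreal (c K))"

definition outer_content :: "'g set \<Rightarrow> ennreal" where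
  "outer_content A = (INF U\<in>{U. open U \<and> A \<subseteq> U}. inner_content U)"

lemma c_empty: "c {} = 0"
  using c_disjoint[of "{}" "{}"] by simp

lemma inner_content_upper: "compact K \<Longrightarrow> K \<subseteq> U \<Longrightarrow> ennreal (c K) \<le> inner_content U"
  unfolding inner_content_def by (rule SUP_upper) simp

lemma inner_content_mono: "U \<subseteq> V \<Longrightarrow> inner_content U \<le> inner_content V"
  unfolding inner_content_def by (rule SUP_subset_mono) auto

lemma outer_content_mono: "A \<subseteq> B \<Longrightarrow> outer_content A \<le> outer_content B"
  unfolding outer_content_def by (rule INF_superset_mono) auto

lemma outer_content_le: "open U \<Longrightarrow> A \<subseteq> U \<Longrightarrow> outer_content A \<le> inner_content U"
  unfolding outer_content_def by (rule INF_lower) simp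

lemma outer_content_open: "open U \<Longrightarrow> outer_content U = inner_content U"
  by (intro antisym outer_content_le) (auto simp: outer_content_def intro!: INF_greatest inner_content_mono)

lemma inner_content_empty: "inner_content {} = 0"
  by (simp add: inner_content_def c_empty cong: conj_cong)

lemma inner_content_Un:
  assumes "open A" "open B"
  shows "inner_content (A \<union> B) \<le> inner_content A + inner_content B"
  unfolding inner_content_def[of "A \<union> B"]
proof (rule SUP_least)
  fix K assume "K \<in> {K. compact K \<and> K \<subseteq> A \<union> B}"
  hence "compact K" "K \<subseteq> A \<union> B" by auto
  then obtain K1 K2 where K: "compact K1" "compact K2" "K1 \<subseteq> A" "K2 \<subseteq> B" "K = K1 \<union> K2"
    by (rule compact_split[OF _ _ assms])
  have "ennreal (c K) \<le> ennreal (c K1) + ennreal (c K2)"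
    using c_Un[OF K(1,2)] c_nonneg K by (simp add: ennreal_plus[symmetric] del: ennreal_plus)
  also have "\<dots> \<le> inner_content A + inner_content B" by (intro add_mono inner_content_upper K)
  finally show "ennreal (c K) \<le> inner_content A + inner_content B" .
qed

lemma inner_content_UN_finite:
  assumes "\<And>i. open (A i)"
  shows "inner_content (\<Union>i<n::nat. A i) \<le> (\<Sum>i<n. inner_content (A i))"
proof (induction n)
  case 0
  show ?case by (simp add: inner_content_empty)
next
  case (Suc n)
  have "inner_content (\<Union>i<Suc n. A i) \<le> inner_content (\<Union>i<n. A i) + inner_content (A n)"
    using inner_content_Un[of "\<Union>i<n. A i" "A n"] assms by (simp add: lessThan_Suc Un_commute open_UN)
  thus ?case using Suc by (simp add: add_right_mono order_trans)
qed

lemma inner_content_UN: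
  assumes A: "\<And>i::nat. open (A i)"
  shows "inner_content (\<Union>i. A i) \<le> (\<Sum>i. inner_content (A i))"
  unfolding inner_content_def[of "\<Union>i. A i"]
proof (rule SUP_least)
  fix K assume "K \<in> {K. compact K \<and> K \<subseteq> (\<Union>i. A i)}"
  hence K: "compact K" "K \<subseteq> (\<Union>i\<in>UNIV. A i)" by auto
  then obtain D where D: "finite D" "K \<subseteq> (\<Union>i\<in>D. A i)" using compactE_image[OF K(1), of UNIV A] A by metis
  obtain n where n: "D \<subseteq> {..<n}" using finite_nat_iff_bounded D(1) by blast
  have "(\<Union>i\<in>D. A i) \<subseteq> (\<Union>i<n. A i)" using n by blast
  hence "ennreal (c K) \<le> inner_content (\<Union>i<n. A i)" using D(2) K by (intro inner_content_upper) auto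
  also have "\<dots> \<le> (\<Sum>i<n. inner_content (A i))" by (rule inner_content_UN_finite[OF A])
  also have "\<dots> \<le> (\<Sum>i. inner_content (A i))" by (rule sum_le_suminf) auto
  finally show "ennreal (c K) \<le> (\<Sum>i. inner_content (A i))" .
qed

lemma outer_content_lessD: "outer_content A < x \<Longrightarrow> \<exists>U. open U \<and> A \<subseteq> U \<and> inner_content U < x"
  unfolding outer_content_def INF_less_iff by auto

lemma outer_content_UN: "outer_content (\<Union>i::nat. A i) \<le> (\<Sum>i. outer_content (A i))"
proof (rule ennreal_le_epsilon)
  fix e :: real assume e: "0 < e" and fin: "(\<Sum>i. outer_content (A i)) < top"
  have "outer_content (A n) < outer_content (A n) + e * (1/2)^Suc n" for n
    using fin e by (auto simp add: less_top dest!: ennreal_suminf_lessD)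
  hence "\<exists>U. open U \<and> A n \<subseteq> U \<and> inner_content U < outer_content (A n) + e * (1/2)^Suc n" for n
    by (rule outer_content_lessD)
  then obtain U where U: "\<And>n. open (U n)" "\<And>n. A n \<subseteq> U n" "\<And>n. inner_content (U n) < outer_content (A n) + e * (1/2)^Suc n"
    by metis
  have "outer_content (\<Union>i. A i) \<le> inner_content (\<Union>i. U i)" using U by (intro outer_content_le) blast+
  also have "\<dots> \<le> (\<Sum>i. inner_content (U i))" by (rule inner_content_UN[OF U(1)])
  also have "\<dots> \<le> (\<Sum>n. outer_content (A n) + e * (1/2) ^ Suc n)"
    using U(3) by (intro suminf_le less_imp_le) auto
  also have "\<dots> = (\<Sum>n. outer_content (A n)) + (\<Sum>n. ennreal e * ennreal ((1/2) ^ Suc n))"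
    using \<open>0 < e\<close> by (subst suminf_add[symmetric])
                     (auto simp del: ennreal_suminf_cmult simp add: ennreal_mult[symmetric])
  also have "\<dots> = (\<Sum>n. outer_content (A n)) + e"
    unfolding ennreal_suminf_cmult
    by (subst suminf_ennreal_eq[OF zero_le_power power_half_series]) auto
  finally show "outer_content (\<Union>i. A i) \<le> (\<Sum>i. outer_content (A i)) + ennreal e" .
qed

lemma outer_content_outer_measure: "outer_measure_space (Pow UNIV) outer_content"
  unfolding outer_measure_space_def positive_def increasing_def countably_subadditive_def
  using outer_content_mono outer_content_UN outer_content_open[of "{}"] inner_content_empty by auto

text \<open>A compact subset of \<open>W \<inter> U\<close> and one of the rest of \<open>W\<close> are disjoint, so their contents add up.\<close>

lemma open_outer_content_measurable:
  assumes U: "open U"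
  shows "outer_content (U \<inter> X) + outer_content ((UNIV - U) \<inter> X) = outer_content X"
proof (rule antisym)
  show "outer_content (U \<inter> X) + outer_content ((UNIV - U) \<inter> X) \<le> outer_content X"
    unfolding outer_content_def[of X]
  proof (rule INF_greatest)
    fix W assume "W \<in> {W. open W \<and> X \<subseteq> W}"
    hence W: "open W" "X \<subseteq> W" by auto
    have main: "ennreal (c K) + outer_content (W - U) \<le> inner_content W" if K: "compact K" "K \<subseteq> U \<inter> W" for K
    proof -
      have "outer_content (W - U) \<le> inner_content (W - K)"
        using K compact_imp_closed[OF K(1)] W by (intro outer_content_le open_Diff) auto
      hence "ennreal (c K) + outer_content (W - U) \<le> ennreal (c K) + inner_content (W - K)" by (rule add_left_mono)
      also have "\<dots> = (SUP L\<in>{L. compact L \<and> L \<subseteq> W - K}. ennreal (c K) + ennreal (c L))"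
        unfolding inner_content_def by (rule ennreal_SUP_add_right) auto
      also have "\<dots> \<le> inner_content W"
      proof (rule SUP_least)
        fix L assume "L \<in> {L. compact L \<and> L \<subseteq> W - K}"
        hence L: "compact L" "L \<subseteq> W - K" by auto
        have "K \<inter> L = {}" using L by blast
        hence "ennreal (c K) + ennreal (c L) = ennreal (c (K \<union> L))"
          using c_disjoint[OF K(1) L(1)] L c_nonneg K(1) by (subst ennreal_plus[symmetric]) auto
        also have "\<dots> \<le> inner_content W" using K L by (intro inner_content_upper) auto
        finally show "ennreal (c K) + ennreal (c L) \<le> inner_content W" .
      qed
      finally show ?thesis .
    qed
    have "outer_content (U \<inter> X) + outer_content ((UNIV - U) \<inter> X) \<le> inner_content (U \<inter> W) + outer_content (W - U)"
      using W U by (intro add_mono outer_content_le outer_content_mono) auto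
    also have "\<dots> = (SUP K\<in>{K. compact K \<and> K \<subseteq> U \<inter> W}. ennreal (c K) + outer_content (W - U))"
      unfolding inner_content_def by (rule ennreal_SUP_add_left[symmetric]) auto
    also have "\<dots> \<le> inner_content W" using main by (intro SUP_least) auto
    finally show "outer_content (U \<inter> X) + outer_content ((UNIV - U) \<inter> X) \<le> inner_content W" .
  qed
  let ?A = "\<lambda>n::nat. if n = 0 then U \<inter> X else if n = 1 then (UNIV - U) \<inter> X else {}"
  have "X = (\<Union>n. ?A n)" by auto
  hence "outer_content X \<le> (\<Sum>n. outer_content (?A n))" using outer_content_UN[of ?A] by metis
  also have "\<dots> = (\<Sum>n\<in>{0,1}. outer_content (?A n))"
    using outer_content_open[of "{}"] inner_content_empty by (intro suminf_finite) auto
  also have "\<dots> = outer_content (U \<inter> X) + outer_content ((UNIV - U) \<inter> X)" by simp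
  finally show "outer_content X \<le> outer_content (U \<inter> X) + outer_content ((UNIV - U) \<inter> X)" .
qed

lemma measure_space_outer_content: "measure_space UNIV (sets borel) outer_content"
proof -
  interpret sigma_algebra "UNIV :: 'g set" "Pow UNIV" by (rule sigma_algebra_Pow)
  let ?L = "lambda_system UNIV (Pow UNIV) outer_content"
  have ms: "measure_space UNIV ?L outer_content" by (rule caratheodory_lemma[OF outer_content_outer_measure])
  have "{S. open S} \<subseteq> ?L" using open_outer_content_measurable by (auto simp: lambda_system_def)
  hence "sigma_sets UNIV {S. open S} \<subseteq> ?L"
    using ms sigma_algebra.sigma_sets_subset unfolding measure_space_def by blast
  hence "sets borel \<subseteq> ?L" by (simp add: borel_def)
  thus ?thesis
    using measure_down[OF ms] sets.sigma_algebra_axioms[of borel] by (simp add: space_borel)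
qed

definition haar :: "'g measure" where
  "haar = measure_of UNIV (sets borel) outer_content"

lemma sets_haar [simp]: "sets haar = sets borel"
  by (simp add: haar_def) (metis sets.sets_measure_of_eq sets.sigma_sets_eq space_borel)

lemma emeasure_haar: "A \<in> sets borel \<Longrightarrow> emeasure haar A = outer_content A"
proof -
  assume A: "A \<in> sets borel"
  have "sets haar = sets borel" by simp
  thus ?thesis
    using measure_space_outer_content A
    by (intro emeasure_measure_of[OF haar_def]) (auto simp: measure_space_def)
qed

lemma inner_content_rtrans_le: "inner_content U \<le> inner_content (rtrans U g)"
  unfolding inner_content_def[of U]
proof (rule SUP_least)
  fix K assume "K \<in> {K. compact K \<and> K \<subseteq> U}"
  hence K: "compact K" "K \<subseteq> U" by auto
  have "ennreal (c K) = ennreal (c (rtrans K g))" by (simp add: c_rtrans K)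
  also have "\<dots> \<le> inner_content (rtrans U g)" using K by (intro inner_content_upper compact_rtrans) (auto simp: rtrans_def)
  finally show "ennreal (c K) \<le> inner_content (rtrans U g)" .
qed

lemma outer_content_rtrans_le: "outer_content (rtrans A g) \<le> outer_content A"
  unfolding outer_content_def[of A]
proof (rule INF_greatest)
  fix U assume "U \<in> {U. open U \<and> A \<subseteq> U}"
  hence U: "open U" "A \<subseteq> U" by auto
  have "outer_content (rtrans A g) \<le> inner_content (rtrans U g)" using U by (intro outer_content_le open_rtrans) (auto simp: rtrans_def)
  also have "\<dots> \<le> inner_content U" using inner_content_rtrans_le[of "rtrans U g" "- g"] by (simp add: rtrans_plus)
  finally show "outer_content (rtrans A g) \<le> inner_content U" .
qed

lemma outer_content_rtrans: "outer_content (rtrans A g) = outer_content A"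
  using outer_content_rtrans_le[of A g] outer_content_rtrans_le[of "rtrans A g" "- g"] by (simp add: rtrans_plus)

lemma outer_content_compact_ge: "compact K \<Longrightarrow> ennreal (c K) \<le> outer_content K"
  unfolding outer_content_def by (intro INF_greatest inner_content_upper) auto

lemma outer_content_compact_finite:
  assumes K: "compact K"
  shows "outer_content K < \<infinity>"
proof -
  obtain U L where UL: "\<And>x. open (U x)" "\<And>x. compact (L x)" "\<And>x :: 'g. x \<in> U x" "\<And>x. U x \<subseteq> L x" using lc by metis
  have "K \<subseteq> (\<Union>x\<in>K. U x)" using UL(3) by blast
  then obtain D where D: "finite D" "K \<subseteq> (\<Union>x\<in>D. U x)" using compactE_image[OF K, of K U] UL(1) by metis
  have cL: "compact (\<Union>x\<in>D. L x)" using D UL(2) by (intro compact_UN) auto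
  have "outer_content K \<le> inner_content (\<Union>x\<in>D. U x)" using D UL by (intro outer_content_le) auto
  also have "\<dots> \<le> ennreal (c (\<Union>x\<in>D. L x))"
    unfolding inner_content_def using UL(4) by (intro SUP_least ennreal_leI c_mono cL) fastforce+
  also have "\<dots> < \<infinity>" by simp
  finally show ?thesis .
qed

end

definition right_haar :: "'g::{topological_group_add, t2_space} measure \<Rightarrow> bool" where
  "right_haar m \<longleftrightarrow> sets m = sets borel \<and> emeasure m UNIV \<noteq> 0 \<and> sigma_finite_measure m \<and>
     (\<forall>A\<in>sets borel. \<forall>g. emeasure m (rtrans A g) = emeasure m A) \<and>
     (\<forall>A\<in>sets borel. \<forall>e. emeasure m A < e \<longrightarrow> (\<exists>U. open U \<and> A \<subseteq> U \<and> emeasure m U < e)) \<and>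
     (\<forall>U. open U \<longrightarrow> (\<forall>e<emeasure m U. \<exists>K. compact K \<and> K \<subseteq> U \<and> e < emeasure m K))"

theorem right_haar_exists:
  assumes "locally_compact_space (euclidean :: 'g::{topological_group_add, t2_space, second_countable_topology} topology)"
  shows "\<exists>m :: 'g measure. right_haar m"
proof -
  obtain c and K0 :: "'g set" where "right_content c K0" using right_content_exists[OF assms] by blast
  then interpret right_content c K0 .
  have rt: "rtrans A g \<in> sets borel" if A: "A \<in> sets borel" for A and g :: 'g
  proof -
    have "(\<lambda>x. x - g) \<in> measurable borel borel" by (intro borel_measurable_continuous_onI continuous_intros)
    from measurable_sets[OF this A] show ?thesis by (simp add: rtrans_vimage space_borel)
  qed
  have "sigma_finite_measure haar"
  proof
    obtain U L where UL: "\<And>x. open (U x)" "\<And>x. compact (L x)" "\<And>x :: 'g. x \<in> U x" "\<And>x. U x \<subseteq> L x" using lc by metis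
    obtain D where D: "D \<subseteq> range U" "countable D" "\<Union>D = \<Union>(range U)" using Lindelof[of "range U"] UL(1) by auto
    have "\<Union>D = UNIV" using D(3) UL(3) by blast
    moreover have "emeasure haar V \<noteq> \<infinity>" if V: "V \<in> D" for V
    proof -
      obtain x where x: "V = U x" using D(1) V by blast
      have "emeasure haar V \<le> emeasure haar (L x)" using UL x by (intro emeasure_mono) (auto intro: borel_compact)
      also have "\<dots> < \<infinity>" using outer_content_compact_finite[OF UL(2)] by (simp add: emeasure_haar borel_compact UL(2))
      finally show ?thesis by simp
    qed
    ultimately show "\<exists>A. countable A \<and> A \<subseteq> sets haar \<and> \<Union>A = space haar \<and> (\<forall>a\<in>A. emeasure haar a \<noteq> \<infinity>)"
      using D(1,2) UL(1) by (intro exI[of _ D]) (auto simp: haar_def intro: borel_open)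
  qed
  moreover have "emeasure haar UNIV \<noteq> 0"
  proof -
    have "1 \<le> outer_content K0" using outer_content_compact_ge[OF K0(1)] K0(2) by simp
    also have "\<dots> \<le> emeasure haar UNIV" by (simp add: emeasure_haar outer_content_mono)
    finally show ?thesis by auto
  qed
  moreover have "\<exists>U. open U \<and> A \<subseteq> U \<and> emeasure haar U < e" if "A \<in> sets borel" "emeasure haar A < e" for A e
    using that unfolding emeasure_haar[OF that(1)] outer_content_def INF_less_iff
    by (metis (mono_tags, lifting) borel_open emeasure_haar mem_Collect_eq outer_content_open)
  moreover have "\<exists>K. compact K \<and> K \<subseteq> U \<and> e < emeasure haar K" if U: "open U" "e < emeasure haar U" for U e
  proof -
    have "e < inner_content U" using U by (simp add: emeasure_haar outer_content_open)
    then obtain K where K: "compact K" "K \<subseteq> U" "e < ennreal (c K)" unfolding inner_content_def less_SUP_iff by auto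
    thus ?thesis using outer_content_compact_ge[OF K(1)] by (auto simp: emeasure_haar borel_compact intro: less_le_trans)
  qed
  ultimately have "right_haar haar"
    unfolding right_haar_def using rt by (auto simp: emeasure_haar outer_content_rtrans)
  thus ?thesis by blast
qed

lemma right_haarD:
  assumes "right_haar m"
  shows "sets m = sets borel" "space m = UNIV" "emeasure m UNIV \<noteq> 0" "sigma_finite_measure m"
    "A \<in> sets borel \<Longrightarrow> emeasure m (rtrans A g) = emeasure m A"
    "A \<in> sets borel \<Longrightarrow> emeasure m A < e \<Longrightarrow> \<exists>U. open U \<and> A \<subseteq> U \<and> emeasure m U < e"
    "open U \<Longrightarrow> e < emeasure m U \<Longrightarrow> \<exists>K. compact K \<and> K \<subseteq> U \<and> e < emeasure m K"
  using assms sets_eq_imp_space_eq[of m borel] unfolding right_haar_def by auto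

lemma borel_rtrans:
  fixes g :: "'g::topological_group_add"
  assumes "A \<in> sets borel"
  shows "rtrans A g \<in> sets borel"
proof -
  have "(\<lambda>x. x - g) \<in> measurable borel borel" by (intro borel_measurable_continuous_onI continuous_intros)
  from measurable_sets[OF this assms] show ?thesis by (simp add: rtrans_vimage space_borel)
qed

text \<open>A set of positive measure fills most of a suitable open set; a small translate of it still lies
  in that open set, so it cannot avoid the original.\<close>

theorem steinhaus:
  fixes S :: "'g::{topological_group_add, t2_space} set"
  assumes m: "right_haar m" and S: "S \<in> sets borel" "emeasure m S \<noteq> 0"
  obtains W where "open W" "0 \<in> W" "\<And>w. w \<in> W \<Longrightarrow> \<exists>s\<in>S. s + w \<in> S"
proof -
  note m' = right_haarD[OF m]
  interpret sigma_finite_measure m by (rule m'(4))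
  obtain A :: "nat \<Rightarrow> 'g set" where A: "range A \<subseteq> sets m" "(\<Union>i. A i) = space m" "\<And>i. emeasure m (A i) \<noteq> \<infinity>"
    using sigma_finite by blast
  have "\<exists>i. emeasure m (S \<inter> A i) \<noteq> 0"
  proof (rule ccontr)
    assume "\<not> ?thesis"
    hence "S \<inter> A i \<in> null_sets m" for i using S A m'(1) by (auto simp: null_sets_def)
    hence "(\<Union>i. S \<inter> A i) \<in> null_sets m" by (intro null_sets_UN) auto
    moreover have "(\<Union>i. S \<inter> A i) = S" using A(2) m'(2) by auto
    ultimately show False using S by auto
  qed
  then obtain i where i: "emeasure m (S \<inter> A i) \<noteq> 0" by blast
  define R where "R = S \<inter> A i"
  have R: "R \<in> sets borel" "emeasure m R \<noteq> 0" "R \<subseteq> S" using i S A m'(1) by (auto simp: R_def)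
  have "emeasure m R \<le> emeasure m (A i)" unfolding R_def using A by (intro emeasure_mono) auto
  hence Rfin: "emeasure m R \<noteq> \<infinity>" using A(3)[of i] by (auto simp: top_unique)
  define r where "r = measure m R"
  have r: "emeasure m R = ennreal r" "r > 0"
  proof -
    show 1: "emeasure m R = ennreal r" using Rfin by (simp add: r_def emeasure_eq_ennreal_measure)
    show "r > 0" using R(2) unfolding 1 by (simp add: ennreal_eq_0_iff not_le)
  qed
  \<comment> \<open>Two disjoint sets of measure above \<open>3/4 * r\<close> do not fit into a set of measure below \<open>5/4 * r\<close>.\<close>
  have "emeasure m R < ennreal (5/4 * r)" using r by (simp add: ennreal_less_iff)
  then obtain U where U: "open U" "R \<subseteq> U" "emeasure m U < ennreal (5/4 * r)" using m'(6)[OF R(1)] by blast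
  have Ur: "emeasure m U \<ge> ennreal r" unfolding r(1)[symmetric] using U R m'(1) by (intro emeasure_mono) auto
  define u where "u = measure m U"
  have Ufin: "emeasure m U \<noteq> \<infinity>" using U(3) by (auto simp: top_unique)
  have u: "emeasure m U = ennreal u" "r \<le> u" "u < 5/4 * r"
  proof -
    show 1: "emeasure m U = ennreal u" using Ufin by (simp add: u_def emeasure_eq_ennreal_measure)
    have "u \<ge> 0" by (simp add: u_def)
    thus "r \<le> u" "u < 5/4 * r" using Ur U(3) r(2) unfolding 1 by (auto simp: ennreal_less_iff)
  qed
  have "ennreal (u - r/4) < emeasure m U" using u r by (simp add: ennreal_less_iff)
  then obtain C where C: "compact C" "C \<subseteq> U" "ennreal (u - r/4) < emeasure m C" using m'(7)[OF U(1)] by blast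
  have Cb: "C \<in> sets borel" using C by (intro borel_compact)
  have Cfin: "emeasure m C \<noteq> \<infinity>" using emeasure_mono[OF C(2), of m] Ufin U(1) m'(1) by (auto simp: top_unique)
  define T where "T = R \<inter> C"
  have Tb: "T \<in> sets borel" using R Cb by (simp add: T_def)
  have mC: "measure m C > u - r/4"
    using C(3) Cfin u r by (simp add: emeasure_eq_ennreal_measure ennreal_less_iff)
  have fin: "R \<in> fmeasurable m" "C \<in> fmeasurable m" "U \<in> fmeasurable m"
    using R Cb U m'(1) Rfin Cfin Ufin by (auto simp: fmeasurable_def less_top)
  have "measure m (R \<union> C) \<le> u"
    unfolding u_def using U C fin by (intro measure_mono_fmeasurable) auto
  moreover have "measure m (R \<union> C) = r + measure m C - measure m T"
    unfolding T_def r_def using fin by (intro measure_Un3)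
  ultimately have mT: "measure m T > 3/4 * r" using mC by linarith
  have Tfin: "T \<in> fmeasurable m" unfolding T_def using fin by (intro fmeasurable_Int_fmeasurable) auto
  define V where "V = (\<lambda>p :: 'g \<times> 'g. snd p + fst p) -` U"
  have "open V" unfolding V_def using U by (intro open_vimage continuous_intros)
  moreover have "{0} \<times> C \<subseteq> V" using C by (auto simp: V_def)
  ultimately obtain W where W: "0 \<in> W" "open W" "W \<times> C \<subseteq> V"
    using Elementary_Topology.tube_lemma[OF C(1), of V 0] by metis
  show ?thesis
  proof (rule that[OF W(2,1)])
    fix w assume w: "w \<in> W"
    have tr: "emeasure m (rtrans T w) = emeasure m T" by (rule m'(5)[OF Tb])
    have trb: "rtrans T w \<in> fmeasurable m"
      using Tfin tr borel_rtrans[OF Tb, of w] m'(1) by (auto simp: fmeasurable_def)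
    have sub: "T \<union> rtrans T w \<subseteq> U"
    proof -
      have "x + w \<in> U" if "x \<in> T" for x
        using W(3) w that unfolding T_def V_def by fastforce
      thus ?thesis using C(2) by (auto simp: T_def rtrans_def)
    qed
    have "T \<inter> rtrans T w \<noteq> {}"
    proof
      assume d: "T \<inter> rtrans T w = {}"
      have "measure m (T \<union> rtrans T w) = measure m T + measure m (rtrans T w)"
        using measure_Un3[OF Tfin trb] d by simp
      moreover have "measure m (T \<union> rtrans T w) \<le> u" unfolding u_def using sub fin Tfin trb
        by (intro measure_mono_fmeasurable) auto
      moreover have "measure m (rtrans T w) = measure m T" using tr by (simp add: measure_def)
      ultimately show False using mT u by linarith
    qed
    then obtain x where "x \<in> T" "x \<in> rtrans T w" by blast
    then obtain s where "s \<in> T" "s + w \<in> T" by (auto simp: rtrans_def)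
    thus "\<exists>s\<in>S. s + w \<in> S" using R(3) by (auto simp: T_def)
  qed
qed


section \<open>Separability of the space of measurable maps\<close>

text \<open>Formulas index the Boolean algebra that is generated by a sequence of sets; there are only
  countably many.\<close>

datatype set_formula = Atom nat | Neg set_formula | Disj set_formula set_formula

instance set_formula :: countable
  by countable_datatype

fun interp :: "'w set \<Rightarrow> (nat \<Rightarrow> 'w set) \<Rightarrow> set_formula \<Rightarrow> 'w set" where
  "interp S U (Atom n) = U n"
| "interp S U (Neg p) = S - interp S U p"
| "interp S U (Disj p q) = interp S U p \<union> interp S U q"

lemma standard_borel_countably_generated:
  assumes "standard_borel M"
  obtains U :: "nat \<Rightarrow> 'w set" where "sets M = sigma_sets (space M) (range U)"
proof -
  obtain T where T: "topspace T = space M" "second_countable T" "sets M = sigma_sets (space M) {U. openin T U}"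
    using assms unfolding standard_borel_def by blast
  obtain B where B: "countable B" "\<And>V. V \<in> B \<Longrightarrow> openin T V" "\<And>U x. openin T U \<Longrightarrow> x \<in> U \<Longrightarrow> \<exists>V\<in>B. x \<in> V \<and> V \<subseteq> U"
    using T(2) unfolding second_countable_def by metis
  define U where "U = from_nat_into (insert {} B)"
  have rU: "range U = insert {} B" unfolding U_def using B(1) by (intro range_from_nat_into) auto
  have "openin T V" if "V \<in> insert {} B" for V using that B(2) by auto
  hence op: "\<And>n. openin T (U n)" using rU by blast
  have "sigma_sets (space M) {U. openin T U} = sigma_sets (space M) (range U)"
  proof
    show "sigma_sets (space M) (range U) \<subseteq> sigma_sets (space M) {U. openin T U}"
      using op by (intro sigma_sets_mono') blast
    show "sigma_sets (space M) {U. openin T U} \<subseteq> sigma_sets (space M) (range U)"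
    proof (rule sigma_sets_mono, rule subsetI)
      fix S assume "S \<in> {U. openin T U}"
      hence "S = \<Union>{V\<in>B. V \<subseteq> S}" using B(3) by blast
      moreover have "\<Union>{V\<in>B. V \<subseteq> S} \<in> sigma_sets (space M) (range U)"
        using B(1) rU by (intro sigma_sets_UNION countable_subset[OF _ B(1)]) (auto intro!: sigma_sets.Basic)
      ultimately show "S \<in> sigma_sets (space M) (range U)" by simp
    qed
  qed
  thus ?thesis using that T(3) by metis
qed

context prob_space
begin

definition set_dist :: "'a set \<Rightarrow> 'a set \<Rightarrow> real" where
  "set_dist A B = prob ((A - B) \<union> (B - A))"

lemma set_dist_triangle:
  assumes "A \<in> events" "B \<in> events" "C \<in> events"
  shows "set_dist A C \<le> set_dist A B + set_dist B C"
proof -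
  have "set_dist A C \<le> prob (((A - B) \<union> (B - A)) \<union> ((B - C) \<union> (C - B)))"
    unfolding set_dist_def using assms by (intro finite_measure_mono) auto
  also have "\<dots> \<le> set_dist A B + set_dist B C"
    unfolding set_dist_def using assms by (intro measure_Un_le) auto
  finally show ?thesis .
qed

lemma set_dist_Un:
  assumes "A \<in> events" "B \<in> events" "C \<in> events" "D \<in> events"
  shows "set_dist (A \<union> C) (B \<union> D) \<le> set_dist A B + set_dist C D"
proof -
  have "set_dist (A \<union> C) (B \<union> D) \<le> prob (((A - B) \<union> (B - A)) \<union> ((C - D) \<union> (D - C)))"
    unfolding set_dist_def using assms by (intro finite_measure_mono) auto
  also have "\<dots> \<le> set_dist A B + set_dist C D"
    unfolding set_dist_def using assms by (intro measure_Un_le) auto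
  finally show ?thesis .
qed

context
  fixes U :: "nat \<Rightarrow> 'a set"
  assumes gen: "events = sigma_sets (space M) (range U)"
begin

lemma interp_event: "interp (space M) U p \<in> events"
  by (induction p) (auto simp: gen intro: sigma_sets.Basic, auto simp: gen[symmetric])

text \<open>The events that formulas approximate form a sigma-algebra.\<close>

lemma event_approximation:
  assumes "A \<in> events" "e > 0"
  shows "\<exists>p. set_dist A (interp (space M) U p) < e"
proof -
  let ?i = "interp (space M) U"
  have ev: "\<And>A. A \<in> sigma_sets (space M) (range U) \<Longrightarrow> A \<in> events" by (simp add: gen)
  have "A \<in> sigma_sets (space M) (range U)" using assms gen by simp
  hence "\<forall>e>0. \<exists>p. set_dist A (?i p) < e"
  proof induction
    case (Basic A)
    then obtain n where "A = U n" by blast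
    thus ?case by (auto simp: set_dist_def intro!: exI[of _ "Atom n"])
  next
    case Empty
    have "?i (Neg (Disj (Atom 0) (Neg (Atom 0)))) = {}" by auto
    thus ?case by (auto simp: set_dist_def intro!: exI[of _ "Neg (Disj (Atom 0) (Neg (Atom 0)))"] simp del: interp.simps)
  next
    case (Compl A)
    have "set_dist (space M - A) (?i (Neg p)) = set_dist A (?i p)" for p
    proof -
      have "A \<subseteq> space M" "?i p \<subseteq> space M" using Compl(1) ev interp_event sets.sets_into_space by blast+
      hence "((space M - A) - ?i (Neg p)) \<union> (?i (Neg p) - (space M - A)) = (A - ?i p) \<union> (?i p - A)" by auto
      thus ?thesis unfolding set_dist_def by (rule arg_cong)
    qed
    thus ?case using Compl by metis
  next
    case (Union A)
    have Aev: "\<And>i. A i \<in> events" using Union(1) ev by blast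
    have fin: "\<forall>e>0. \<exists>p. set_dist (\<Union>i<n. A i) (?i p) < e" for n :: nat
    proof (induction n)
      case 0
      have "?i (Neg (Disj (Atom 0) (Neg (Atom 0)))) = {}" by auto
      thus ?case by (auto simp: set_dist_def intro!: exI[of _ "Neg (Disj (Atom 0) (Neg (Atom 0)))"] simp del: interp.simps)
    next
      case (Suc n)
      show ?case
      proof safe
        fix e :: real assume "e > 0"
        then obtain p q where pq: "set_dist (\<Union>i<n. A i) (?i p) < e/2" "set_dist (A n) (?i q) < e/2"
          using Suc Union(2) by (meson half_gt_zero)
        have "set_dist ((\<Union>i<n. A i) \<union> A n) (?i (Disj p q)) \<le> set_dist (\<Union>i<n. A i) (?i p) + set_dist (A n) (?i q)"
          using Aev interp_event by (auto intro!: set_dist_Un)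
        moreover have "(\<Union>i<Suc n. A i) = (\<Union>i<n. A i) \<union> A n" by (auto simp: less_Suc_eq)
        ultimately have "set_dist (\<Union>i<Suc n. A i) (?i (Disj p q)) < e" using pq by simp
        thus "\<exists>p. set_dist (\<Union>i<Suc n. A i) (?i p) < e" by blast
      qed
    qed
    show ?case
    proof safe
      fix e :: real assume e: "e > 0"
      have "(\<lambda>n. prob (\<Union>i<n. A i)) \<longlonglongrightarrow> prob (\<Union>n. \<Union>i<n. A i)"
        using Aev by (intro finite_Lim_measure_incseq) (auto simp: incseq_def, force)
      moreover have "(\<Union>n. \<Union>i<n. A i) = (\<Union>i. A i)" by auto
      ultimately have "(\<lambda>n. prob (\<Union>i<n. A i)) \<longlonglongrightarrow> prob (\<Union>i. A i)" by simp
      then obtain n where n: "norm (prob (\<Union>i<n. A i) - prob (\<Union>i. A i)) < e/2" using e LIMSEQ_D[of _ _ "e/2"] by fastforce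
      have "set_dist (\<Union>i. A i) (\<Union>i<n. A i) = prob ((\<Union>i. A i) - (\<Union>i<n. A i))"
        unfolding set_dist_def by (rule arg_cong[of _ _ prob]) auto
      also have "\<dots> = prob (\<Union>i. A i) - prob (\<Union>i<n. A i)" using Aev by (intro finite_measure_Diff) auto
      finally have 1: "set_dist (\<Union>i. A i) (\<Union>i<n. A i) < e/2" using n abs_ge_minus_self[of "prob (\<Union>i<n. A i) - prob (\<Union>i. A i)"] by simp
      obtain p where p: "set_dist (\<Union>i<n. A i) (?i p) < e/2" using fin e by (meson half_gt_zero)
      have "set_dist (\<Union>i. A i) (?i p) \<le> set_dist (\<Union>i. A i) (\<Union>i<n. A i) + set_dist (\<Union>i<n. A i) (?i p)"
        using Aev interp_event by (intro set_dist_triangle) auto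
      thus "\<exists>p. set_dist (\<Union>i. A i) (?i p) < e" using 1 p by (intro exI[of _ p]) linarith
    qed
  qed
  thus ?thesis using assms by blast
qed

fun step_map :: "(nat \<Rightarrow> 'b) \<Rightarrow> (set_formula \<times> nat) list \<Rightarrow> 'a \<Rightarrow> 'b" where
  "step_map q [] w = q 0"
| "step_map q (x # xs) w = (if w \<in> interp (space M) U (fst x) then q (snd x) else step_map q xs w)"

lemma step_map_measurable [measurable]: "step_map q xs \<in> measurable M (borel :: 'b::topological_space measure)"
proof (induction xs)
  case Nil
  show ?case by (simp cong: measurable_cong)
next
  case (Cons x xs)
  have [measurable]: "interp (space M) U (fst x) \<in> events" by (rule interp_event)
  have "(\<lambda>w. if w \<in> interp (space M) U (fst x) then q (snd x) else step_map q xs w) \<in> measurable M borel"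
    using Cons by measurable
  thus ?case by (simp cong: measurable_cong)
qed

lemma step_map_eq:
  assumes "\<And>x. x \<in> set xs \<Longrightarrow> w \<in> interp (space M) U (fst x) \<longleftrightarrow> x = y" "y \<in> set xs"
  shows "step_map q xs w = q (snd y)"
  using assms by (induction xs) auto

end

text \<open>A metric for convergence in measure.\<close>

definition map_dist :: "real \<Rightarrow> ('a \<Rightarrow> 'b::metric_space) \<Rightarrow> ('a \<Rightarrow> 'b) \<Rightarrow> real" where
  "map_dist t f g = (\<integral>w. 1 - exp (- t * dist (f w) (g w)) \<partial>M)"

context
  fixes t :: real
  assumes t: "t > 0"
begin

lemma exp_dist_bound: "norm (1 - exp (- t * dist x (y::'b::metric_space))) \<le> 1"
proof -
  have "exp (- t * dist x y) \<le> 1" "exp (- t * dist x y) \<ge> 0" using t by auto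
  thus ?thesis by simp
qed

lemma map_dist_integrable:
  fixes f g :: "'a \<Rightarrow> 'b::{metric_space, second_countable_topology}"
  assumes [measurable]: "f \<in> borel_measurable M" "g \<in> borel_measurable M"
  shows "integrable M (\<lambda>w. 1 - exp (- t * dist (f w) (g w)))"
  by (intro integrable_const_bound[where B = 1] AE_I2 exp_dist_bound) measurable

lemma exp_dist_triangle: "1 - exp (- t * dist x z) \<le> (1 - exp (- t * dist x y)) + (1 - exp (- t * dist y (z::'b::metric_space)))"
proof -
  have "t * dist x z \<le> t * dist x y + t * dist y z"
    using dist_triangle[of x z y] t by (simp add: distrib_left[symmetric])
  hence "exp (- t * dist x z) \<ge> exp (- t * dist x y + - t * dist y z)" by simp
  hence 1: "exp (- t * dist x z) \<ge> exp (- t * dist x y) * exp (- t * dist y z)" by (simp only: exp_add)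
  have "(1 - exp (- t * dist x y)) * (1 - exp (- t * dist y z)) \<ge> 0" using t by (intro mult_nonneg_nonneg) auto
  thus ?thesis using 1 by (simp add: algebra_simps)
qed

lemma map_dist_triangle:
  fixes f g h :: "'a \<Rightarrow> 'b::{metric_space, second_countable_topology}"
  assumes m: "f \<in> borel_measurable M" "g \<in> borel_measurable M" "h \<in> borel_measurable M"
  shows "map_dist t f h \<le> map_dist t f g + map_dist t g h"
proof -
  have "map_dist t f h \<le> (\<integral>w. (1 - exp (- t * dist (f w) (g w))) + (1 - exp (- t * dist (g w) (h w))) \<partial>M)"
    unfolding map_dist_def using m by (intro integral_mono Bochner_Integration.integrable_add map_dist_integrable exp_dist_triangle)
  also have "\<dots> = map_dist t f g + map_dist t g h"
    unfolding map_dist_def using m by (intro Bochner_Integration.integral_add map_dist_integrable)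
  finally show ?thesis .
qed

lemma map_dist_commute: "map_dist t f g = map_dist t g f"
  by (simp add: map_dist_def dist_commute)

lemma map_dist_approx_step:
  fixes f :: "'a \<Rightarrow> 'b::{metric_space, second_countable_topology}"
  assumes gen: "events = sigma_sets (space M) (range U)"
    and q: "\<And>x e. e > 0 \<Longrightarrow> \<exists>n. dist x (q n) < e"
    and f: "simple_function M f" and e: "e > 0"
  shows "\<exists>xs. map_dist t f (step_map U q xs) < e"
proof -
  let ?i = "interp (space M) U"
  define X where "X = f ` space M"
  have X: "finite X" "X \<noteq> {}" using f not_empty by (auto simp: X_def simple_function_def)
  define N where "N = real (card X)"
  have N: "N > 0" using X by (simp add: N_def card_gt_0_iff)
  define d where "d = e / (2 * t)"
  have d: "d > 0" using e t by (simp add: d_def)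
  have Aev: "f -` {x} \<inter> space M \<in> events" for x
    using f by (rule simple_functionD)
  have "e / (4 * N) > 0" using e N by simp
  hence "\<exists>p. set_dist (f -` {x} \<inter> space M) (?i p) < e / (4 * N)" for x
    by (rule event_approximation[OF gen Aev])
  then obtain p where p: "\<And>x. set_dist (f -` {x} \<inter> space M) (?i (p x)) < e / (4 * N)" by metis
  obtain n where n: "\<And>x. dist x (q (n x)) < d" using q[OF d] by metis
  obtain L where L: "set L = X" "distinct L" using X(1) finite_distinct_list by blast
  define xs where "xs = map (\<lambda>x. (p x, n x)) L"
  define bad where "bad = (\<Union>x\<in>X. ((f -` {x} \<inter> space M) - ?i (p x)) \<union> (?i (p x) - (f -` {x} \<inter> space M)))"
  have badev: "bad \<in> events" unfolding bad_def using X Aev interp_event[OF gen] by auto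
  have "prob bad \<le> (\<Sum>x\<in>X. set_dist (f -` {x} \<inter> space M) (?i (p x)))"
    unfolding bad_def set_dist_def using X Aev interp_event[OF gen] by (intro measure_UNION_le) auto
  also have "\<dots> \<le> (\<Sum>x\<in>X. e / (4 * N))" using p by (intro sum_mono less_imp_le)
  also have "\<dots> = e / 4" using N by (simp add: N_def)
  finally have pb: "prob bad \<le> e / 4" .
  have good: "dist (f w) (step_map U q xs w) \<le> d" if w: "w \<in> space M" "w \<notin> bad" for w
  proof -
    have fX: "f w \<in> X" using w by (simp add: X_def)
    have iff: "w \<in> ?i (p x) \<longleftrightarrow> x = f w" if "x \<in> X" for x
    proof -
      have "w \<notin> ((f -` {x} \<inter> space M) - ?i (p x)) \<union> (?i (p x) - (f -` {x} \<inter> space M))"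
        using w(2) that unfolding bad_def by blast
      thus ?thesis using w(1) by blast
    qed
    have "step_map U q xs w = q (snd (p (f w), n (f w)))"
      unfolding xs_def using fX L iff by (intro step_map_eq[OF gen]) (auto simp: iff)
    thus ?thesis using n[of "f w"] by simp
  qed
  have fm: "f \<in> borel_measurable M" using f by (rule borel_measurable_simple_function)
  have "map_dist t f (step_map U q xs) \<le> (\<integral>w. t * d + indicator bad w \<partial>M)"
    unfolding map_dist_def
  proof (rule integral_mono)
    show "integrable M (\<lambda>w. 1 - exp (- t * dist (f w) (step_map U q xs w)))"
      by (intro map_dist_integrable fm step_map_measurable[OF gen])
    show "integrable M (\<lambda>w. t * d + indicator bad w :: real)" using badev by (auto simp: emeasure_eq_measure)
    fix w assume w: "w \<in> space M"
    show "1 - exp (- t * dist (f w) (step_map U q xs w)) \<le> t * d + indicator bad w"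
    proof (cases "w \<in> bad")
      case True
      have "0 \<le> t * d" using t d by simp
      thus ?thesis using True by (simp add: add_increasing)
    next
      case False
      have "t * dist (f w) (step_map U q xs w) \<le> t * d" using good[OF w False] t by simp
      moreover have "1 + - t * dist (f w) (step_map U q xs w) \<le> exp (- t * dist (f w) (step_map U q xs w))"
        by (rule exp_ge_add_one_self)
      ultimately show ?thesis using False by simp
    qed
  qed
  also have "\<dots> = (\<integral>w. t * d \<partial>M) + (\<integral>w. indicator bad w \<partial>M)"
    using badev by (intro Bochner_Integration.integral_add) (auto simp: emeasure_eq_measure)
  also have "\<dots> = t * d + prob bad" using badev by (simp add: prob_space)
  also have "\<dots> < e" using pb e t by (simp add: d_def)
  finally show ?thesis by blast
qed

text \<open>Measurable maps are approximated by simple ones, these by maps built from finitely many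
  formulas and points of a countable dense set, of which there are countably many.\<close>

theorem map_dist_separable:
  assumes sb: "standard_borel M"
  obtains \<phi> :: "nat \<Rightarrow> 'a \<Rightarrow> 'b::{metric_space, second_countable_topology}" where "\<And>j. \<phi> j \<in> borel_measurable M"
    "\<And>f e. f \<in> borel_measurable M \<Longrightarrow> e > 0 \<Longrightarrow> \<exists>j. map_dist t f (\<phi> j) < e"
proof -
  obtain U :: "nat \<Rightarrow> 'a set" where U: "events = sigma_sets (space M) (range U)"
    by (rule standard_borel_countably_generated[OF sb]) (rule that)
  obtain D :: "'b set" where D: "countable D" "\<And>X. open X \<Longrightarrow> X \<noteq> {} \<Longrightarrow> \<exists>d\<in>D. d \<in> X"
    by (erule countable_dense_setE)
  define q where "q = from_nat_into D"
  have q: "\<exists>n. dist x (q n) < e" if e: "e > 0" for x e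
  proof -
    obtain d where d: "d \<in> D" "d \<in> ball x e" using D(2)[of "ball x e"] e by auto
    obtain n where "q n = d" using from_nat_into_surj[OF D(1) d(1)] unfolding q_def by blast
    thus ?thesis using d by auto
  qed
  define \<phi> where "\<phi> j = step_map U q (from_nat j)" for j
  show ?thesis
  proof (rule that[of \<phi>])
    show meas: "\<phi> j \<in> borel_measurable M" for j unfolding \<phi>_def by (rule step_map_measurable[OF U])
    fix f :: "'a \<Rightarrow> 'b" and e :: real assume f: "f \<in> borel_measurable M" and e: "e > 0"
    obtain F where F: "\<And>i. simple_function M (F i)" "\<And>x. x \<in> space M \<Longrightarrow> (\<lambda>i. F i x) \<longlonglongrightarrow> f x"
      using borel_measurable_implies_sequence_metric[OF f] by metis
    have Fm: "F i \<in> borel_measurable M" for i using F(1) by (rule borel_measurable_simple_function)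
    have "(\<lambda>i. map_dist t f (F i)) \<longlonglongrightarrow> (\<integral>w. 0 \<partial>M)"
      unfolding map_dist_def
    proof (rule integral_dominated_convergence[where w = "\<lambda>_. 1"])
      show "AE x in M. (\<lambda>i. 1 - exp (- t * dist (f x) (F i x))) \<longlonglongrightarrow> 0"
      proof (rule AE_I2)
        fix x assume x: "x \<in> space M"
        have "(\<lambda>i. 1 - exp (- t * dist (f x) (F i x))) \<longlonglongrightarrow> 1 - exp (- t * dist (f x) (f x))"
          by (intro tendsto_intros F(2) x)
        thus "(\<lambda>i. 1 - exp (- t * dist (f x) (F i x))) \<longlonglongrightarrow> 0" by simp
      qed
      show "AE x in M. norm (1 - exp (- t * dist (f x) (F i x))) \<le> 1" for i by (intro AE_I2 exp_dist_bound)
      show "(\<lambda>x. 1 - exp (- t * dist (f x) (F i x))) \<in> borel_measurable M" for i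
        using map_dist_integrable[OF f Fm] by (rule borel_measurable_integrable)
    qed auto
    hence "(\<lambda>i. map_dist t f (F i)) \<longlonglongrightarrow> 0" by simp
    then obtain i where "norm (map_dist t f (F i) - 0) < e / 2" using LIMSEQ_D[of _ 0 "e/2"] e by fastforce
    hence 1: "map_dist t f (F i) < e / 2" by simp
    obtain xs where 2: "map_dist t (F i) (step_map U q xs) < e / 2"
      using map_dist_approx_step[OF U q F(1), of "e/2" i] e by auto
    have "map_dist t f (step_map U q xs) \<le> map_dist t f (F i) + map_dist t (F i) (step_map U q xs)"
      by (intro map_dist_triangle f Fm step_map_measurable[OF U])
    hence "map_dist t f (\<phi> (to_nat xs)) < e" using 1 2 by (simp add: \<phi>_def)
    thus "\<exists>j. map_dist t f (\<phi> j) < e" by blast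
  qed
qed

end

end


section \<open>Isometric cocycles\<close>

locale isometric_cocycle_action = pmp_action M act
  for M :: "'w measure" and act :: "'g::{topological_group_add, t2_space, second_countable_topology} \<Rightarrow> 'w \<Rightarrow> 'w" +
  fixes \<alpha> :: "'g \<Rightarrow> 'w \<Rightarrow> 'a::{polish_space, median_space} \<Rightarrow> 'a" and m :: "'g measure"
  assumes cocycle: "isometric_cocycle M act \<alpha>"
    and haar: "right_haar m"
    and standard: "standard_borel M"
begin

lemmas haarD = right_haarD[OF haar]

lemma act_space [simp]: "w \<in> space M \<Longrightarrow> act g w \<in> space M"
  using measurable_space[OF act_measurable, of "(g, w)"] by (simp add: space_pair_measure)

lemma act_measurable_fixed [measurable]: "act g \<in> measurable M M"
  using measurable_Pair2[OF act_measurable, of g] by simp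

lemma act_measurable_comp:
  assumes "p \<in> measurable N borel" "r \<in> measurable N M"
  shows "(\<lambda>x. act (p x) (r x)) \<in> measurable N M"
  using measurable_compose[OF measurable_Pair[OF assms] act_measurable] by simp

lemma AE_act: "AE w in M. P w \<Longrightarrow> AE w in M. P (act g w)"
proof -
  assume "AE w in M. P w"
  hence "AE w in distr M M (act g). P w" by (subst act_preserving)
  thus ?thesis by (rule AE_distrD[rotated]) simp
qed

lemma integral_act: "f \<in> borel_measurable M \<Longrightarrow> (\<integral>w. f (act g w) \<partial>M) = (\<integral>w. f w \<partial>M)" for f :: "'w \<Rightarrow> real"
  using integral_distr[of "act g" M M f] act_preserving[of g] by simp

lemma act_neg [simp]: "w \<in> space M \<Longrightarrow> act (- g) (act g w) = w" "w \<in> space M \<Longrightarrow> act g (act (- g) w) = w"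
  using act_plus[of w "- g" g] act_plus[of w g "- g"] act_zero[of w] by simp_all

lemma cocycle_plus: "w \<in> space M \<Longrightarrow> \<alpha> (g + h) w x = \<alpha> g (act h w) (\<alpha> h w x)"
  using cocycle unfolding isometric_cocycle_def by (simp add: fun_eq_iff)

lemma cocycle_isometric: "w \<in> space M \<Longrightarrow> isometric_bij (\<alpha> g w)"
proof -
  assume w: "w \<in> space M"
  have "(\<lambda>(g, w). \<alpha> g w) \<in> measurable (borel \<Otimes>\<^sub>M M) isometry_borel"
    using cocycle by (simp add: isometric_cocycle_def)
  from measurable_space[OF this, of "(g, w)"] w show ?thesis
    by (simp add: space_pair_measure isometry_borel_def space_restrict_space isometries_iff)
qed

lemma cocycle_dist: "w \<in> space M \<Longrightarrow> dist (\<alpha> g w x) (\<alpha> g w y) = dist x y"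
  using cocycle_isometric by (simp add: isometric_bij_def)

lemma cocycle_inj: "w \<in> space M \<Longrightarrow> \<alpha> g w x = \<alpha> g w y \<longleftrightarrow> x = y"
  using cocycle_dist[of w g x y] by (metis dist_eq_0_iff)

lemma cocycle_measurable_point: "(\<lambda>p. \<alpha> (fst p) (snd p) x) \<in> borel_measurable (borel \<Otimes>\<^sub>M M)"
proof -
  have "(\<lambda>(g, w). \<alpha> g w) \<in> measurable (borel \<Otimes>\<^sub>M M) isometry_borel"
    using cocycle by (simp add: isometric_cocycle_def)
  moreover have "(\<lambda>f :: 'a \<Rightarrow> 'a. f x) \<in> measurable isometry_borel borel"
    unfolding isometry_borel_def
    by (intro measurable_restrict_space1 borel_measurable_continuous_onI continuous_on_product_coordinates)
  ultimately have "(\<lambda>p. (case p of (g, w) \<Rightarrow> \<alpha> g w) x) \<in> borel_measurable (borel \<Otimes>\<^sub>M M)"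
    by (rule measurable_compose)
  thus ?thesis by (simp add: split_beta)
qed

text \<open>For simple \<open>f\<close> this is a countable case distinction; the general case is a limit because the
  values of the cocycle are isometries.\<close>

lemma cocycle_measurable_comp:
  assumes p: "p \<in> measurable N borel" and r: "r \<in> measurable N M" and f: "f \<in> borel_measurable N"
  shows "(\<lambda>x. \<alpha> (p x) (r x) (f x)) \<in> borel_measurable N"
proof -
  have pt: "(\<lambda>x. \<alpha> (p x) (r x) y) \<in> borel_measurable N" for y
    using measurable_compose[OF measurable_Pair[OF p r] cocycle_measurable_point] by simp
  obtain F where F: "\<And>i. simple_function N (F i)" "\<And>x. x \<in> space N \<Longrightarrow> (\<lambda>i. F i x) \<longlonglongrightarrow> f x"
    using borel_measurable_implies_sequence_metric[OF f] by metis
  show ?thesis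
  proof (rule borel_measurable_LIMSEQ_metric)
    fix i
    show "(\<lambda>x. \<alpha> (p x) (r x) (F i x)) \<in> borel_measurable N"
    proof (rule measurable_compose_countable'[where f = "\<lambda>y x. \<alpha> (p x) (r x) y" and I = "F i ` space N"])
      show "F i \<in> measurable N (count_space (F i ` space N))"
        using F(1)[of i] by (simp add: simple_function_def measurable_count_space_eq2) 
      show "countable (F i ` space N)" using F(1)[of i] by (simp add: simple_function_def countable_finite)
    qed (rule pt)
  next
    fix x assume x: "x \<in> space N"
    hence "r x \<in> space M" using measurable_space[OF r] by blast
    hence "(\<lambda>i. dist (\<alpha> (p x) (r x) (F i x)) (\<alpha> (p x) (r x) (f x))) \<longlonglongrightarrow> 0"
      using tendsto_dist_iff[THEN iffD1, OF F(2)[OF x]] by (simp add: cocycle_dist)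
    thus "(\<lambda>i. \<alpha> (p x) (r x) (F i x)) \<longlonglongrightarrow> \<alpha> (p x) (r x) (f x)" by (rule tendsto_dist_iff[THEN iffD2])
  qed
qed

text \<open>The group acts on maps from the probability space by moving argument and value at once;
  \<open>F g\<close> below is the image under \<open>g\<close> of the constant map \<open>base\<close>.\<close>

definition base :: 'a where
  "base = (SOME x. True)"

definition F :: "'g \<Rightarrow> 'w \<Rightarrow> 'a" where
  "F g w = \<alpha> g (act (- g) w) base"

lemma F_measurable_pair: "(\<lambda>p. F (fst p) (snd p)) \<in> borel_measurable (borel \<Otimes>\<^sub>M M)"
proof -
  have "uminus \<in> measurable (borel :: 'g measure) borel"
    by (intro borel_measurable_continuous_onI continuous_intros)
  from measurable_compose[OF measurable_fst this]
  have "(\<lambda>p :: 'g \<times> 'w. - fst p) \<in> measurable (borel \<Otimes>\<^sub>M M) borel" .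
  thus ?thesis unfolding F_def by (intro cocycle_measurable_comp act_measurable_comp) auto
qed

lemma F_measurable [measurable]: "F g \<in> borel_measurable M"
  using measurable_Pair2[OF F_measurable_pair, of g] by simp

lemma F_equivariant: "w \<in> space M \<Longrightarrow> F (k + g) (act k w) = \<alpha> k w (F g w)"
proof -
  assume w: "w \<in> space M"
  have "act (- (k + g)) (act k w) = act (- g) w"
    using act_plus[OF w, of "- (k + g)" k] by (simp add: minus_add add.assoc)
  thus ?thesis
    using cocycle_plus[of "act (- g) w" k g base] w by (simp add: F_def)
qed

definition psi :: "real \<Rightarrow> 'g \<Rightarrow> 'g \<Rightarrow> real" where
  "psi t g h = (\<integral>w. exp (- t * dist (F g w) (F h w)) \<partial>M)"

context
  fixes t :: real
  assumes t: "t > 0"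
begin

lemma psi_integrable: "integrable M (\<lambda>w. exp (- t * dist (F g w) (F h w)))"
  using t by (intro integrable_const_bound[where B = 1] AE_I2) auto

lemma psi_map_dist: "psi t g h = 1 - map_dist t (F g) (F h)"
  unfolding map_dist_def psi_def using psi_integrable[of g h]
  by (subst Bochner_Integration.integral_diff) (auto simp: prob_space)

lemma psi_self [simp]: "psi t g g = 1"
  by (simp add: psi_def prob_space)

lemma psi_translate: "psi t (k + g) (k + h) = psi t g h"
proof -
  let ?f = "\<lambda>w. exp (- t * dist (F (k + g) w) (F (k + h) w))"
  have "psi t (k + g) (k + h) = (\<integral>w. ?f (act k w) \<partial>M)"
    unfolding psi_def by (intro integral_act[symmetric]) measurable
  also have "\<dots> = psi t g h"
    unfolding psi_def by (intro Bochner_Integration.integral_cong) (auto simp: F_equivariant cocycle_dist)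
  finally show ?thesis .
qed

lemma map_dist_measurable:
  assumes [measurable]: "\<phi> \<in> borel_measurable M"
  shows "(\<lambda>g. map_dist t (F g) \<phi>) \<in> borel_measurable borel"
proof -
  have [measurable]: "(\<lambda>p. F (fst p) (snd p)) \<in> borel_measurable (borel \<Otimes>\<^sub>M M)" by (rule F_measurable_pair)
  have "(\<lambda>p. 1 - exp (- t * dist (F (fst p) (snd p)) (\<phi> (snd p)))) \<in> borel_measurable (borel \<Otimes>\<^sub>M M)" by measurable
  thus ?thesis unfolding map_dist_def
    by (intro borel_measurable_lebesgue_integral) (simp add: split_beta')
qed

text \<open>By separability countably many balls cover the orbit of the constant section, so one of them
  is visited by a set of positive Haar measure, whose differences contain a neighbourhood of zero.\<close>

lemma psi_continuous_at_zero:
  assumes e: "e > 0"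
  obtains W where "open W" "0 \<in> W" "\<And>w. w \<in> W \<Longrightarrow> map_dist t (F 0) (F w) < e"
proof -
  obtain \<phi> :: "nat \<Rightarrow> 'w \<Rightarrow> 'a" where \<phi>: "\<And>j. \<phi> j \<in> borel_measurable M"
    "\<And>f e. f \<in> borel_measurable M \<Longrightarrow> e > 0 \<Longrightarrow> \<exists>j. map_dist t f (\<phi> j) < e"
    by (rule map_dist_separable[OF t standard]) (rule that)
  define S where "S j = {g. map_dist t (F g) (\<phi> j) < e / 2}" for j
  have Sb: "S j \<in> sets borel" for j
    unfolding S_def using map_dist_measurable[OF \<phi>(1)[of j]] by measurable
  have cover: "(\<Union>j. S j) = UNIV" using \<phi>(2)[OF F_measurable, of "e/2"] e by (auto simp: S_def)
  have "\<exists>j. emeasure m (S j) \<noteq> 0"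
  proof (rule ccontr)
    assume "\<not> ?thesis"
    hence "S j \<in> null_sets m" for j using Sb haarD(1) by (auto simp: null_sets_def)
    hence "(\<Union>j. S j) \<in> null_sets m" by (intro null_sets_UN) auto
    thus False using cover haarD(3) by auto
  qed
  then obtain j where "emeasure m (S j) \<noteq> 0" by blast
  then obtain W where W: "open W" "0 \<in> W" "\<And>w. w \<in> W \<Longrightarrow> \<exists>s\<in>S j. s + w \<in> S j"
    using steinhaus[OF haar Sb[of j]] by blast
  have "map_dist t (F 0) (F w) < e" if w: "w \<in> W" for w
  proof -
    obtain s where s: "s \<in> S j" "s + w \<in> S j" using W(3)[OF w] by blast
    have "map_dist t (F 0) (F w) = map_dist t (F s) (F (s + w))"
      using psi_translate[of s 0 w] psi_map_dist[of s "s + w"] psi_map_dist[of 0 w] by simp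
    also have "\<dots> \<le> map_dist t (F s) (\<phi> j) + map_dist t (\<phi> j) (F (s + w))"
      using \<phi>(1) by (intro map_dist_triangle t) auto
    also have "map_dist t (\<phi> j) (F (s + w)) = map_dist t (F (s + w)) (\<phi> j)" by (rule map_dist_commute[OF t])
    finally show ?thesis using s by (simp add: S_def)
  qed
  thus ?thesis using that W by blast
qed

lemma psi_continuous: "continuous_on UNIV (psi t 0)"
  unfolding continuous_on_topological
proof (intro ballI allI impI)
  fix g B assume B: "open B" "psi t 0 g \<in> B"
  then obtain e where e: "e > 0" "ball (psi t 0 g) e \<subseteq> B" using open_contains_ball by blast
  obtain W where W: "open W" "0 \<in> W" "\<And>w. w \<in> W \<Longrightarrow> map_dist t (F 0) (F w) < e"
    using psi_continuous_at_zero[OF e(1)] by blast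
  have "psi t 0 h \<in> B" if h: "- g + h \<in> W" for h
  proof -
    have gh: "map_dist t (F g) (F h) < e"
      using W(3)[OF h] psi_translate[of g 0 "- g + h"] psi_map_dist[of g h] psi_map_dist[of 0 "- g + h"]
      by (simp add: add.assoc[symmetric])
    have "map_dist t (F 0) (F h) \<le> map_dist t (F 0) (F g) + map_dist t (F g) (F h)"
      "map_dist t (F 0) (F g) \<le> map_dist t (F 0) (F h) + map_dist t (F h) (F g)"
      by (intro map_dist_triangle t F_measurable)+
    hence "\<bar>psi t 0 g - psi t 0 h\<bar> < e" using gh map_dist_commute[OF t, of "F g" "F h"] by (simp add: psi_map_dist)
    thus ?thesis using e(2) by (auto simp: dist_real_def)
  qed
  moreover have "open ((\<lambda>h. - g + h) -` W)" by (intro open_vimage W continuous_intros)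
  ultimately show "\<exists>A. open A \<and> g \<in> A \<and> (\<forall>y\<in>UNIV. y \<in> A \<longrightarrow> psi t 0 y \<in> B)"
    using W by (intro exI[of _ "(\<lambda>h. - g + h) -` W"]) auto
qed

lemma psi_invariant_kernel: "invariant_kernel (psi t)"
proof
  show "psi t x y = psi t y x" for x y by (simp add: psi_def dist_commute)
  show "psi t (k + x) (k + y) = psi t x y" for k x y by (rule psi_translate)
  show "continuous_on UNIV (psi t 0)" by (rule psi_continuous)
  fix S :: "'g set" and c :: "'g \<Rightarrow> real"  assume S: "finite S"
  have "(\<Sum>x\<in>S. \<Sum>y\<in>S. c x * c y * psi t x y)
      = (\<integral>w. (\<Sum>x\<in>S. \<Sum>y\<in>S. c x * c y * exp (- t * dist (F x w) (F y w))) \<partial>M)"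
    unfolding psi_def using psi_integrable by (simp add: Bochner_Integration.integral_sum)
  also have "\<dots> \<ge> 0" using S t by (intro integral_nonneg_AE AE_I2 exp_dist_positive_definite) auto
  finally show "0 \<le> (\<Sum>x\<in>S. \<Sum>y\<in>S. c x * c y * psi t x y)" .
qed

end

text \<open>As the parameter decreases to zero, the continuous kernels increase pointwise to one, by dominated
  convergence; compactness makes this uniform, as in Dini's theorem.\<close>

lemma psi_near_one:
  assumes Q: "compact Q" and e: "e > 0"
  obtains t where "t > 0" "\<And>g. g \<in> Q \<Longrightarrow> psi t 0 g > 1 - e"
proof -
  have mono: "psi t' 0 g \<ge> psi t 0 g" if "0 < t'" "t' \<le> t" for t t' g
    unfolding psi_def using that by (intro integral_mono psi_integrable) (auto intro: mult_right_mono)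
  have pt: "\<exists>t>0. psi t 0 g > 1 - e" for g
  proof -
    have "(\<lambda>n. psi (inverse (real (Suc n))) 0 g) \<longlonglongrightarrow> (\<integral>w. 1 \<partial>M)"
      unfolding psi_def
    proof (rule integral_dominated_convergence[where w = "\<lambda>_. 1"])
      show "AE w in M. (\<lambda>n. exp (- inverse (real (Suc n)) * dist (F 0 w) (F g w))) \<longlonglongrightarrow> 1"
      proof (rule AE_I2)
        fix w
        have "(\<lambda>n. exp (- inverse (real (Suc n)) * dist (F 0 w) (F g w))) \<longlonglongrightarrow> exp (- 0 * dist (F 0 w) (F g w))"
          by (intro tendsto_intros LIMSEQ_inverse_real_of_nat)
        thus "(\<lambda>n. exp (- inverse (real (Suc n)) * dist (F 0 w) (F g w))) \<longlonglongrightarrow> 1" by simp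
      qed
    qed auto
    hence "(\<lambda>n. psi (inverse (real (Suc n))) 0 g) \<longlonglongrightarrow> 1" by (simp add: prob_space)
    from order_tendstoD(1)[OF this, of "1 - e"] e
    obtain n where "psi (inverse (real (Suc n))) 0 g > 1 - e" by (auto simp: eventually_sequentially)
    thus ?thesis by (intro exI[of _ "inverse (real (Suc n))"]) simp
  qed
  then obtain T where T: "\<And>g. T g > 0" "\<And>g. psi (T g) 0 g > 1 - e" by metis
  define A where "A g = {h. psi (T g) 0 h > 1 - e}" for g
  have Aopen: "open (A g)" for g
  proof -
    have "open (psi (T g) 0 -` {1 - e<..})" using psi_continuous[OF T(1)] by (intro open_vimage) auto
    moreover have "psi (T g) 0 -` {1 - e<..} = A g" by (auto simp: A_def)
    ultimately show ?thesis by simp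
  qed
  have "Q \<subseteq> (\<Union>g\<in>Q. A g)" using T(2) by (auto simp: A_def)
  then obtain D where D: "D \<subseteq> Q" "finite D" "Q \<subseteq> (\<Union>g\<in>D. A g)" using compactE_image[OF Q, of Q A] Aopen by metis
  define t where "t = Min (insert 1 (T ` D))"
  have t: "t > 0" "\<And>g. g \<in> D \<Longrightarrow> t \<le> T g" using D(2) T(1) by (auto simp: t_def)
  have "psi t 0 h > 1 - e" if h: "h \<in> Q" for h
  proof -
    obtain g where g: "g \<in> D" "psi (T g) 0 h > 1 - e" using h D(3) by (auto simp: A_def)
    thus ?thesis using mono[OF t(1) t(2)[OF g(1)], of h] by simp
  qed
  thus ?thesis using that t by blast
qed

end


section \<open>Finite combinations of exponential bumps\<close>

definition bumps :: "real \<Rightarrow> ('g \<Rightarrow> complex) \<Rightarrow> ('g \<Rightarrow> 'a::metric_space) \<Rightarrow> 'a \<Rightarrow> complex" where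
  "bumps t a P x = (\<Sum>g\<in>fsupp a. a g * of_real (exp (- t * dist (P g) x)))"

definition bump_form :: "real \<Rightarrow> ('g \<Rightarrow> complex) \<Rightarrow> ('g \<Rightarrow> 'a::metric_space) \<Rightarrow> real" where
  "bump_form t a P = (\<Sum>g\<in>fsupp a. \<Sum>h\<in>fsupp a. Re (a g * cnj (a h)) * exp (- t * dist (P g) (P h)))"

text \<open>The Cauchy--Schwarz inequality in the space of the kernel on the points \<open>P g\<close> and \<open>x\<close>.\<close>

lemma bumps_bound:
  fixes P :: "'g \<Rightarrow> 'a::median_space"
  assumes t: "t > 0" and a: "finite (fsupp a)"
  shows "cmod (bumps t a P x) \<le> sqrt (bump_form t a P)"
proof -
  define P' where "P' = case_option x P"
  define K where "K p q = exp (- t * dist (P' p) (P' q))" for p q :: "'g option"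
  interpret positive_kernel K
    by standard (use t in \<open>auto simp: K_def dist_commute intro!: exp_dist_positive_definite[of _ t _ P', simplified]\<close>)
  define a' where "a' = case_option 0 a"
  have s: "fsupp a' = Some ` fsupp a"
  proof -
    have "p \<in> Some ` fsupp a" if "a' p \<noteq> 0" for p using that by (cases p) (auto simp: a'_def fsupp_def)
    thus ?thesis by (auto simp: fsupp_def a'_def)
  qed
  have d: "fsupp (dirac None) = {None :: 'g option}" by (auto simp: fsupp_def dirac_def)
  have V: "a' \<in> V" using a s by (simp add: V_def)
  have inj: "inj_on Some A" for A :: "'g set" by simp
  have 1: "bil a' (dirac None) = bumps t a P x"
    unfolding bil_def s d sum.reindex[OF inj] by (simp add: bumps_def a'_def dirac_def K_def P'_def)
  have 2: "Re (bil a' a') = bump_form t a P"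
    unfolding bil_def s sum.reindex[OF inj] by (simp add: bump_form_def a'_def K_def P'_def)
  have 3: "nrm (dirac None) = 1" by (simp add: nrm_def bil_def d) (simp add: dirac_def K_def)
  show ?thesis using cauchy_schwarz[OF V V_closed(2)[of None]] 1 2 3 by (simp add: nrm_def[of a'])
qed

lemma bump_form_nonneg:
  fixes P :: "'g \<Rightarrow> 'a::median_space"
  assumes t: "t > 0" and a: "finite (fsupp a)"
  shows "bump_form t a P \<ge> 0"
proof -
  fix x :: 'a
  have "0 \<le> sqrt (bump_form t a P)" using bumps_bound[OF assms, of P x] norm_ge_zero order_trans by blast
  thus ?thesis by simp
qed

lemma bumps_diff:
  assumes a: "finite (fsupp a)" and b: "finite (fsupp b)"
  shows "bumps t (fdiff a b) P x = bumps t a P x - bumps t b P x"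
proof -
  let ?S = "fsupp a \<union> fsupp b"
  have "bumps t c P x = (\<Sum>g\<in>?S. c g * of_real (exp (- t * dist (P g) x)))" if "fsupp c \<subseteq> ?S" for c
    unfolding bumps_def using a b that by (intro sum.mono_neutral_left) (auto simp: fsupp_def)
  moreover have "fsupp (fdiff a b) \<subseteq> ?S" by (auto simp: fsupp_def fadd_def fscale_def)
  ultimately show ?thesis
    by (simp add: sum_subtractf[symmetric] fadd_def fscale_def algebra_simps)
qed

lemma exp_decay_lipschitz: "\<bar>exp (- t * r) - exp (- t * s)\<bar> \<le> t * \<bar>r - s\<bar>" if "t > 0" "r \<ge> 0" "s \<ge> 0" for t r s :: real
proof -
  have *: "exp (- t * p) - exp (- t * q) \<le> t * (q - p)" if "0 \<le> p" "p \<le> q" for p q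
  proof -
    have "exp (- t * p) - exp (- t * q) = exp (- t * p) * (1 - exp (- t * (q - p)))"
      by (simp add: algebra_simps exp_add[symmetric])
    also have "\<dots> \<le> 1 * (t * (q - p))"
    proof (rule mult_mono)
      show "1 - exp (- t * (q - p)) \<le> t * (q - p)" using exp_ge_add_one_self[of "- t * (q - p)"] by simp
    qed (use that \<open>t > 0\<close> in auto)
    finally show ?thesis by simp
  qed
  have mono: "exp (- t * q) \<le> exp (- t * p)" if "p \<le> q" for p q using that \<open>t > 0\<close> by simp
  show ?thesis
  proof (cases "r \<le> s")
    case True
    thus ?thesis using *[of r s] mono[of r s] that by simp
  next
    case False
    thus ?thesis using *[of s r] mono[of s r] that by simp
  qed
qed

lemma bumps_perturb:
  assumes t: "t > 0"
  shows "cmod (bumps t a P x - bumps t a P' x') \<le> (\<Sum>g\<in>fsupp a. cmod (a g) * (t * (dist (P g) (P' g) + dist x x')))"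
proof -
  have "bumps t a P x - bumps t a P' x'
      = (\<Sum>g\<in>fsupp a. a g * of_real (exp (- t * dist (P g) x) - exp (- t * dist (P' g) x')))"
    by (simp add: bumps_def sum_subtractf[symmetric] algebra_simps)
  also have "cmod \<dots> \<le> (\<Sum>g\<in>fsupp a. cmod (a g) * \<bar>exp (- t * dist (P g) x) - exp (- t * dist (P' g) x')\<bar>)"
    by (rule order.trans[OF norm_sum]) (simp add: norm_mult del: of_real_diff)
  also have "\<dots> \<le> (\<Sum>g\<in>fsupp a. cmod (a g) * (t * (dist (P g) (P' g) + dist x x')))"
  proof (intro sum_mono mult_left_mono)
    fix g
    have "\<bar>exp (- t * dist (P g) x) - exp (- t * dist (P' g) x')\<bar> \<le> t * \<bar>dist (P g) x - dist (P' g) x'\<bar>"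
      by (rule exp_decay_lipschitz) (use t in auto)
    also have "\<dots> \<le> t * (dist (P g) (P' g) + dist x x')"
    proof (rule mult_left_mono)
      have "dist (P g) x \<le> dist (P g) (P' g) + dist (P' g) x' + dist x' x" 
        "dist (P' g) x' \<le> dist (P' g) (P g) + dist (P g) x + dist x x'"
        by (metis add.assoc add_left_mono dist_triangle order_trans)+
      thus "\<bar>dist (P g) x - dist (P' g) x'\<bar> \<le> dist (P g) (P' g) + dist x x'" by (simp add: dist_commute)
    qed (use t in simp)
    finally show "\<bar>exp (- t * dist (P g) x) - exp (- t * dist (P' g) x')\<bar> \<le> t * (dist (P g) (P' g) + dist x x')" .
  qed simp
  finally show ?thesis .
qed

lemma bumps_continuous:
  assumes t: "t > 0"
  shows "continuous_on UNIV (bumps t a P)"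
  unfolding bumps_def by (intro continuous_intros)

text \<open>The zero function is admitted, so that the class is closed under uniform limits.\<close>

definition vanishing :: "('a::metric_space \<Rightarrow> real) \<Rightarrow> bool" where
  "vanishing u \<longleftrightarrow> (\<forall>x. 0 \<le> u x) \<and> bdd_above (range u) \<and> (\<forall>e>0. bounded {x. u x \<ge> e})"

lemma profile_iff_vanishing: "profile u \<longleftrightarrow> vanishing u \<and> (\<exists>x. u x > 0)"
  by (auto simp: profile_def vanishing_def)

lemma vanishing_bumps:
  fixes P :: "'g \<Rightarrow> 'a::metric_space"
  assumes t: "t > 0" and a: "finite (fsupp a)"
  shows "vanishing (\<lambda>x. cmod (bumps t a P x))"
  unfolding vanishing_def
proof (intro conjI allI impI)
  have b: "cmod (bumps t a P x) \<le> (\<Sum>g\<in>fsupp a. cmod (a g) * exp (- t * dist (P g) x))" for x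
    unfolding bumps_def by (rule order.trans[OF norm_sum]) (simp add: norm_mult)
  have "cmod (bumps t a P x) \<le> (\<Sum>g\<in>fsupp a. cmod (a g))" for x
    using t by (intro order.trans[OF b] sum_mono mult_right_le_one_le) auto
  thus "bdd_above (range (\<lambda>x. cmod (bumps t a P x)))" by (auto simp: bdd_above_def)
  fix e :: real assume e: "e > 0"
  fix x0 :: 'a
  define R where "R = (\<Sum>g\<in>fsupp a. dist (P g) x0)"
  define A where "A = (\<Sum>g\<in>fsupp a. cmod (a g)) + 1"
  have A: "A > 0" unfolding A_def by (intro add_nonneg_pos sum_nonneg) auto
  have "dist x0 x \<le> R + \<bar>ln (e / A) / t\<bar>" if x: "x \<in> {x. cmod (bumps t a P x) \<ge> e}" for x
  proof (rule ccontr)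
    assume far: "\<not> ?thesis"
    have "exp (- t * dist (P g) x) \<le> e / A" if g: "g \<in> fsupp a" for g
    proof -
      have "dist (P g) x0 \<le> R" unfolding R_def using a g by (intro member_le_sum) auto
      hence "dist (P g) x \<ge> \<bar>ln (e / A) / t\<bar>" using far dist_triangle[of x0 x "P g"] by (simp add: dist_commute)
      hence "dist (P g) x \<ge> - (ln (e / A) / t)" using abs_ge_minus_self[of "ln (e / A) / t"] by linarith
      hence "t * dist (P g) x \<ge> t * - (ln (e / A) / t)" using t by (intro mult_left_mono) auto
      hence "- t * dist (P g) x \<le> ln (e / A)" using t by simp
      hence "exp (- t * dist (P g) x) \<le> exp (ln (e / A))" by (simp only: exp_le_cancel_iff)
      thus ?thesis using e A by simp
    qed
    hence "cmod (bumps t a P x) \<le> (\<Sum>g\<in>fsupp a. cmod (a g) * (e / A))"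
      by (intro order.trans[OF b] sum_mono mult_left_mono) auto
    also have "\<dots> = (A - 1) * (e / A)" by (simp only: A_def sum_distrib_right[symmetric] add_diff_cancel_right')
    also have "\<dots> < e" using A e by (simp add: field_simps)
    finally show False using x by simp
  qed
  thus "bounded {x. cmod (bumps t a P x) \<ge> e}" unfolding bounded_def by blast
qed auto

lemma vanishing_uniform_limit:
  assumes v: "\<And>n::nat. vanishing (v n)" and u: "\<And>x. 0 \<le> u x"
    and lim: "\<And>e. e > 0 \<Longrightarrow> \<forall>\<^sub>F n in sequentially. \<forall>x. \<bar>u x - v n x\<bar> \<le> e"
  shows "vanishing u"
  unfolding vanishing_def
proof (intro conjI allI impI u)
  have ex: "\<exists>n. \<forall>x. \<bar>u x - v n x\<bar> \<le> e" if "e > 0" for e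
    using lim[OF that] by (auto simp: eventually_sequentially)
  obtain n where n: "\<And>x. \<bar>u x - v n x\<bar> \<le> 1" using ex[of 1] by auto
  obtain B where "\<And>x. v n x \<le> B" using v[of n] by (auto simp: vanishing_def bdd_above_def)
  hence "u x \<le> B + 1" for x using n[of x] by (smt (verit))
  thus "bdd_above (range u)" by (auto simp: bdd_above_def)
  fix e :: real assume e: "e > 0"
  obtain n where n: "\<And>x. \<bar>u x - v n x\<bar> \<le> e / 2" using ex[of "e/2"] e by auto
  have "{x. u x \<ge> e} \<subseteq> {x. v n x \<ge> e / 2}"
  proof safe
    fix x assume "u x \<ge> e"
    thus "v n x \<ge> e / 2" using n[of x] abs_ge_self[of "u x - v n x"] by linarith
  qed
  moreover have "bounded {x. v n x \<ge> e / 2}" using v[of n] e unfolding vanishing_def by (meson half_gt_zero)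
  ultimately show "bounded {x. u x \<ge> e}" using bounded_subset by blast
qed

definition centre_or :: "'a \<Rightarrow> ('a::metric_space \<Rightarrow> real) \<Rightarrow> 'a" where
  "centre_or b u = (if \<exists>x. u x > 0 then centre u else b)"

lemma centre_or_tendsto:
  fixes u :: "'a::{polish_space, median_space} \<Rightarrow> real"
  assumes fr: "finite_rank TYPE('a)" and conn: "connected (UNIV :: 'a set)" and u: "profile u"
    and v: "\<And>n::nat. vanishing (v n)"
    and lim: "\<And>e. e > 0 \<Longrightarrow> \<forall>\<^sub>F n in sequentially. \<forall>x. \<bar>u x - v n x\<bar> \<le> e"
  shows "(\<lambda>n. centre_or b (v n)) \<longlonglongrightarrow> centre_or b u"
proof -
  obtain x0 where x0: "u x0 > 0" using u by (auto simp: profile_def)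
  have ev: "\<forall>\<^sub>F n in sequentially. profile (v n)"
  proof (rule eventually_mono)
    show "\<forall>\<^sub>F n in sequentially. \<forall>x. \<bar>u x - v n x\<bar> \<le> u x0 / 2" using lim[of "u x0 / 2"] x0 by simp
    fix n assume "\<forall>x. \<bar>u x - v n x\<bar> \<le> u x0 / 2"
    hence "\<bar>u x0 - v n x0\<bar> \<le> u x0 / 2" by blast
    hence "v n x0 > 0" using x0 abs_ge_self[of "u x0 - v n x0"] by linarith
    thus "profile (v n)" using v by (auto simp: profile_iff_vanishing)
  qed
  define v' where "v' n = (if profile (v n) then v n else u)" for n
  have "(\<lambda>n. centre (v' n)) \<longlonglongrightarrow> centre u"
  proof (rule centre_continuous[OF fr conn u])
    show "profile (v' n)" for n using u by (simp add: v'_def)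
    fix e :: real assume e: "e > 0"
    show "\<forall>\<^sub>F n in sequentially. \<forall>x. \<bar>u x - v' n x\<bar> \<le> e"
      using lim[OF e] by eventually_elim (use e in \<open>auto simp: v'_def\<close>)
  qed
  moreover have "\<forall>\<^sub>F n in sequentially. centre (v' n) = centre_or b (v n)"
    using ev by eventually_elim (auto simp: v'_def centre_or_def profile_def)
  ultimately have "(\<lambda>n. centre_or b (v n)) \<longlonglongrightarrow> centre u" by (rule Lim_transform_eventually)
  thus ?thesis using x0 by (auto simp: centre_or_def)
qed


section \<open>Almost invariant fields\<close>

context isometric_cocycle_action
begin

definition orbit :: "'w \<Rightarrow> 'g \<Rightarrow> 'a" where
  "orbit w = (\<lambda>g. F g w)"

definition bump_norm :: "real \<Rightarrow> ('g \<Rightarrow> complex) \<Rightarrow> 'w \<Rightarrow> real" where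
  "bump_norm t a w = sqrt (bump_form t a (orbit w))"

lemma bump_form_measurable [measurable]: "(\<lambda>w. bump_form t a (orbit w)) \<in> borel_measurable M"
  unfolding bump_form_def orbit_def by measurable

lemma bump_norm_measurable [measurable]: "bump_norm t a \<in> borel_measurable M"
  unfolding bump_norm_def by measurable

lemma bump_norm_nonneg: "t > 0 \<Longrightarrow> finite (fsupp a) \<Longrightarrow> bump_norm t a w \<ge> 0"
  unfolding bump_norm_def using bump_form_nonneg[of t a "orbit w"] by simp

lemma bump_form_integral:
  assumes t: "t > 0"
  shows "integrable M (\<lambda>w. bump_form t a (orbit w))"
    "(\<integral>w. bump_form t a (orbit w) \<partial>M) = Re (\<Sum>g\<in>fsupp a. \<Sum>h\<in>fsupp a. a g * cnj (a h) * of_real (psi t g h))"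
proof -
  show "integrable M (\<lambda>w. bump_form t a (orbit w))"
    unfolding bump_form_def orbit_def
    by (intro Bochner_Integration.integrable_sum integrable_mult_right psi_integrable t)
  show "(\<integral>w. bump_form t a (orbit w) \<partial>M) = Re (\<Sum>g\<in>fsupp a. \<Sum>h\<in>fsupp a. a g * cnj (a h) * of_real (psi t g h))"
    unfolding bump_form_def orbit_def
    using psi_integrable[OF t] by (simp add: Bochner_Integration.integral_sum psi_def)
qed

text \<open>The mean of a square root is at most the square root of the mean.\<close>

lemma bump_norm_integral:
  assumes t: "t > 0" and a: "finite (fsupp a)"
  shows "integrable M (bump_norm t a)"
    "(\<integral>w. bump_norm t a w \<partial>M) \<le> sqrt (\<integral>w. bump_form t a (orbit w) \<partial>M)"
proof -
  note nn = bump_form_nonneg[OF t a]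
  have sq: "(bump_norm t a w)\<^sup>2 = bump_form t a (orbit w)" for w using nn by (simp add: bump_norm_def)
  show int: "integrable M (bump_norm t a)"
  proof (rule Bochner_Integration.integrable_bound)
    show "integrable M (\<lambda>w. 1 + bump_form t a (orbit w))"
      by (intro Bochner_Integration.integrable_add bump_form_integral t) simp
    have "bump_norm t a w \<le> 1 + bump_form t a (orbit w)" for w
    proof -
      have "0 \<le> (bump_norm t a w - 1)\<^sup>2" by simp
      hence "2 * bump_norm t a w \<le> 1 + bump_form t a (orbit w)" unfolding power2_diff sq by simp
      thus ?thesis using bump_norm_nonneg[OF t a, of w] by linarith
    qed
    thus "AE w in M. norm (bump_norm t a w) \<le> norm (1 + bump_form t a (orbit w))"
      using bump_norm_nonneg[OF t a] by (intro AE_I2) (auto intro: order.trans[OF _ abs_ge_self])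
  qed simp
  let ?c = "\<integral>w. bump_norm t a w \<partial>M"
  have "0 \<le> (\<integral>w. (bump_norm t a w - ?c)\<^sup>2 \<partial>M)" by (intro integral_nonneg_AE) auto
  also have "\<dots> = (\<integral>w. bump_form t a (orbit w) - 2 * ?c * bump_norm t a w + ?c\<^sup>2 \<partial>M)"
    by (intro Bochner_Integration.integral_cong) (auto simp: power2_diff sq)
  also have "\<dots> = (\<integral>w. bump_form t a (orbit w) \<partial>M) - 2 * ?c * ?c + ?c\<^sup>2"
    using int bump_form_integral(1)[OF t] by (simp add: prob_space)
  finally have "?c\<^sup>2 \<le> (\<integral>w. bump_form t a (orbit w) \<partial>M)" by (simp add: power2_eq_square)
  thus "?c \<le> sqrt (\<integral>w. bump_form t a (orbit w) \<partial>M)" by (rule real_le_rsqrt)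
qed

lemma bumps_measurable:
  assumes [measurable]: "x \<in> borel_measurable M"
  shows "(\<lambda>w. bumps t a (orbit w) (x w)) \<in> borel_measurable M"
  unfolding bumps_def orbit_def by measurable

lemma bumps_integrable:
  assumes t: "t > 0" and x [measurable]: "x \<in> borel_measurable M"
  shows "integrable M (\<lambda>w. of_real (exp (- t * dist (F g w) (x w))) :: complex)"
  by (intro integrable_const_bound[where B = 1] AE_I2) (use t in auto)

text \<open>Property (T) gives a nonzero translation invariant, hence constant, function in the Hilbert
  space of the kernel; it is approximated by finite combinations, here along a fast subsequence.\<close>

theorem property_T_invariant_bumps:
  assumes T: "property_T TYPE('g)"
  obtains t v c where "t > 0" "v \<noteq> 0" "\<And>n. finite (fsupp (c n))"
    "\<And>n. (\<integral>w. bump_norm t (fdiff (c (Suc n)) (c n)) w \<partial>M) \<le> (1/2)^n"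
    "\<And>k. (\<lambda>n. \<integral>w. bump_norm t (fdiff (translate k (c n)) (c n)) w \<partial>M) \<longlonglongrightarrow> 0"
    "(\<lambda>n. \<integral>w. bumps t (c n) (orbit w) (F 0 w) \<partial>M) \<longlonglongrightarrow> v"
proof -
  obtain Q \<epsilon> where Q: "compact (Q :: 'g set)" "\<epsilon> > 0"
    and T': "\<And>(H :: ('g \<Rightarrow> complex) set) zero add scale ip (\<pi> :: 'g \<Rightarrow> _).
           unitary_representation H zero add scale ip \<pi> \<Longrightarrow>
           (\<exists>v. unitary_representation.almost_invariant H zero add scale ip \<pi> Q \<epsilon> v) \<Longrightarrow>
           unitary_representation.has_invariant_vector H zero \<pi>"
    using T unfolding property_T_def by blast
  have "\<epsilon>\<^sup>2 / 2 > 0" using Q by simp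
  then obtain t where t: "t > 0" "\<And>g. g \<in> Q \<Longrightarrow> psi t 0 g > 1 - \<epsilon>\<^sup>2 / 2" using psi_near_one[OF Q(1)] by metis
  interpret K: invariant_kernel "psi t" by (rule psi_invariant_kernel[OF t(1)])
  have small: "2 - 2 * psi t 0 g < \<epsilon>\<^sup>2" if "g \<in> Q" for g using t(2)[OF that] by simp
  have "\<exists>v s. v \<noteq> 0 \<and> K.represents s (\<lambda>_. v) \<and> (\<forall>k. (\<lambda>n. K.nrm (fdiff (translate k (s n)) (s n))) \<longlonglongrightarrow> 0)"
  proof (rule K.property_T_invariant_function[of Q \<epsilon>])
    show "unitary_representation.has_invariant_vector H zero \<pi>"
      if "unitary_representation H zero add scale ip \<pi>"
        "\<exists>v. unitary_representation.almost_invariant H zero add scale ip \<pi> Q \<epsilon> v"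
      for H zero add scale ip and \<pi> :: "'g \<Rightarrow> ('g \<Rightarrow> complex) \<Rightarrow> 'g \<Rightarrow> complex"
      by (rule T'[OF that])
    show "2 - 2 * psi t 0 g < \<epsilon>\<^sup>2" if "g \<in> Q" for g by (rule small[OF that])
  qed (use Q(2) psi_self[OF t(1)] in auto)
  then obtain v s where v: "v \<noteq> 0" and s: "K.represents s (\<lambda>_. v)"
    and inv: "\<And>k. (\<lambda>n. K.nrm (fdiff (translate k (s n)) (s n))) \<longlonglongrightarrow> 0" by blast
  note s' = K.representsD[OF s]
  have "\<exists>N. \<forall>i\<ge>N. \<forall>j\<ge>N. K.nrm (fdiff (s i) (s j)) < (1/2)^n" for n by (rule s'(3)) simp
  then obtain N where N: "\<And>n i j. i \<ge> N n \<Longrightarrow> j \<ge> N n \<Longrightarrow> K.nrm (fdiff (s i) (s j)) < (1/2)^n" by metis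
  define r where "r = rec_nat (N 0) (\<lambda>n r. max (Suc r) (N (Suc n)))"
  have r: "r n \<ge> N n" "r n < r (Suc n)" for n by (cases n; simp add: r_def) (simp add: r_def)
  have rs: "strict_mono r" using r(2) by (simp add: strict_mono_Suc_iff)
  define c where "c n = s (r n)" for n
  have cV: "c n \<in> K.V" for n using s'(1) by (simp add: c_def)
  have fin: "finite (fsupp a)" if "a \<in> K.V" for a using that by (simp add: K.V_def)
  have nrm: "(\<integral>w. bump_norm t a w \<partial>M) \<le> K.nrm a" if "a \<in> K.V" for a
    using bump_norm_integral(2)[OF t(1) fin[OF that]] bump_form_integral(2)[OF t(1), of a]
    by (simp add: K.nrm_def K.bil_def)
  have nn: "0 \<le> (\<integral>w. bump_norm t a w \<partial>M)" if "a \<in> K.V" for a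
    using bump_norm_nonneg[OF t(1) fin[OF that]] by (intro integral_nonneg_AE) auto
  show ?thesis
  proof (rule that[OF t(1) v, of c])
    show "finite (fsupp (c n))" for n using cV fin by simp
    show "(\<integral>w. bump_norm t (fdiff (c (Suc n)) (c n)) w \<partial>M) \<le> (1/2)^n" for n
    proof -
      have "r (Suc n) \<ge> N n" using r(1)[of n] r(2)[of n] by linarith
      hence "K.nrm (fdiff (c (Suc n)) (c n)) < (1/2)^n" unfolding c_def using N r(1)[of n] by blast
      thus ?thesis using nrm[of "fdiff (c (Suc n)) (c n)"] cV by simp
    qed
    show "(\<lambda>n. \<integral>w. bump_norm t (fdiff (translate k (c n)) (c n)) w \<partial>M) \<longlonglongrightarrow> 0" for k
    proof (rule Lim_null_comparison)
      show "(\<lambda>n. K.nrm (fdiff (translate k (c n)) (c n))) \<longlonglongrightarrow> 0"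
        using LIMSEQ_subseq_LIMSEQ[OF inv[of k] rs] by (simp add: c_def comp_def)
      show "\<forall>\<^sub>F n in sequentially. norm (\<integral>w. bump_norm t (fdiff (translate k (c n)) (c n)) w \<partial>M)
          \<le> K.nrm (fdiff (translate k (c n)) (c n))"
        using nrm nn cV by (intro always_eventually allI) simp
    qed
    have "(\<integral>w. bumps t (c n) (orbit w) (F 0 w) \<partial>M) = K.ev (c n) 0" for n
    proof -
      have d: "fsupp (dirac 0) = {0 :: 'g}" by (auto simp: fsupp_def dirac_def)
      have "(\<integral>w. of_real (exp (- t * dist (F g w) (F 0 w))) \<partial>M) = (of_real (psi t g 0) :: complex)" for g
        unfolding psi_def by (rule integral_complex_of_real)
      thus ?thesis
        using bumps_integrable[OF t(1) F_measurable]
        by (simp add: bumps_def orbit_def K.ev_def K.bil_def d Bochner_Integration.integral_sum) (simp add: dirac_def)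
    qed
    moreover have "(\<lambda>n. K.ev (c n) 0) \<longlonglongrightarrow> v"
      using LIMSEQ_subseq_LIMSEQ[OF s'(2)[of 0] rs] by (simp add: c_def comp_def)
    ultimately show "(\<lambda>n. \<integral>w. bumps t (c n) (orbit w) (F 0 w) \<partial>M) \<longlonglongrightarrow> v" by simp
  qed
qed

lemma bumps_translate:
  assumes "w \<in> space M"
  shows "bumps t (translate k a) (orbit (act k w)) (\<alpha> k w x) = bumps t a (orbit w) x"
proof -
  have inj: "inj_on ((+) k) A" for A by (simp add: inj_on_def)
  show ?thesis
    unfolding bumps_def fsupp_translate sum.reindex[OF inj] orbit_def
    using assms by (simp add: translate_def F_equivariant cocycle_dist add.assoc[symmetric])
qed

lemma AE_haar_translate:
  assumes "AE g in m. P g"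
  shows "AE g in m. P (g + h)"
proof -
  obtain N where N: "N \<in> null_sets m" "{g \<in> space m. \<not> P g} \<subseteq> N" using assms by (auto simp: eventually_ae_filter)
  have "N \<in> sets borel" using N(1) haarD(1) by auto
  hence "rtrans N (- h) \<in> null_sets m"
    using haarD(5)[of N "- h"] borel_rtrans[of N "- h"] N(1) haarD(1) by (auto simp: null_sets_def)
  moreover have "{g \<in> space m. \<not> P (g + h)} \<subseteq> rtrans N (- h)"
    using N(2) haarD(2) by (auto simp: in_rtrans_iff)
  ultimately show ?thesis by (rule AE_I')
qed

lemma AE_haar_translate_iff: "(AE g in m. P (g + h)) \<longleftrightarrow> (AE g in m. P g)"
proof
  assume "AE g in m. P (g + h)"
  from AE_haar_translate[OF this, of "- h"] show "AE g in m. P g" by simp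
qed (rule AE_haar_translate)

lemma not_AE_haar_False: "\<not> (AE g in m. False)"
proof
  assume "AE g in m. False"
  then obtain N where "N \<in> null_sets m" "space m \<subseteq> N" by (auto simp: eventually_ae_filter)
  hence "space m \<in> null_sets m" using null_sets_subset sets.top by blast
  thus False using haarD(2,3) by auto
qed

sublocale haar: sigma_finite_measure m by (rule haarD(4))

sublocale haar_pair: pair_sigma_finite m M
  by (intro pair_sigma_finite.intro haarD(4) sigma_finite_measure_axioms)

lemma act_measurable_pair [measurable]: "(\<lambda>p. act (fst p) (snd p)) \<in> measurable (m \<Otimes>\<^sub>M M) M"
proof -
  have "sets (m \<Otimes>\<^sub>M M) = sets (borel \<Otimes>\<^sub>M M)" by (intro sets_pair_measure_cong haarD(1) refl)
  thus ?thesis using act_measurable by (simp add: split_beta' cong: measurable_cong_sets)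
qed

text \<open>By Fubini a set that is invariant up to null sets agrees, up to a null set, with the set of
  points that almost every group element moves into it, and that set is strictly invariant.\<close>

lemma ergodic_AE_invariant:
  assumes erg: "ergodic_action M act" and E: "E \<in> events"
    and inv: "\<And>g. AE w in M. act g w \<in> E \<longleftrightarrow> w \<in> E"
  shows "prob E = 0 \<or> prob E = 1"
proof -
  note E [measurable]
  define E' where "E' = {w \<in> space M. AE g in m. act g w \<in> E}"
  have E'_eq: "E' = {w \<in> space M. (\<integral>\<^sup>+g. indicator (space M - E) (act g w) \<partial>m) = 0}"
  proof -
    have "(AE g in m. act g w \<in> E) \<longleftrightarrow> (\<integral>\<^sup>+g. indicator (space M - E) (act g w) \<partial>m) = 0" if w: "w \<in> space M" for w
    proof -
      have [measurable]: "(\<lambda>g. act g w) \<in> measurable m M"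
        using measurable_Pair1[OF act_measurable_pair, of w] w by simp
      have "(\<integral>\<^sup>+g. indicator (space M - E) (act g w) \<partial>m) = 0 \<longleftrightarrow> (AE g in m. indicator (space M - E) (act g w) = (0::ennreal))"
        by (intro nn_integral_0_iff_AE) measurable
      thus ?thesis using w by (simp add: indicator_eq_0_iff)
    qed
    thus ?thesis unfolding E'_def by blast
  qed
  have [measurable]: "(\<lambda>w. \<integral>\<^sup>+g. indicator (space M - E) (act g w) \<partial>m) \<in> borel_measurable M"
  proof -
    have "(\<lambda>p. indicator (space M - E) (act (fst p) (snd p)) :: ennreal) \<in> borel_measurable (m \<Otimes>\<^sub>M M)" by measurable
    from measurable_compose[OF measurable_pair_swap' this]
    have "(\<lambda>p. indicator (space M - E) (act (snd p) (fst p)) :: ennreal) \<in> borel_measurable (M \<Otimes>\<^sub>M m)"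
      by (simp add: split_beta')
    thus ?thesis by (intro haar.borel_measurable_nn_integral) (simp add: split_beta')
  qed
  have E'm: "E' \<in> events" unfolding E'_eq by measurable
  have "act h -` E' \<inter> space M = E'" for h
  proof -
    have "(AE g in m. act g (act h w) \<in> E) \<longleftrightarrow> (AE g in m. act g w \<in> E)" if "w \<in> space M" for w
      using AE_haar_translate_iff[of "\<lambda>g. act g w \<in> E" h] act_plus[OF that] by simp
    hence "{w \<in> space M. AE g in m. act g (act h w) \<in> E} = E'"
      unfolding E'_def by (intro Collect_cong) blast
    moreover have "act h -` E' \<inter> space M = {w \<in> space M. AE g in m. act g (act h w) \<in> E}"
      unfolding E'_def using act_space by blast
    ultimately show ?thesis by simp
  qed
  hence "prob E' = 0 \<or> prob E' = 1" using erg E'm by (simp add: ergodic_action_def)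
  moreover have "AE w in M. w \<in> E' \<longleftrightarrow> w \<in> E"
  proof -
    have "AE g in m. AE w in M. act g w \<in> E \<longleftrightarrow> w \<in> E" using inv by simp
    hence "AE w in M. AE g in m. act g w \<in> E \<longleftrightarrow> w \<in> E"
      by (subst (asm) haar_pair.AE_commute) measurable
    thus ?thesis
    proof (rule AE_mp, intro AE_I2 impI)
      fix w assume w: "w \<in> space M" "AE g in m. act g w \<in> E \<longleftrightarrow> w \<in> E"
      show "w \<in> E' \<longleftrightarrow> w \<in> E"
      proof (cases "w \<in> E")
        case True
        thus ?thesis using w by (simp add: E'_def)
      next
        case False
        hence n: "AE g in m. act g w \<notin> E" using w(2) by simp
        have "\<not> (AE g in m. act g w \<in> E)"
        proof
          assume "AE g in m. act g w \<in> E"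
          with n have "AE g in m. False" by eventually_elim simp
          thus False using not_AE_haar_False by blast
        qed
        thus ?thesis using False by (simp add: E'_def)
      qed
    qed
  qed
  hence "prob E' = prob E" using E E'm by (intro finite_measure_eq_AE) auto
  ultimately show ?thesis by simp
qed

end


section \<open>The equivariant section\<close>

lemma countable_dense_UNIV:
  obtains D :: "'a::{metric_space, second_countable_topology} set" where "countable D" "D \<noteq> {}"
    "\<And>x e. e > 0 \<Longrightarrow> \<exists>d\<in>D. dist x d < e"
proof -
  obtain D :: "'a set" where D: "countable D" "\<And>X. open X \<Longrightarrow> X \<noteq> {} \<Longrightarrow> \<exists>d\<in>D. d \<in> X"
    by (erule countable_dense_setE)
  have "\<exists>d\<in>D. dist x d < e" if e: "e > 0" for x e
    using D(2)[of "ball x e"] e by auto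
  moreover have "D \<noteq> {}" using D(2)[of UNIV] by auto
  ultimately show ?thesis using that D(1) by blast
qed

lemma continuous_nonzero_dense:
  fixes f :: "'a::metric_space \<Rightarrow> complex"
  assumes f: "continuous_on UNIV f" and D: "\<And>x e. e > 0 \<Longrightarrow> \<exists>d\<in>D. dist x d < e"
  shows "(\<exists>x. f x \<noteq> 0) \<longleftrightarrow> (\<exists>x\<in>D. f x \<noteq> 0)"
proof
  assume "\<exists>x. f x \<noteq> 0"
  then obtain x where x: "f x \<noteq> 0" by blast
  have "open (f -` (- {0}))" using f by (intro open_vimage) auto
  moreover have "x \<in> f -` (- {0})" using x by simp
  ultimately obtain e where e: "e > 0" "ball x e \<subseteq> f -` (- {0})" using open_contains_ball by metis
  obtain d where "d \<in> D" "dist x d < e" using D[OF e(1)] by blast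
  thus "\<exists>x\<in>D. f x \<noteq> 0" using e(2) by (intro bexI[of _ d]) auto
qed blast

text \<open>The sequence \<open>c\<close> approximates an invariant vector.  It is fast enough to converge at almost every
  point of the probability space.\<close>

locale invariant_bumps = isometric_cocycle_action M act \<alpha> m
  for M :: "'w measure" and act :: "'g::{topological_group_add, t2_space, second_countable_topology} \<Rightarrow> 'w \<Rightarrow> 'w"
    and \<alpha> :: "'g \<Rightarrow> 'w \<Rightarrow> 'a::{polish_space, median_space} \<Rightarrow> 'a" and m :: "'g measure" +
  fixes t :: real and v :: complex and c :: "nat \<Rightarrow> 'g \<Rightarrow> complex"
  assumes t: "t > 0" and v: "v \<noteq> 0" and c_finite: "\<And>n. finite (fsupp (c n))"
    and c_fast: "\<And>n. (\<integral>w. bump_norm t (fdiff (c (Suc n)) (c n)) w \<partial>M) \<le> (1/2)^n"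
    and c_invariant: "\<And>k. (\<lambda>n. \<integral>w. bump_norm t (fdiff (translate k (c n)) (c n)) w \<partial>M) \<longlonglongrightarrow> 0"
    and c_value: "(\<lambda>n. \<integral>w. bumps t (c n) (orbit w) (F 0 w) \<partial>M) \<longlonglongrightarrow> v"
    and finite_rank: "finite_rank TYPE('a)" and connected_space: "connected (UNIV :: 'a set)"
    and ergodic: "ergodic_action M act"
begin

definition approx :: "nat \<Rightarrow> 'w \<Rightarrow> 'a \<Rightarrow> complex" where
  "approx n w x = bumps t (c n) (orbit w) x"

definition increment :: "nat \<Rightarrow> 'w \<Rightarrow> real" where
  "increment n w = bump_norm t (fdiff (c (Suc n)) (c n)) w"

definition good :: "'w \<Rightarrow> bool" where
  "good w \<longleftrightarrow> (\<Sum>n. ennreal (increment n w)) \<noteq> \<infinity>"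

definition field :: "'w \<Rightarrow> 'a \<Rightarrow> complex" where
  "field w x = lim (\<lambda>n. approx n w x)"

definition tail :: "nat \<Rightarrow> 'w \<Rightarrow> real" where
  "tail n w = (\<Sum>k. increment (k + n) w)"

lemma fdiff_finite: "finite (fsupp a) \<Longrightarrow> finite (fsupp b) \<Longrightarrow> finite (fsupp (fdiff a b))" for a b :: "'g \<Rightarrow> complex"
  by (rule finite_subset[of _ "fsupp a \<union> fsupp b"]) (auto simp: fsupp_def fadd_def fscale_def)

lemma increment_measurable [measurable]: "increment n \<in> borel_measurable M"
  unfolding increment_def by measurable

lemma increment_nonneg: "increment n w \<ge> 0"
  unfolding increment_def by (intro bump_norm_nonneg t fdiff_finite c_finite)

lemma increment_integrable: "integrable M (increment n)"
  unfolding increment_def by (intro bump_norm_integral t fdiff_finite c_finite)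

lemma increment_nn_integral: "(\<integral>\<^sup>+w. increment n w \<partial>M) \<le> ennreal ((1/2)^n)"
proof -
  have "(\<integral>\<^sup>+w. increment n w \<partial>M) = ennreal (\<integral>w. increment n w \<partial>M)"
    using increment_nonneg by (intro nn_integral_eq_integral increment_integrable AE_I2)
  also have "\<dots> \<le> ennreal ((1/2)^n)" using c_fast[of n] by (intro ennreal_leI) (simp add: increment_def)
  finally show ?thesis .
qed

lemma tail_nn_integral: "(\<integral>\<^sup>+w. (\<Sum>k. ennreal (increment (k + n) w)) \<partial>M) \<le> ennreal (2 * (1/2)^n)"
proof -
  have "(\<integral>\<^sup>+w. (\<Sum>k. ennreal (increment (k + n) w)) \<partial>M) = (\<Sum>k. \<integral>\<^sup>+w. increment (k + n) w \<partial>M)"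
    by (intro nn_integral_suminf) measurable
  also have "\<dots> \<le> (\<Sum>k. ennreal ((1/2)^(k + n)))"
    by (intro suminf_le increment_nn_integral) auto
  also have "\<dots> = ennreal (2 * (1/2)^n)"
  proof (rule suminf_ennreal_eq)
    have "(\<lambda>k. (1/2)^k * (1/2)^n :: real) sums (2 * (1/2)^n)"
      using geometric_sums[of "1/2 :: real"] by (intro sums_mult2) simp
    thus "(\<lambda>k. (1/2)^(k + n) :: real) sums (2 * (1/2)^n)" by (simp add: power_add)
  qed simp
  finally show ?thesis .
qed

lemma AE_good: "AE w in M. good w"
proof -
  have "(\<integral>\<^sup>+w. (\<Sum>k. ennreal (increment k w)) \<partial>M) \<noteq> \<infinity>"
    using tail_nn_integral[of 0] by (auto simp: top_unique)
  thus ?thesis unfolding good_def by (intro nn_integral_noteq_infinite) measurable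
qed

lemma good_measurable [measurable]: "{w \<in> space M. good w} \<in> events"
  unfolding good_def by measurable

lemma good_summable: "good w \<Longrightarrow> summable (\<lambda>n. increment n w)"
  unfolding good_def by (intro summable_suminf_not_top increment_nonneg) simp

lemma tail_tendsto:
  assumes "good w"
  shows "(\<lambda>n. tail n w) \<longlonglongrightarrow> 0"
proof -
  note s = good_summable[OF assms]
  have "tail n w = (\<Sum>k. increment k w) - (\<Sum>i<n. increment i w)" for n
    unfolding tail_def by (rule suminf_minus_initial_segment[OF s])
  moreover have "(\<lambda>n. (\<Sum>k. increment k w) - (\<Sum>i<n. increment i w)) \<longlonglongrightarrow> (\<Sum>k. increment k w) - (\<Sum>k. increment k w)"
    by (intro tendsto_diff tendsto_const summable_LIMSEQ s)
  ultimately show ?thesis by simp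
qed

lemma approx_increment: "cmod (approx (Suc n) w x - approx n w x) \<le> increment n w"
  unfolding approx_def increment_def bump_norm_def bumps_diff[OF c_finite c_finite, symmetric]
  by (intro bumps_bound t fdiff_finite c_finite)

lemma field_limit:
  assumes w: "good w"
  shows "(\<lambda>n. approx n w x) \<longlonglongrightarrow> field w x" "cmod (field w x - approx n w x) \<le> tail n w"
proof -
  note s = good_summable[OF w]
  define d where "d n = approx (Suc n) w x - approx n w x" for n
  have sn: "summable (\<lambda>k. norm (d (k + n)))" for n
    by (rule summable_comparison_test'[OF summable_ignore_initial_segment[OF s, of n]])
       (use approx_increment in \<open>auto simp: d_def\<close>)
  have sd: "summable d" using summable_norm_cancel[OF sn[of 0]] by simp
  have tel: "approx n w x = approx 0 w x + (\<Sum>k<n. d k)" for n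
    by (induction n) (auto simp: d_def)
  have "(\<lambda>n. approx 0 w x + (\<Sum>k<n. d k)) \<longlonglongrightarrow> approx 0 w x + suminf d"
    by (intro tendsto_add tendsto_const summable_LIMSEQ sd)
  hence lim: "(\<lambda>n. approx n w x) \<longlonglongrightarrow> approx 0 w x + suminf d" unfolding tel[symmetric] .
  hence eq: "field w x = approx 0 w x + suminf d" unfolding field_def by (rule limI)
  show "(\<lambda>n. approx n w x) \<longlonglongrightarrow> field w x" using lim eq by simp
  have "field w x - approx n w x = (\<Sum>k. d (k + n))"
    unfolding eq tel[of n] using suminf_minus_initial_segment[OF sd, of n] by simp
  also have "cmod (\<Sum>k. d (k + n)) \<le> (\<Sum>k. norm (d (k + n)))" by (rule summable_norm[OF sn])
  also have "\<dots> \<le> tail n w" unfolding tail_def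
    by (intro suminf_le sn summable_ignore_initial_segment s) (use approx_increment in \<open>auto simp: d_def\<close>)
  finally show "cmod (field w x - approx n w x) \<le> tail n w" .
qed

lemma approx_uniform:
  assumes w: "good w" and e: "e > 0"
  shows "\<forall>\<^sub>F n in sequentially. \<forall>x. cmod (field w x - approx n w x) < e"
  using order_tendstoD(2)[OF tail_tendsto[OF w] e]
  by eventually_elim (use field_limit(2)[OF w] in \<open>blast intro: le_less_trans\<close>)

lemma approx_uniform_abs:
  assumes w: "good w" and e: "e > 0"
  shows "\<forall>\<^sub>F n in sequentially. \<forall>x. \<bar>cmod (field w x) - cmod (approx n w x)\<bar> \<le> e"
  using approx_uniform[OF w e]
  by eventually_elim (use norm_triangle_ineq3 in \<open>blast intro: order.trans less_imp_le\<close>)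

lemma approx_vanishing: "vanishing (\<lambda>x. cmod (approx n w x))"
  unfolding approx_def by (rule vanishing_bumps[OF t c_finite])

lemma field_vanishing:
  assumes w: "good w"
  shows "vanishing (\<lambda>x. cmod (field w x))"
  by (rule vanishing_uniform_limit[OF approx_vanishing _ approx_uniform_abs[OF w]]) auto

lemma field_continuous:
  assumes w: "good w"
  shows "continuous_on UNIV (field w)"
proof (rule uniform_limit_theorem[where f = "\<lambda>n. approx n w" and F = sequentially])
  show "\<forall>\<^sub>F n in sequentially. continuous_on UNIV (approx n w)"
    unfolding approx_def[abs_def] using bumps_continuous[OF t] by (intro always_eventually allI)
  show "uniform_limit UNIV (\<lambda>n. approx n w) (field w) sequentially"
  proof (rule uniform_limitI)
    fix e :: real assume "e > 0"
    from approx_uniform[OF w this] show "\<forall>\<^sub>F n in sequentially. \<forall>x\<in>UNIV. dist (approx n w x) (field w x) < e"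
      by eventually_elim (simp add: dist_norm norm_minus_commute)
  qed
qed simp

lemma approx_measurable [measurable]: "(\<lambda>w. approx n w x) \<in> borel_measurable M"
  unfolding approx_def by (rule bumps_measurable) simp

lemma field_measurable [measurable]: "(\<lambda>w. field w x) \<in> borel_measurable M"
  unfolding field_def by measurable

definition support_set :: "'w set" where
  "support_set = {w \<in> space M. good w \<and> (\<exists>x. field w x \<noteq> 0)}"

lemma support_set_event [measurable]: "support_set \<in> events"
proof -
  obtain D :: "'a set" where D: "countable D" "\<And>x e. e > 0 \<Longrightarrow> \<exists>d\<in>D. dist x d < e"
    by (rule countable_dense_UNIV) (rule that)
  have "support_set = {w \<in> space M. good w} \<inter> (\<Union>x\<in>D. {w \<in> space M. field w x \<noteq> 0})"
    unfolding support_set_def using continuous_nonzero_dense[OF field_continuous D(2)] by blast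
  also have "\<dots> \<in> events"
    using D(1) by (intro sets.Int good_measurable sets.countable_UN') (auto, measurable)
  finally show ?thesis .
qed

text \<open>The field is equivariant because the approximants of the field and their translates differ by
  a sequence that tends to zero in mean, hence almost everywhere along a subsequence.\<close>

lemma field_equivariant:
  "AE w in M. good w \<and> good (act k w) \<and> (\<forall>x. field (act k w) (\<alpha> k w x) = field w x)"
proof -
  define d where "d n = bump_norm t (fdiff (translate k (c n)) (c n))" for n
  have tf: "finite (fsupp (translate k (c n)))" for n by (simp add: fsupp_translate c_finite)
  have d0: "d n w \<ge> 0" for n w unfolding d_def by (intro bump_norm_nonneg t fdiff_finite c_finite tf)
  have di: "integrable M (d n)" for n unfolding d_def by (intro bump_norm_integral t fdiff_finite c_finite tf)
  have "(\<lambda>n. \<integral>w. norm (d n w) \<partial>M) \<longlonglongrightarrow> 0" using c_invariant[of k] d0 by (simp add: d_def)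
  from tendsto_L1_AE_subseq[OF di this]
  obtain r :: "nat \<Rightarrow> nat" where r: "strict_mono r" "AE w in M. (\<lambda>n. d (r n) w) \<longlonglongrightarrow> 0" by blast
  have "AE w in M. good w \<and> good (act k w) \<and> (\<lambda>n. d (r n) (act k w)) \<longlonglongrightarrow> 0"
    using AE_good AE_act[OF AE_good, of k] AE_act[OF r(2), of k] by eventually_elim blast
  thus ?thesis
  proof (rule AE_mp, intro AE_I2 impI)
    fix w assume w: "w \<in> space M" "good w \<and> good (act k w) \<and> (\<lambda>n. d (r n) (act k w)) \<longlonglongrightarrow> 0"
    have "field (act k w) (\<alpha> k w x) = field w x" for x
    proof -
      have "approx n w x - approx n (act k w) (\<alpha> k w x) = bumps t (fdiff (translate k (c n)) (c n)) (orbit (act k w)) (\<alpha> k w x)" for n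
        unfolding bumps_diff[OF tf c_finite] bumps_translate[OF w(1)] approx_def ..
      hence b: "norm (approx n w x - approx n (act k w) (\<alpha> k w x)) \<le> d n (act k w)" for n
        unfolding d_def bump_norm_def using bumps_bound[OF t fdiff_finite[OF tf c_finite]] by simp
      have "(\<lambda>n. approx (r n) w x - approx (r n) (act k w) (\<alpha> k w x)) \<longlonglongrightarrow> 0"
        by (rule Lim_null_comparison[OF always_eventually[OF allI[OF b]]]) (use w in blast)
      moreover have "(\<lambda>n. approx (r n) w x - approx (r n) (act k w) (\<alpha> k w x)) \<longlonglongrightarrow> field w x - field (act k w) (\<alpha> k w x)"
        using LIMSEQ_subseq_LIMSEQ[OF field_limit(1) r(1)] w by (intro tendsto_diff) (auto simp: comp_def)
      ultimately have "field w x - field (act k w) (\<alpha> k w x) = 0" using LIMSEQ_unique by blast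
      thus ?thesis by simp
    qed
    thus "good w \<and> good (act k w) \<and> (\<forall>x. field (act k w) (\<alpha> k w x) = field w x)" using w by blast
  qed
qed

lemma cocycle_surj: "w \<in> space M \<Longrightarrow> \<exists>x. y = \<alpha> k w x"
  using cocycle_isometric[of w k] unfolding isometric_bij_def by (metis bij_pointE)

lemma support_set_invariant: "AE w in M. act k w \<in> support_set \<longleftrightarrow> w \<in> support_set"
  using field_equivariant[of k]
proof (rule AE_mp, intro AE_I2 impI)
  fix w assume w: "w \<in> space M" "good w \<and> good (act k w) \<and> (\<forall>x. field (act k w) (\<alpha> k w x) = field w x)"
  have "(\<exists>y. field (act k w) y \<noteq> 0) \<longleftrightarrow> (\<exists>x. field w x \<noteq> 0)" using w cocycle_surj[OF w(1)] by metis
  thus "act k w \<in> support_set \<longleftrightarrow> w \<in> support_set" using w by (simp add: support_set_def)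
qed

text \<open>Where the field vanishes the approximants are bounded by the tails, whose means tend to zero;
  but the means of the values of the approximants at the constant section tend to \<open>v\<close>.\<close>

lemma support_set_not_null: "prob support_set \<noteq> 0"
proof
  assume "prob support_set = 0"
  hence "AE w in M. w \<notin> support_set" by (intro AE_not_in) (simp add: emeasure_eq_measure null_setsI)
  hence vanish: "AE w in M. good w \<and> (\<forall>x. field w x = 0)"
    using AE_good AE_space by eventually_elim (auto simp: support_set_def)
  have bound: "cmod (\<integral>w. bumps t (c n) (orbit w) (F 0 w) \<partial>M) \<le> 2 * (1/2)^n" for n
  proof -
    have int: "integrable M (\<lambda>w. bumps t (c n) (orbit w) (F 0 w))"
      unfolding bumps_def orbit_def by (intro Bochner_Integration.integrable_sum integrable_mult_right bumps_integrable t F_measurable)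
    have "ennreal (cmod (\<integral>w. bumps t (c n) (orbit w) (F 0 w) \<partial>M)) \<le> (\<integral>\<^sup>+w. norm (bumps t (c n) (orbit w) (F 0 w)) \<partial>M)"
      by (rule integral_norm_bound_ennreal[OF int])
    also have "\<dots> \<le> (\<integral>\<^sup>+w. (\<Sum>k. ennreal (increment (k + n) w)) \<partial>M)"
    proof (rule nn_integral_mono_AE, use vanish in eventually_elim)
      fix w assume w: "good w \<and> (\<forall>x. field w x = 0)"
      hence "cmod (approx n w (F 0 w)) \<le> tail n w" using field_limit(2)[of w "F 0 w" n] by simp
      moreover have "ennreal (tail n w) = (\<Sum>k. ennreal (increment (k + n) w))"
        unfolding tail_def using w
        by (intro suminf_ennreal2[symmetric] increment_nonneg summable_ignore_initial_segment good_summable) auto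
      ultimately show "ennreal (norm (bumps t (c n) (orbit w) (F 0 w))) \<le> (\<Sum>k. ennreal (increment (k + n) w))"
        unfolding approx_def by (metis ennreal_leI)
    qed
    also have "\<dots> \<le> ennreal (2 * (1/2)^n)" by (rule tail_nn_integral)
    finally show ?thesis by (subst (asm) ennreal_le_iff) auto
  qed
  have "(\<lambda>n. \<integral>w. bumps t (c n) (orbit w) (F 0 w) \<partial>M) \<longlonglongrightarrow> 0"
  proof (rule Lim_null_comparison)
    show "\<forall>\<^sub>F n in sequentially. norm (\<integral>w. bumps t (c n) (orbit w) (F 0 w) \<partial>M) \<le> 2 * (1/2)^n"
      by (rule always_eventually, rule allI, rule bound)
    have "(\<lambda>n. 2 * (1/2)^n :: real) \<longlonglongrightarrow> 2 * 0" by (intro tendsto_mult_left LIMSEQ_realpow_zero) auto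
    thus "(\<lambda>n. 2 * (1/2)^n :: real) \<longlonglongrightarrow> 0" by simp
  qed
  thus False using c_value v LIMSEQ_unique by blast
qed

lemma AE_support_set: "AE w in M. w \<in> support_set"
proof -
  have "prob support_set = 1"
    using ergodic_AE_invariant[OF ergodic support_set_event support_set_invariant] support_set_not_null by blast
  thus ?thesis by (simp add: prob_eq_1)
qed

text \<open>When the maps \<open>F g\<close> are replaced by simple ones, the centre takes only finitely many values; by
  continuity of the centre these approximations converge.\<close>

lemma centre_of_bumps_measurable:
  assumes a: "finite (fsupp a)"
  shows "(\<lambda>w. centre_or base (\<lambda>x. cmod (bumps t a (orbit w) x))) \<in> borel_measurable M"
proof -
  have "\<exists>G. (\<forall>i. simple_function M (G i)) \<and> (\<forall>w\<in>space M. (\<lambda>i. G i w) \<longlonglongrightarrow> F g w)" for g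
    using borel_measurable_implies_sequence_metric[OF F_measurable[of g]] by blast
  then obtain G where G: "\<And>g i. simple_function M (G g i)" "\<And>g w. w \<in> space M \<Longrightarrow> (\<lambda>i. G g i w) \<longlonglongrightarrow> F g w" by metis
  define H where "H P = centre_or base (\<lambda>x. cmod (bumps t a P x))" for P
  have Hcong: "H P = H (restrict P (fsupp a))" for P by (simp add: H_def bumps_def)
  have simple: "(\<lambda>w. H (\<lambda>g. G g i w)) \<in> borel_measurable M" for i
  proof -
    define T where "T w = restrict (\<lambda>g. G g i w) (fsupp a)" for w
    have fin: "finite (G g i ` space M)" for g using G(1)[of g i] by (simp add: simple_function_def)
    have "T ` space M \<subseteq> PiE (fsupp a) (\<lambda>g. G g i ` space M)" by (auto simp: T_def)
    hence finT: "finite (T ` space M)" by (rule finite_subset) (intro finite_PiE a fin)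
    have "T -` {\<tau>} \<inter> space M \<in> events" if \<tau>: "\<tau> \<in> T ` space M" for \<tau>
    proof -
      have "T w = \<tau> \<longleftrightarrow> (\<forall>g\<in>fsupp a. G g i w = \<tau> g)" for w
      proof
        assume "T w = \<tau>"
        thus "\<forall>g\<in>fsupp a. G g i w = \<tau> g" by (auto simp: T_def)
      next
        assume eq: "\<forall>g\<in>fsupp a. G g i w = \<tau> g"
        obtain w' where "\<tau> = T w'" using \<tau> by blast
        thus "T w = \<tau>" using eq by (auto simp: T_def fun_eq_iff restrict_def)
      qed
      hence "T -` {\<tau>} \<inter> space M = {w \<in> space M. \<forall>g\<in>fsupp a. G g i w = \<tau> g}" by auto
      also have "\<dots> \<in> events"
      proof (rule sets.sets_Collect_finite_All[OF _ a])
        show "{w \<in> space M. G g i w = \<tau> g} \<in> events" if "g \<in> fsupp a" for g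
          using simple_functionD(2)[OF G(1)[of g i], of "{\<tau> g}"] by (simp add: vimage_def Int_def conj_commute)
      qed
      finally show ?thesis .
    qed
    hence "T \<in> measurable M (count_space (T ` space M))" by (simp add: measurable_count_space_eq2[OF finT])
    hence "(\<lambda>w. H (T w)) \<in> borel_measurable M"
      by (rule measurable_compose) simp
    thus ?thesis unfolding T_def Hcong[symmetric] .
  qed
  define A where "A = {w \<in> space M. \<exists>x. bumps t a (orbit w) x \<noteq> 0}"
  have A [measurable]: "A \<in> events"
  proof -
    obtain D :: "'a set" where D: "countable D" "\<And>x e. e > 0 \<Longrightarrow> \<exists>d\<in>D. dist x d < e"
      by (rule countable_dense_UNIV) (rule that)
    have [measurable]: "(\<lambda>w. bumps t a (orbit w) x) \<in> borel_measurable M" for x by (rule bumps_measurable) simp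
    have "A = (\<Union>x\<in>D. {w \<in> space M. bumps t a (orbit w) x \<noteq> 0})"
      unfolding A_def using continuous_nonzero_dense[OF bumps_continuous[OF t] D(2)] by blast
    also have "\<dots> \<in> events" using D(1) by (intro sets.countable_UN') (auto, measurable)
    finally show ?thesis .
  qed
  show ?thesis
  proof (rule borel_measurable_LIMSEQ_metric)
    show "(\<lambda>w. if w \<in> A then H (\<lambda>g. G g i w) else base) \<in> borel_measurable M" for i
      using simple[of i] by measurable
    fix w assume w: "w \<in> space M"
    show "(\<lambda>i. if w \<in> A then H (\<lambda>g. G g i w) else base) \<longlonglongrightarrow> centre_or base (\<lambda>x. cmod (bumps t a (orbit w) x))"
    proof (cases "w \<in> A")
      case False
      hence "centre_or base (\<lambda>x. cmod (bumps t a (orbit w) x)) = base" using w by (auto simp: A_def centre_or_def)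
      thus ?thesis using False by simp
    next
      case True
      hence p: "profile (\<lambda>x. cmod (bumps t a (orbit w) x))"
        using vanishing_bumps[OF t a] by (auto simp: profile_iff_vanishing A_def)
      have "(\<lambda>i. H (\<lambda>g. G g i w)) \<longlonglongrightarrow> centre_or base (\<lambda>x. cmod (bumps t a (orbit w) x))"
        unfolding H_def
      proof (rule centre_or_tendsto[OF finite_rank connected_space p vanishing_bumps[OF t a]])
        fix e :: real assume e: "e > 0"
        have "(\<lambda>i. \<Sum>g\<in>fsupp a. cmod (a g) * (t * (dist (orbit w g) (G g i w) + 0)))
            \<longlonglongrightarrow> (\<Sum>g\<in>fsupp a. cmod (a g) * (t * (dist (orbit w g) (F g w) + 0)))"
          by (intro tendsto_intros G(2) w)
        hence "(\<lambda>i. \<Sum>g\<in>fsupp a. cmod (a g) * (t * (dist (orbit w g) (G g i w) + 0))) \<longlonglongrightarrow> 0"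
          by (simp add: orbit_def)
        from order_tendstoD(2)[OF this e]
        show "\<forall>\<^sub>F i in sequentially. \<forall>x. \<bar>cmod (bumps t a (orbit w) x) - cmod (bumps t a (\<lambda>g. G g i w) x)\<bar> \<le> e"
        proof eventually_elim
          case (elim i)
          show ?case
          proof
            fix x
            have "\<bar>cmod (bumps t a (orbit w) x) - cmod (bumps t a (\<lambda>g. G g i w) x)\<bar>
                \<le> cmod (bumps t a (orbit w) x - bumps t a (\<lambda>g. G g i w) x)" by (rule norm_triangle_ineq3)
            also have "\<dots> \<le> (\<Sum>g\<in>fsupp a. cmod (a g) * (t * (dist (orbit w g) (G g i w) + dist x x)))"
              by (rule bumps_perturb[OF t])
            finally show "\<bar>cmod (bumps t a (orbit w) x) - cmod (bumps t a (\<lambda>g. G g i w) x)\<bar> \<le> e" using elim by simp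
          qed
        qed
      qed
      thus ?thesis using True by simp
    qed
  qed
qed

definition section_map :: "'w \<Rightarrow> 'a" where
  "section_map w = (if w \<in> support_set then centre_or base (\<lambda>x. cmod (field w x)) else base)"

lemma support_set_profile:
  assumes "w \<in> support_set"
  shows "profile (\<lambda>x. cmod (field w x))" "section_map w = centre (\<lambda>x. cmod (field w x))"
proof -
  have w: "good w" "\<exists>x. field w x \<noteq> 0" using assms by (auto simp: support_set_def)
  show "profile (\<lambda>x. cmod (field w x))" using field_vanishing[OF w(1)] w(2) by (simp add: profile_iff_vanishing)
  show "section_map w = centre (\<lambda>x. cmod (field w x))" using assms w(2) by (simp add: section_map_def centre_or_def)
qed

lemma section_map_measurable: "section_map \<in> borel_measurable M"
proof (rule borel_measurable_LIMSEQ_metric)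
  have [measurable]: "(\<lambda>w. centre_or base (\<lambda>x. cmod (approx n w x))) \<in> borel_measurable M" for n
    unfolding approx_def by (rule centre_of_bumps_measurable[OF c_finite])
  show "(\<lambda>w. if w \<in> support_set then centre_or base (\<lambda>x. cmod (approx n w x)) else base) \<in> borel_measurable M" for n
    by measurable
  fix w assume "w \<in> space M"
  show "(\<lambda>n. if w \<in> support_set then centre_or base (\<lambda>x. cmod (approx n w x)) else base) \<longlonglongrightarrow> section_map w"
  proof (cases "w \<in> support_set")
    case True
    hence w: "good w" by (simp add: support_set_def)
    have "(\<lambda>n. centre_or base (\<lambda>x. cmod (approx n w x))) \<longlonglongrightarrow> centre_or base (\<lambda>x. cmod (field w x))"
      by (rule centre_or_tendsto[OF finite_rank connected_space support_set_profile(1)[OF True] approx_vanishing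
            approx_uniform_abs[OF w]])
    thus ?thesis using True by (simp add: section_map_def)
  qed (simp add: section_map_def)
qed

text \<open>The centre of a function is carried along by isometries, and the field is equivariant.\<close>

theorem section_map_equivariant: "equivariant_section M act \<alpha> section_map"
  unfolding equivariant_section_def
proof
  fix k
  have "AE w in M. w \<in> support_set \<and> act k w \<in> support_set \<and> (\<forall>x. field (act k w) (\<alpha> k w x) = field w x)"
    using AE_support_set AE_act[OF AE_support_set, of k] field_equivariant[of k] by eventually_elim blast
  thus "AE w in M. section_map (act k w) = \<alpha> k w (section_map w)"
  proof (rule AE_mp, intro AE_I2 impI)
    fix w assume sp: "w \<in> space M"
      and w: "w \<in> support_set \<and> act k w \<in> support_set \<and> (\<forall>x. field (act k w) (\<alpha> k w x) = field w x)"
    have "centre (\<lambda>x. cmod (field (act k w) x)) = \<alpha> k w (centre (\<lambda>x. cmod (field w x)))"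
      using w by (intro centre_equivariant[OF finite_rank connected_space] support_set_profile(1)
          cocycle_isometric sp) auto
    thus "section_map (act k w) = \<alpha> k w (section_map w)" using w by (simp add: support_set_profile(2))
  qed
qed

end


section \<open>Cocycles with an equivariant section are elementary\<close>

lemma lineal_singleton:
  assumes "\<And>x y :: 'a::median_space. x = y"
  shows "lineal TYPE('a)"
proof -
  fix a :: 'a
  let ?T = "product_topology (\<lambda>(a, b). top_of_set (metric_interval a (b :: 'a))) UNIV"
  have eq: "\<xi> = \<eta>" for \<xi> \<eta> :: "'a \<times> 'a \<Rightarrow> 'a" using assms by (intro ext)
  have mem: "roller_embedding a \<in> topspace ?T"
    by (auto simp: topspace_product_topology roller_embedding_def median_props PiE_iff)
  have "range (roller_embedding :: 'a \<Rightarrow> _) \<subseteq> topspace ?T"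
    by (rule image_subsetI) (subst eq[of _ "roller_embedding a"], rule mem)
  hence "range (roller_embedding :: 'a \<Rightarrow> _) \<subseteq> roller_compactification"
    unfolding roller_compactification_def by (rule closure_of_subset)
  hence r: "roller_embedding a \<in> (roller_compactification :: ('a \<times> 'a \<Rightarrow> 'a) set)" by blast
  have "roller_compactification = roller_interval (roller_embedding a) (roller_embedding a)"
    unfolding roller_interval_def using eq by blast
  thus ?thesis unfolding lineal_def using r by blast
qed

context isometric_cocycle_action
begin

text \<open>Fubini replaces the exceptional null sets, one for each group element, by a single one: almost
  every \<open>w\<close> satisfies the equation for almost every group element.  If both \<open>w\<close> and \<open>act g w\<close> do,
  then for almost every \<open>h\<close> the value at \<open>act (h + g) w\<close> can be computed in two ways, which gives
  the equation for \<open>g\<close> itself.\<close>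

lemma equivariant_section_strict:
  assumes f: "f \<in> borel_measurable M" and eq: "equivariant_section M act \<alpha> f"
  obtains N where "N \<in> null_sets M"
    "\<And>g w. w \<in> space M - N \<Longrightarrow> act g w \<in> space M - N \<Longrightarrow> f (act g w) = \<alpha> g w (f w)"
proof -
  have [measurable]: "(\<lambda>p. f (act (fst p) (snd p))) \<in> borel_measurable (m \<Otimes>\<^sub>M M)"
    by (rule measurable_compose[OF act_measurable_pair f])
  have fst: "fst \<in> measurable (m \<Otimes>\<^sub>M M) borel" using measurable_fst[of m M] haarD(1) by (simp cong: measurable_cong_sets)
  have [measurable]: "(\<lambda>p. \<alpha> (fst p) (snd p) (f (snd p))) \<in> borel_measurable (m \<Otimes>\<^sub>M M)"
    using f by (intro cocycle_measurable_comp fst measurable_snd measurable_compose[OF measurable_snd])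
  have "AE g in m. AE w in M. f (act g w) = \<alpha> g w (f w)" using eq by (simp add: equivariant_section_def)
  moreover have "{p \<in> space (m \<Otimes>\<^sub>M M). f (act (fst p) (snd p)) = \<alpha> (fst p) (snd p) (f (snd p))} \<in> sets (m \<Otimes>\<^sub>M M)"
  proof -
    have "{p \<in> space (m \<Otimes>\<^sub>M M). dist (f (act (fst p) (snd p))) (\<alpha> (fst p) (snd p) (f (snd p))) = 0} \<in> sets (m \<Otimes>\<^sub>M M)"
      by measurable
    thus ?thesis by simp
  qed
  ultimately have "AE w in M. AE g in m. f (act g w) = \<alpha> g w (f w)"
    using haar_pair.AE_commute[of "\<lambda>g w. f (act g w) = \<alpha> g w (f w)"] by blast
  then obtain N where N: "N \<in> null_sets M" "{w \<in> space M. \<not> (AE g in m. f (act g w) = \<alpha> g w (f w))} \<subseteq> N"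
    by (auto simp: eventually_ae_filter)
  show ?thesis
  proof (rule that[OF N(1)])
    fix g w assume w: "w \<in> space M - N" "act g w \<in> space M - N"
    have "AE h in m. f (act h w) = \<alpha> h w (f w)" using N(2) w(1) by blast
    hence 1: "AE h in m. f (act (h + g) w) = \<alpha> (h + g) w (f w)" by (rule AE_haar_translate)
    have 2: "AE h in m. f (act h (act g w)) = \<alpha> h (act g w) (f (act g w))" using N(2) w(2) by blast
    have "AE h in m. f (act g w) = \<alpha> g w (f w)"
      using 1 2
    proof eventually_elim
      case (elim h)
      thus ?case using w(1) act_plus[of w h g] cocycle_plus[of w h g] cocycle_inj[of "act g w" h] by simp
    qed
    thus "f (act g w) = \<alpha> g w (f w)" using not_AE_haar_False by (cases "f (act g w) = \<alpha> g w (f w)") auto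
  qed
qed

text \<open>Choose a ball that the section visits with positive probability and a thick halfspace around
  it.  The cocycle cannot map that halfspace into its complement between two such visits.\<close>

theorem equivariant_section_elementary:
  assumes fr: "finite_rank TYPE('a)" and f: "f \<in> borel_measurable M" and eq: "equivariant_section M act \<alpha> f"
  shows "elementary_cocycle M act \<alpha>"
  unfolding elementary_cocycle_def
proof
  assume ne: "nonelementary_cocycle M act \<alpha>"
  hence "\<not> lineal TYPE('a)" by (simp add: nonelementary_cocycle_def)
  then obtain a b :: 'a where ab: "a \<noteq> b" using lineal_singleton by blast
  define \<eta> where "\<eta> = dist a b / 2"
  have \<eta>: "\<eta> > 0" using ab by (simp add: \<eta>_def)
  obtain \<gamma> where \<gamma>: "\<gamma> > 0" and nest: "\<And>x y :: 'a. dist x y \<ge> \<eta> \<Longrightarrow> \<exists>h k. nested_separation \<gamma> x y h k"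
    using nested_halfspaces[OF fr \<eta>] by blast
  obtain N where N: "N \<in> null_sets M"
    "\<And>g w. w \<in> space M - N \<Longrightarrow> act g w \<in> space M - N \<Longrightarrow> f (act g w) = \<alpha> g w (f w)"
    using equivariant_section_strict[OF f eq] by blast
  define A where "A p = f -` ball p \<gamma> \<inter> space M - N" for p
  have Aev: "A p \<in> events" for p unfolding A_def using f N(1) by (intro sets.Diff measurable_sets) auto
  obtain D :: "'a set" where D: "countable D" "\<And>x e. e > 0 \<Longrightarrow> \<exists>d\<in>D. dist x d < e"
    by (rule countable_dense_UNIV) (rule that)
  have "\<exists>p\<in>D. prob (A p) > 0"
  proof (rule ccontr)
    assume "\<not> ?thesis"
    hence "prob (A p) = 0" if "p \<in> D" for p using that measure_nonneg[of M "A p"] by (meson antisym_conv not_less)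
    hence "A p \<in> null_sets M" if "p \<in> D" for p using that Aev by (simp add: emeasure_eq_measure null_setsI)
    hence "(\<Union>p\<in>D. A p) \<in> null_sets M" using D(1) by (intro null_sets_UN') auto
    moreover have "space M \<subseteq> (\<Union>p\<in>D. A p) \<union> N"
    proof
      fix w assume w: "w \<in> space M"
      obtain p where "p \<in> D" "dist (f w) p < \<gamma>" using D(2)[OF \<gamma>] by blast
      thus "w \<in> (\<Union>p\<in>D. A p) \<union> N" using w by (auto simp: A_def dist_commute)
    qed
    ultimately have "space M \<in> null_sets M" using N(1) null_sets.Un null_sets_subset sets.top by metis
    thus False using emeasure_space_1 by auto
  qed
  then obtain p where p: "prob (A p) > 0" by blast
  obtain y where y: "dist p y \<ge> \<eta>" 
  proof -
    have "dist a b \<le> dist p a + dist p b" by (rule dist_triangle3)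
    thus ?thesis using that[of a] that[of b] by (auto simp: \<eta>_def) linarith
  qed
  obtain h k where hk: "median_halfspace h" "ball p \<gamma> \<subseteq> h" "h \<subseteq> k" "ball y \<gamma> \<inter> k = {}" using nest[OF y] unfolding nested_separation_def by blast
  have "p \<in> interior h" using hk(2) \<gamma> by (intro interiorI[of "ball p \<gamma>"]) auto
  moreover have "y \<in> interior (- h)" using hk(3,4) \<gamma> by (intro interiorI[of "ball y \<gamma>"]) auto
  ultimately have "thick_halfspace h" using hk(1) by (auto simp: thick_halfspace_def)
  then obtain g w where gw: "w \<in> A p" "act g w \<in> A p" "\<alpha> g w ` h \<subseteq> - h"
    using ne p Aev unfolding nonelementary_cocycle_def by blast
  have "f (act g w) = \<alpha> g w (f w)" using N(2)[of w g] gw by (auto simp: A_def)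
  moreover have "f w \<in> h" "f (act g w) \<in> h" using gw hk(2) by (auto simp: A_def)
  ultimately show False using gw(3) by auto
qed

end

theorem theorem9:
  fixes M :: "'w measure"
    and act :: "'g::{topological_group_add, t2_space, second_countable_topology} \<Rightarrow> 'w \<Rightarrow> 'w"
    and \<alpha> :: "'g \<Rightarrow> 'w \<Rightarrow> 'a::{polish_space, median_space} \<Rightarrow> 'a"
  assumes "connected (UNIV :: 'a set)"
    and "finite_rank TYPE('a)"
    and "locally_compact_space (euclidean :: 'g topology)"
    and "property_T TYPE('g)"
    and "standard_borel M"
    and "pmp_action M act"
    and "ergodic_action M act"
    and "isometric_cocycle M act \<alpha>"
  shows "(\<exists>f \<in> borel_measurable M. equivariant_section M act \<alpha> f) \<and>
         elementary_cocycle M act \<alpha>"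
proof -
  obtain m :: "'g measure" where m: "right_haar m" using right_haar_exists[OF assms(3)] by blast
  interpret pmp_action M act by (rule assms(6))
  interpret isometric_cocycle_action M act \<alpha> m
    by unfold_locales (rule assms(8) m assms(5))+
  obtain t v c where c: "t > 0" "v \<noteq> 0" "\<And>n. finite (fsupp (c n))"
    "\<And>n. (\<integral>w. bump_norm t (fdiff (c (Suc n)) (c n)) w \<partial>M) \<le> (1/2)^n"
    "\<And>k. (\<lambda>n. \<integral>w. bump_norm t (fdiff (translate k (c n)) (c n)) w \<partial>M) \<longlonglongrightarrow> 0"
    "(\<lambda>n. \<integral>w. bumps t (c n) (orbit w) (F 0 w) \<partial>M) \<longlonglongrightarrow> v"
    by (rule property_T_invariant_bumps[OF assms(4)]) (rule that)
  interpret invariant_bumps M act \<alpha> m t v c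
    by unfold_locales (rule c assms(1,2,7))+
  have "elementary_cocycle M act \<alpha>"
    by (rule equivariant_section_elementary[OF assms(2) section_map_measurable section_map_equivariant])
  thus ?thesis using section_map_measurable section_map_equivariant by blast
qed

end
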